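(* Let $n\ge1$. For every simplified grove $G$ of size $n$ there is a finite sequence of simplified groves $G=G_0,G_1,\dots,G_k$ of size $n$ such that each $G_{t+1}$ is obtained from $G_t$ by a spin and $G_k$ is the target grove of size $n$.
   Context: Let $V_n=\{(i,j)\in\mathbb{Z}^2 : |i|+|j|\le n,\ j\le 0,\ i+j\equiv n \pmod 2\}$. Two points of $V_n$ are joined by a lattice edge if they differ by $(\pm 2,0)$ or by $(\pm1,\pm1)$. A simplified grove of size $n$ is a graph $G$ with vertex set $V_n$ whose edges are lattice edges, such that (acyclicity) $G$ has no cycle, and (connectivity) each connected component of $G$ contains exactly one of the following sets of boundary vertices and each of these sets is contained in some component: the singletons $\{(-n,0)\},\{(n,0)\},\{(0,-n)\}$; the west pairs $\{(-i,0),(\frac{-n-i}{2},\frac{-n+i}{2})\}$ for $0<i<n$, $i\equiv n \pmod 2$; the east pairs $\{(i,0),(\frac{n+i}{2},\frac{-n+i}{2})\}$ for $0<i<n$, $i\equiv n\pmod 2$; the south pairs $\{(-n+i,-i),(n-i,-i)\}$ for $\frac n2<i<n$; and, if $n$ is even, the middle triplet $\{(0,0),(-\frac n2,-\frac n2),(\frac n2,-\frac n2)\}$. The target grove of size $n$ is the simplified grove of size $n$ whose edges are exactly: (i) for each $0\le i<n$ with $i\equiv n\pmod 2$, with $d=(n-i)/2$, the edges $\{(-i+t,-t),(-i+t+1,-t-1)\}$ for $0\le t<d$ and $\{(-i+d-2s,-d),(-i+d-2s-2,-d)\}$ for $0\le s<d$; (ii) for each $0<i<n$ with $i\equiv n\pmod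 2$, with $d=(n-i)/2$, the edges $\{(i+t,-t),(i+t+1,-t-1)\}$ for $0\le t<d$; (iii) for each $\frac n2<i<n$, the edges $\{(-n+i+2s,-i),(-n+i+2s+2,-i)\}$ for $0\le s<n-i$. Spins: for a vertex $p=(x,y)$, list its six potential neighbours in the cyclic order $UL=(x-1,y+1)$, $UR=(x+1,y+1)$, $R=(x+2,y)$, $DR=(x+1,y-1)$, $DL=(x-1,y-1)$, $L=(x-2,y)$ (then back to $UL$). A simplified grove $G'$ is obtained from a simplified grove $G$ by a spin with pivot $p$ if there are $u,v\in V_n$ which are consecutive in this cyclic order around $p$, with $\{p,u\}$ an edge of $G$ and $\{p,v\}$ not an edge of $G$, such that $G'$ is obtained from $G$ by deleting the edge $\{p,u\}$ and adding the edge $\{p,v\}$. *)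

theory Defs
  imports Main
begin

type_synonym point = "int \<times> int"

definition grove_vertices :: "nat \<Rightarrow> point set" where
  "grove_vertices n =
     {(i, j). \<bar>i\<bar> + \<bar>j\<bar> \<le> int n \<and> j \<le> 0 \<and> (i + j) mod 2 = int n mod 2}"

text \<open>The six potential neighbours, in the cyclic order UL, UR, R, DR, DL, L.\<close>

fun neighbours :: "point \<Rightarrow> point list" where
  "neighbours (x, y) =
     [(x - 1, y + 1), (x + 1, y + 1), (x + 2, y), (x + 1, y - 1), (x - 1, y - 1), (x - 2, y)]"

definition lattice_edges :: "nat \<Rightarrow> point set set" where
  "lattice_edges n =
     {{p, q} | p q. p \<in> grove_vertices n \<and> q \<in> grove_vertices n \<and>
        (fst q - fst p, snd q - snd p) \<in> {2, -2} \<times> {0} \<union> {1, -1} \<times> {1, -1}}"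

text \<open>A graph on the fixed vertex set \<^term>\<open>grove_vertices n\<close> is represented by its set of
  edges, an edge being the set of its two endpoints.\<close>

definition is_cycle :: "'a set set \<Rightarrow> 'a list \<Rightarrow> bool" where
  "is_cycle G vs \<longleftrightarrow> 3 \<le> length vs \<and> distinct vs \<and>
     (\<forall>k < length vs. {vs ! k, vs ! ((k + 1) mod length vs)} \<in> G)"

definition acyclic_graph :: "'a set set \<Rightarrow> bool" where
  "acyclic_graph G \<longleftrightarrow> (\<nexists>vs. is_cycle G vs)"

definition component_of :: "'a set set \<Rightarrow> 'a \<Rightarrow> 'a set" where
  "component_of G p = {q. (p, q) \<in> {(a, b). {a, b} \<in> G}\<^sup>*}"

definition components_of :: "'a set \<Rightarrow> 'a set set \<Rightarrow> 'a set set" where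
  "components_of V G = component_of G ` V"

text \<open>All integer divisions by 2 below are exact, by the parity conditions.\<close>

definition corner_singletons :: "nat \<Rightarrow> point set set" where
  "corner_singletons n = {{(- int n, 0)}, {(int n, 0)}, {(0, - int n)}}"

definition west_pairs :: "nat \<Rightarrow> point set set" where
  "west_pairs n = {{(- i, 0), ((- int n - i) div 2, (- int n + i) div 2)} | i :: int.
     0 < i \<and> i < int n \<and> i mod 2 = int n mod 2}"

definition east_pairs :: "nat \<Rightarrow> point set set" where
  "east_pairs n = {{(i, 0), ((int n + i) div 2, (- int n + i) div 2)} | i :: int.
     0 < i \<and> i < int n \<and> i mod 2 = int n mod 2}"

definition south_pairs :: "nat \<Rightarrow> point set set" where
  "south_pairs n = {{(- int n + i, - i), (int n - i, - i)} | i :: int.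
     int n < 2 * i \<and> i < int n}"

definition middle_triplets :: "nat \<Rightarrow> point set set" where
  "middle_triplets n =
     (if even n
      then {{(0, 0), (- (int n div 2), - (int n div 2)), (int n div 2, - (int n div 2))}}
      else {})"

definition boundary_sets :: "nat \<Rightarrow> point set set" where
  "boundary_sets n = corner_singletons n \<union> west_pairs n \<union> east_pairs n \<union>
     south_pairs n \<union> middle_triplets n"

definition simplified_grove :: "nat \<Rightarrow> point set set \<Rightarrow> bool" where
  "simplified_grove n G \<longleftrightarrow>
     G \<subseteq> lattice_edges n \<and>
     acyclic_graph G \<and>
     (\<forall>C \<in> components_of (grove_vertices n) G. \<exists>!B. B \<in> boundary_sets n \<and> B \<subseteq> C) \<and>
     (\<forall>B \<in> boundary_sets n. \<exists>C \<in> components_of (grove_vertices n) G. B \<subseteq> C)"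

definition target_grove :: "nat \<Rightarrow> point set set" where
  "target_grove n =
     {{(- i + t, - t), (- i + t + 1, - t - 1)} | i t :: int.
        0 \<le> i \<and> i < int n \<and> i mod 2 = int n mod 2 \<and> 0 \<le> t \<and> t < (int n - i) div 2} \<union>
     {{(- i + d - 2 * s, - d), (- i + d - 2 * s - 2, - d)} | i d s :: int.
        0 \<le> i \<and> i < int n \<and> i mod 2 = int n mod 2 \<and> d = (int n - i) div 2 \<and>
        0 \<le> s \<and> s < d} \<union>
     {{(i + t, - t), (i + t + 1, - t - 1)} | i t :: int.
        0 < i \<and> i < int n \<and> i mod 2 = int n mod 2 \<and> 0 \<le> t \<and> t < (int n - i) div 2} \<union>
     {{(- int n + i + 2 * s, - i), (- int n + i + 2 * s + 2, - i)} | i s :: int.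
        int n < 2 * i \<and> i < int n \<and> 0 \<le> s \<and> s < int n - i}"

text \<open>Consecutive in either direction: a spin may turn clockwise or counterclockwise.\<close>

definition consecutive_around :: "point \<Rightarrow> point \<Rightarrow> point \<Rightarrow> bool" where
  "consecutive_around p u v \<longleftrightarrow>
     (\<exists>k < 6. {u, v} = {neighbours p ! k, neighbours p ! ((k + 1) mod 6)})"

definition spin_at :: "nat \<Rightarrow> point \<Rightarrow> point set set \<Rightarrow> point set set \<Rightarrow> bool" where
  "spin_at n p G G' \<longleftrightarrow>
     (\<exists>u \<in> grove_vertices n. \<exists>v \<in> grove_vertices n.
        consecutive_around p u v \<and> {p, u} \<in> G \<and> {p, v} \<notin> G \<and>
        G' = insert {p, v} (G - {{p, u}}))"

definition spin :: "nat \<Rightarrow> point set set \<Rightarrow> point set set \<Rightarrow> bool" where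
  "spin n G G' \<longleftrightarrow> (\<exists>p \<in> grove_vertices n. spin_at n p G G')"

end

(*
  A spin on the edge pu stays inside the class of groves if v lies on the side of u after pu is
  deleted, or if v lies in a different component and the side of p contains no boundary vertex.
  In particular two edges of a triangle can always be rotated, and an interior leaf can be moved to
  any of its neighbours.

  With these moves every grove is brought to one normal form; since spins are reversible and the
  target is itself a grove, this suffices.  At each corner the paths around it are straightened one
  line after the other.  To add the next vertex q of a line, q is first made a leaf and then
  attached; when two branches of a foreign component leave q in non-consecutive directions, the
  vertex between them is freed first, and this recursion ends because the chains involved become
  shorter.  Once all boundary sets are joined by straight lines, the remaining vertices
  carry only branches without boundary vertices and are turned, row by row, to their left neighbour.
  The resulting grove is determined by its lines and these edges.
*)

theory Submission
  imports Defs
begin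

section \<open>Connectivity in graphs given by edge sets\<close>

text \<open>Components are replaced by labels \<open>lb\<close> of boundary vertices: whether a spin
  is admissible then depends only on how it affects \<open>conn\<close> between boundary vertices.
  The obstacle is a vertex of the next line that belongs to a component unrelated to the two
  neighbouring lines, since nothing is known about how that component winds. No separation theorem
  is invoked; only straight chains along antidiagonals are compared. A chain in another component,
  parallel to a given one, must break early, because otherwise an edge at the far end of the given
  chain would join the two. Such recursions alter edges away from the vertex under treatment, so the
  invariants record where deleted edges may lie, and this alone shows that finished lines survive.
  The target is in general not the normal form: it joins a west pair by a diagonal followed by a
  row, the normal form by a straight line. Hence the use of reversibility and the separate proof
  that the target is a grove.\<close>

definition conn :: "'a set set \<Rightarrow> 'a \<Rightarrow> 'a \<Rightarrow> bool" where
  "conn G a b \<longleftrightarrow> (a, b) \<in> {(a, b). {a, b} \<in> G}\<^sup>*"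

lemma conn_refl [simp]: "conn G a a"
  by (simp add: conn_def)

lemma conn_edge: "{a, b} \<in> G \<Longrightarrow> conn G a b"
  by (auto simp: conn_def)

lemma conn_trans [trans]: "conn G a b \<Longrightarrow> conn G b c \<Longrightarrow> conn G a c"
  unfolding conn_def by (rule rtrancl_trans)

lemma conn_sym: "conn G a b \<Longrightarrow> conn G b a"
proof -
  have "sym {(a, b). {a, b} \<in> G}"
    by (auto simp: sym_def insert_commute)
  then show "conn G a b \<Longrightarrow> conn G b a"
    unfolding conn_def by (meson sym_rtrancl symD)
qed

lemma conn_commute: "conn G a b \<longleftrightarrow> conn G b a"
  using conn_sym by metis

lemma conn_mono: "conn G a b \<Longrightarrow> G \<subseteq> H \<Longrightarrow> conn H a b"
  unfolding conn_def by (erule rtrancl_mono[THEN subsetD, rotated]) auto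

lemma conn_induct [consumes 1, case_names refl step]:
  assumes "conn G a b" "P a"
    "\<And>y z. conn G a y \<Longrightarrow> {y, z} \<in> G \<Longrightarrow> P y \<Longrightarrow> P z"
  shows "P b"
  using assms(1) unfolding conn_def
proof (induction rule: rtrancl_induct)
  case base
  show ?case by (rule assms(2))
next
  case (step y z)
  then show ?case using assms(3)[of y z] by (auto simp: conn_def)
qed

lemma conn_insert:
  "conn (insert {a, b} G) x y \<longleftrightarrow>
     conn G x y \<or> (conn G x a \<and> conn G b y) \<or> (conn G x b \<and> conn G a y)"
proof
  assume "conn (insert {a, b} G) x y"
  then show "conn G x y \<or> (conn G x a \<and> conn G b y) \<or> (conn G x b \<and> conn G a y)"
  proof (induction rule: conn_induct)
    case refl
    then show ?case by simp
  next
    case (step y z)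
    show ?case
    proof (cases "{y, z} \<in> G")
      case True
      then show ?thesis using step.IH conn_edge conn_trans by metis
    next
      case False
      then have "y = a \<and> z = b \<or> y = b \<and> z = a"
        using step.hyps(2) by (auto simp: doubleton_eq_iff)
      then show ?thesis using step.IH by auto
    qed
  qed
next
  have e: "conn (insert {a, b} G) a b" by (rule conn_edge) simp
  have m: "conn G u v \<Longrightarrow> conn (insert {a, b} G) u v" for u v
    by (erule conn_mono) auto
  assume "conn G x y \<or> (conn G x a \<and> conn G b y) \<or> (conn G x b \<and> conn G a y)"
  then show "conn (insert {a, b} G) x y"
    by (elim disjE conjE)
      (blast intro: m e conn_sym[OF e] conn_trans)+
qed

lemma conn_split:
  assumes "{a, b} \<in> G"
  shows "conn G x y \<longleftrightarrow> conn (G - {{a, b}}) x y \<or>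
     (conn (G - {{a, b}}) x a \<and> conn (G - {{a, b}}) b y) \<or>
     (conn (G - {{a, b}}) x b \<and> conn (G - {{a, b}}) a y)"
  using conn_insert[of a b "G - {{a, b}}" x y] assms by (simp add: insert_absorb)

lemma conn_isolated:
  assumes "conn G v y" "\<And>x. {v, x} \<notin> G"
  shows "y = v"
  using assms(1)
proof (induction rule: conn_induct)
  case (step y z)
  then show ?case using assms(2) by auto
qed simp

lemma conn_first_edge:
  assumes "conn G v y" "y \<noteq> v"
  obtains x where "{v, x} \<in> G"
  using assms conn_isolated by metis

lemma conn_distinct_path:
  assumes "conn G a b"
  shows "\<exists>vs. vs \<noteq> [] \<and> hd vs = a \<and> last vs = b \<and> distinct vs \<and>
    successively (\<lambda>x y. {x, y} \<in> G) vs"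
  using assms
proof (induction rule: conn_induct)
  case refl
  show ?case by (rule exI[of _ "[a]"]) simp
next
  case (step y z)
  then obtain vs where vs: "vs \<noteq> []" "hd vs = a" "last vs = y" "distinct vs"
    "successively (\<lambda>x y. {x, y} \<in> G) vs" by blast
  show ?case
  proof (cases "z \<in> set vs")
    case True
    then obtain ys zs where "vs = ys @ z # zs" by (meson split_list)
    then show ?thesis using vs
      by (intro exI[of _ "ys @ [z]"])
        (auto simp: successively_append_iff hd_append split: if_splits)
  next
    case False
    then show ?thesis using vs step.hyps
      by (intro exI[of _ "vs @ [z]"]) (auto simp: successively_append_iff)
  qed
qed

section \<open>Forests: deleting an edge, closing a cycle, rankings\<close>

text \<open>Stated through deletion of an edge because every spin deletes one edge and adds another.
  A loop violates the condition, since its two ends coincide and stay connected.\<close>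

definition forest :: "'a set set \<Rightarrow> bool" where
  "forest G \<longleftrightarrow> (\<forall>a b. {a, b} \<in> G \<longrightarrow> \<not> conn (G - {{a, b}}) a b)"

text \<open>A simple path that avoids an edge between its ends closes up with this edge to a cycle.
  Loops are excluded separately because \<open>is_cycle\<close> starts at length 3.\<close>

lemma acyclic_graph_imp_forest:
  assumes "acyclic_graph G" "\<And>a. {a} \<notin> G"
  shows "forest G"
  unfolding forest_def
proof (intro allI impI notI)
  fix a b assume e: "{a, b} \<in> G" and "conn (G - {{a, b}}) a b"
  then obtain vs where vs: "vs \<noteq> []" "hd vs = a" "last vs = b" "distinct vs"
    "successively (\<lambda>x y. {x, y} \<in> G - {{a, b}}) vs"
    using conn_distinct_path[of "G - {{a, b}}" a b] by auto
  have ab: "a \<noteq> b" using assms(2) e by auto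
  have h: "vs ! 0 = a" "vs ! (length vs - 1) = b"
    using vs by (auto simp: hd_conv_nth last_conv_nth)
  have s: "{vs ! k, vs ! Suc k} \<in> G \<and> {vs ! k, vs ! Suc k} \<noteq> {a, b}"
    if "Suc k < length vs" for k
    using vs(5) that unfolding successively_conv_nth by auto
  \<comment> \<open>A path with only two vertices would consist of the deleted edge itself.\<close>
  have len: "length vs \<ge> 3"
  proof (rule ccontr)
    assume "\<not> length vs \<ge> 3"
    moreover have "length vs \<noteq> 0" "length vs \<noteq> 1" using vs(1) h ab by auto
    ultimately have "length vs = 2" by linarith
    then show False using s[of 0] h by simp
  qed
  have "is_cycle G vs"
    unfolding is_cycle_def
  proof (intro conjI len vs(4) allI impI)
    fix k assume k: "k < length vs"
    show "{vs ! k, vs ! ((k + 1) mod length vs)} \<in> G"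
    proof (cases "Suc k < length vs")
      case True
      then show ?thesis using s by simp
    next
      case False
      then have "k = length vs - 1" "Suc k = length vs" using k by auto
      then have "k = length vs - 1" "(k + 1) mod length vs = 0" by simp_all
      then show ?thesis using h e by (simp add: insert_commute)
    qed
  qed
  then show False using assms(1) by (auto simp: acyclic_graph_def)
qed

lemma forest_imp_acyclic_graph:
  assumes "forest G"
  shows "acyclic_graph G"
  unfolding acyclic_graph_def
proof
  assume "\<exists>vs. is_cycle G vs"
  then obtain vs where len: "3 \<le> length vs" and d: "distinct vs"
    and c: "\<And>k. k < length vs \<Longrightarrow> {vs ! k, vs ! ((k + 1) mod length vs)} \<in> G"
    unfolding is_cycle_def by blast
  define l where "l = length vs - 1"
  have e: "{vs ! l, vs ! 0} \<in> G" using c[of l] len by (cases vs) (auto simp: l_def)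
  have "k \<le> l \<Longrightarrow> conn (G - {{vs ! l, vs ! 0}}) (vs ! 0) (vs ! k)" for k
  proof (induction k)
    case (Suc k)
    have "{vs ! k, vs ! Suc k} \<in> G" using c[of k] Suc.prems len by (auto simp: l_def)
    \<comment> \<open>As the vertices are distinct, equality forces \<open>k = l\<close>, or
      \<open>k = 0\<close> and \<open>l = 1\<close>; the first is out of range, the second
      contradicts the length.\<close>
    moreover have "{vs ! k, vs ! Suc k} \<noteq> {vs ! l, vs ! 0}"
    proof
      assume "{vs ! k, vs ! Suc k} = {vs ! l, vs ! 0}"
      then consider "vs ! k = vs ! 0" "vs ! Suc k = vs ! l" | "vs ! k = vs ! l"
        by (auto simp: doubleton_eq_iff)
      then have "k = 0 \<and> Suc k = l \<or> k = l"
        using Suc.prems len nth_eq_iff_index_eq[OF d, of k 0] nth_eq_iff_index_eq[OF d, of k l]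
          nth_eq_iff_index_eq[OF d, of "Suc k" l] unfolding l_def by cases linarith+
      then show False using Suc.prems len by (auto simp: l_def)
    qed
    ultimately have "conn (G - {{vs ! l, vs ! 0}}) (vs ! k) (vs ! Suc k)"
      by (intro conn_edge) auto
    moreover have "conn (G - {{vs ! l, vs ! 0}}) (vs ! 0) (vs ! k)" using Suc by simp
    ultimately show ?case by (rule conn_trans[rotated])
  qed simp
  from conn_sym[OF this[OF order_refl]] e assms show False unfolding forest_def by blast
qed

text \<open>A path between the ends of an old edge that avoids this edge has to cross the new one;
  together with the old edge it would have connected \<open>p\<close> with \<open>v\<close>
  before.\<close>

lemma forest_insert:
  assumes "forest G" "\<not> conn G p v"
  shows "forest (insert {p, v} G)"
  unfolding forest_def
proof (intro allI impI notI)
  fix a b assume e: "{a, b} \<in> insert {p, v} G"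
    and c: "conn (insert {p, v} G - {{a, b}}) a b"
  have nin: "{p, v} \<notin> G" using assms(2) conn_edge by metis
  show False
  proof (cases "{a, b} = {p, v}")
    case True
    then have "conn G a b" using c nin by simp
    with True assms(2) show False by (auto simp: doubleton_eq_iff dest: conn_sym)
  next
    case False
    with e have ab: "{a, b} \<in> G" by auto
    let ?H = "G - {{a, b}}"
    have "insert {p, v} G - {{a, b}} = insert {p, v} ?H" using False by auto
    with c have "conn ?H a b \<or> (conn ?H a p \<and> conn ?H v b) \<or> (conn ?H a v \<and> conn ?H p b)"
      using conn_insert[of p v ?H a b] by simp
    moreover have "\<not> conn ?H a b" using assms(1) ab by (auto simp: forest_def)
    moreover have "conn ?H x y \<Longrightarrow> conn G x y" for x y by (erule conn_mono) auto
    ultimately have "conn G a p \<and> conn G v b \<or> conn G a v \<and> conn G p b" by blast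
    then show False
      using assms(2) conn_edge[OF ab] by (meson conn_trans conn_sym)
  qed
qed

lemma forest_subset: "forest G \<Longrightarrow> H \<subseteq> G \<Longrightarrow> forest H"
  unfolding forest_def
  using conn_mono[of "H - _" _ _ "G - _"] by blast

text \<open>Each edge is owned by its higher end, and a vertex owns at most one edge. On a cycle the
  vertex of maximal rank would own both of its cycle edges, whose other ends are distinct.\<close>

lemma forest_ranking:
  fixes rk :: "'a \<Rightarrow> nat"
  assumes "\<And>e. e \<in> G \<Longrightarrow> \<exists>v. e = {v, out v} \<and> rk (out v) < rk v"
  shows "forest G"
proof (rule acyclic_graph_imp_forest)
  show "{a} \<notin> G" for a
  proof
    assume "{a} \<in> G"
    then obtain v where "{a} = {v, out v}" "rk (out v) < rk v" using assms by blast
    then show False by (auto simp: singleton_insert_inj_eq)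
  qed
  have low: "y = out x" if "{x, y} \<in> G" "rk y \<le> rk x" for x y
  proof -
    obtain v where "{x, y} = {v, out v}" "rk (out v) < rk v" using assms \<open>{x, y} \<in> G\<close> by blast
    then show ?thesis using that by (auto simp: doubleton_eq_iff)
  qed
  show "acyclic_graph G"
    unfolding acyclic_graph_def
  proof
    assume "\<exists>vs. is_cycle G vs"
    then obtain vs where len: "3 \<le> length vs" and d: "distinct vs"
      and c: "\<And>k. k < length vs \<Longrightarrow> {vs ! k, vs ! ((k + 1) mod length vs)} \<in> G"
      unfolding is_cycle_def by blast
    let ?M = "Max (rk ` set vs)"
    have "?M \<in> rk ` set vs" using len by (intro Max_in) auto
    then obtain k where k: "k < length vs" "rk (vs ! k) = ?M"
      by (auto simp: in_set_conv_nth)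
    have mx: "rk (vs ! l) \<le> rk (vs ! k)" if "l < length vs" for l
      using that k by (auto intro!: Max_ge)
    define s where "s = (k + 1) mod length vs"
    define p where "p = (if k = 0 then length vs - 1 else k - 1)"
    have s: "s < length vs" "s = (if Suc k = length vs then 0 else Suc k)"
      unfolding s_def using len k by (cases vs; force)+
    have p: "p < length vs" "(p + 1) mod length vs = k"
      using len k by (auto simp: p_def)
    have "vs ! s = out (vs ! k)"
      using c[OF k(1)] mx[OF s(1)] low by (simp add: s_def)
    moreover have "vs ! p = out (vs ! k)"
      using c[OF p(1)] mx[OF p(1)] low p(2) by (simp add: insert_commute)
    ultimately have "s = p" using d s(1) p(1) by (metis nth_eq_iff_index_eq)
    then show False using len k s(2) by (auto simp: p_def split: if_splits)
  qed
qed

section \<open>Groves through boundary labels\<close>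

definition nodes :: "nat \<Rightarrow> point set" where
  "nodes n = {(x, y). (x, y) \<in> grove_vertices n \<and> (y = 0 \<or> \<bar>x\<bar> - y = int n)}"

text \<open>The numbers \<open>n + y - x\<close>, \<open>n + y + x\<close> and \<open>- 2 * y\<close> are twice the barycentric weights of
  a vertex with respect to the west, east and south corner.  Two boundary vertices belong to the
  same boundary set iff their largest weight is the same and sits at the same corner; the middle
  triplet is where the maximum is attained twice.\<close>

definition lb :: "nat \<Rightarrow> point \<Rightarrow> int \<times> int" where
  "lb n = (\<lambda>(x, y).
     if 0 > x \<and> int n + 3 * y > x then (0, int n + y - x)
     else if x > 0 \<and> int n + 3 * y > - x then (1, int n + y + x)
     else if x > int n + 3 * y \<and> - x > int n + 3 * y then (2, - 2 * y)
     else (3, 0))"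

definition block :: "nat \<Rightarrow> point \<Rightarrow> point set" where
  "block n x = {y \<in> nodes n. lb n y = lb n x}"

lemma grove_vertices_iff:
  "(x, y) \<in> grove_vertices n \<longleftrightarrow> \<bar>x\<bar> - y \<le> int n \<and> y \<le> 0 \<and> even (x + y + int n)"
  unfolding grove_vertices_def by (auto; presburger)

lemma nodes_iff:
  "(x, y) \<in> nodes n \<longleftrightarrow> (y = 0 \<and> - int n \<le> x \<and> x \<le> int n \<and> even (x + int n)) \<or>
     (- int n \<le> y \<and> y \<le> 0 \<and> (x = int n + y \<or> x = - int n - y))"
  unfolding nodes_def by (auto simp: grove_vertices_iff)

lemma lb_eq_iff:
  "lb n (x, y) = (0, c) \<longleftrightarrow> x < 0 \<and> x < int n + 3 * y \<and> c = int n + y - x"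
  "lb n (x, y) = (1, c) \<longleftrightarrow> x > 0 \<and> - x < int n + 3 * y \<and> c = int n + y + x"
  "lb n (x, y) = (2, c) \<longleftrightarrow> x > int n + 3 * y \<and> - x > int n + 3 * y \<and> c = - 2 * y"
  "lb n (x, y) = (3, c) \<longleftrightarrow> \<not> (x < 0 \<and> x < int n + 3 * y) \<and>
     \<not> (x > 0 \<and> - x < int n + 3 * y) \<and> \<not> (x > int n + 3 * y \<and> - x > int n + 3 * y) \<and> c = 0"
  unfolding lb_def by auto

text \<open>The case \<open>i = n\<close>, \<open>d = 0\<close> is included: the pair degenerates to
  the corner singleton. The same happens in \<open>block_east\<close> and, for \<open>i = n\<close>,
  in \<open>block_south\<close>, so corners need no treatment of their own.\<close>

lemma block_west:
  assumes i: "0 < i" "i \<le> int n" and d: "int n = i + 2 * d"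
  shows "block n (- i, 0) = {(- i, 0), (- i - d, - d)}"
proof -
  have l: "lb n (- i, 0) = (0, int n + i)" using assms by (simp add: lb_eq_iff)
  have "(x, y) \<in> nodes n \<and> lb n (x, y) = (0, int n + i) \<longleftrightarrow> (x, y) \<in> {(- i, 0), (- i - d, - d)}" for x y
    unfolding nodes_iff lb_eq_iff using assms by (auto; arith)
  then show ?thesis unfolding block_def l by (intro set_eqI; unfold mem_Collect_eq; metis surj_pair)
qed

lemma block_east:
  assumes i: "0 < i" "i \<le> int n" and d: "int n = i + 2 * d"
  shows "block n (i, 0) = {(i, 0), (i + d, - d)}"
proof -
  have l: "lb n (i, 0) = (1, int n + i)" using assms by (simp add: lb_eq_iff)
  have "(x, y) \<in> nodes n \<and> lb n (x, y) = (1, int n + i) \<longleftrightarrow> (x, y) \<in> {(i, 0), (i + d, - d)}" for x y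
    unfolding nodes_iff lb_eq_iff using assms by (auto; arith)
  then show ?thesis unfolding block_def l by (intro set_eqI; unfold mem_Collect_eq; metis surj_pair)
qed

lemma block_middle:
  assumes d: "int n = 2 * d" "d > 0"
  shows "block n (0, 0) = {(0, 0), (- d, - d), (d, - d)}"
proof -
  have l: "lb n (0, 0) = (3, 0)" using assms by (simp add: lb_eq_iff)
  have a: "(x, y) \<in> {(0, 0), (- d, - d), (d, - d)}"
    if h: "(x, y) \<in> nodes n" "lb n (x, y) = (3, 0)" for x y
  proof -
    consider "y = 0" | "x = int n + y" "y \<le> 0" | "x = - int n - y" "y \<le> 0"
      using h(1) unfolding nodes_iff by blast
    then show ?thesis using h(2) assms unfolding lb_eq_iff
      by cases (simp_all, linarith+)
  qed
  have b: "z \<in> nodes n \<and> lb n z = (3, 0)" if "z \<in> {(0, 0), (- d, - d), (d, - d)}" for z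
    using that assms by (auto simp: nodes_iff lb_eq_iff)
  show ?thesis unfolding block_def l using a b by (intro set_eqI; unfold mem_Collect_eq; metis surj_pair)
qed

lemma block_south:
  assumes d: "int n < 2 * i" "i \<le> int n"
  shows "block n (int n - i, - i) = {(- int n + i, - i), (int n - i, - i)}"
proof -
  have l: "lb n (int n - i, - i) = (2, 2 * i)" using assms by (simp add: lb_eq_iff)
  have "(x, y) \<in> nodes n \<and> lb n (x, y) = (2, 2 * i) \<longleftrightarrow> (x, y) \<in> {(- int n + i, - i), (int n - i, - i)}" for x y
    unfolding nodes_iff lb_eq_iff using assms by (auto; arith)
  then show ?thesis unfolding block_def l by (intro set_eqI; unfold mem_Collect_eq; metis surj_pair)
qed

lemma node_in_boundary_set:
  assumes "x \<in> nodes n"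
  shows "\<exists>B \<in> boundary_sets n. x \<in> B"
proof -
  obtain a b where x: "x = (a, b)" by fastforce
  have c: "{(- int n, 0)} \<in> boundary_sets n" "{(int n, 0)} \<in> boundary_sets n"
    "{(0, - int n)} \<in> boundary_sets n" by (auto simp: boundary_sets_def corner_singletons_def)
  have w: "{(- i, 0), (- i - d, - d)} \<in> boundary_sets n" if "0 < i" "0 < d" "int n = i + 2 * d" for i d
  proof -
    have "(- int n - i) div 2 = - i - d" "(- int n + i) div 2 = - d" using that by auto
    then have "{(- i, 0), (- i - d, - d)} = {(- i, 0), ((- int n - i) div 2, (- int n + i) div 2)}" by simp
    moreover have "i mod 2 = int n mod 2" "i < int n" using that by auto
    ultimately have "{(- i, 0), (- i - d, - d)} \<in> west_pairs n" using that unfolding west_pairs_def by blast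
    then show ?thesis by (simp add: boundary_sets_def)
  qed
  have e: "{(i, 0), (i + d, - d)} \<in> boundary_sets n" if "0 < i" "0 < d" "int n = i + 2 * d" for i d
  proof -
    have "(int n + i) div 2 = i + d" "(- int n + i) div 2 = - d" using that by auto
    then have "{(i, 0), (i + d, - d)} = {(i, 0), ((int n + i) div 2, (- int n + i) div 2)}" by simp
    moreover have "i mod 2 = int n mod 2" "i < int n" using that by auto
    ultimately have "{(i, 0), (i + d, - d)} \<in> east_pairs n" using that unfolding east_pairs_def by blast
    then show ?thesis by (simp add: boundary_sets_def)
  qed
  have s: "{(- int n + i, - i), (int n - i, - i)} \<in> boundary_sets n" if "int n < 2 * i" "i < int n" for i
    using that by (auto simp: boundary_sets_def south_pairs_def)
  have m: "{(0, 0), (- d, - d), (d, - d)} \<in> boundary_sets n" if "int n = 2 * d" for d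
  proof -
    have "even (int n)" "int n div 2 = d" using that by auto
    then show ?thesis by (auto simp: boundary_sets_def middle_triplets_def)
  qed
  consider (top) "b = 0" "- int n \<le> a" "a \<le> int n" "even (a + int n)"
    | (east) "- int n \<le> b" "b \<le> 0" "a = int n + b" | (west) "- int n \<le> b" "b \<le> 0" "a = - int n - b"
    using assms x nodes_iff by metis
  then show ?thesis
  proof cases
    case top
    consider "a = int n" | "a = - int n" | "0 < a" "a < int n" | "a = 0" | "- int n < a" "a < 0"
      using top by linarith
    then show ?thesis
    proof cases
      case 3
      have "\<exists>d. int n = a + 2 * d" using top(4) by presburger
      then obtain d where "int n = a + 2 * d" by blast
      then show ?thesis using 3 top x by (intro bexI[OF _ e[of a d]]) auto
    next
      case 4
      obtain d where "int n = 2 * d" using top(4) 4 by (auto elim: evenE)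
      then show ?thesis using 4 top x by (intro bexI[OF _ m[of d]]) auto
    next
      case 5
      have "\<exists>d. int n = - a + 2 * d" using top(4) by presburger
      then obtain d where "int n = - a + 2 * d" by blast
      then show ?thesis using 5 top x by (intro bexI[OF _ w[of "- a" d]]) auto
    qed (use c top x in auto)
  next
    case east
    consider "b = 0" | "b = - int n" | "b < 0" "0 < int n + 2 * b" | "int n + 2 * b = 0" | "- int n < b" "int n + 2 * b < 0"
      using east by linarith
    then show ?thesis
    proof cases
      case 3
      then show ?thesis using east x by (intro bexI[OF _ e[of "int n + 2 * b" "- b"]]) auto
    next
      case 4
      then show ?thesis using east x by (intro bexI[OF _ m[of "- b"]]) auto
    next
      case 5
      then show ?thesis using east x by (intro bexI[OF _ s[of "- b"]]) auto
    qed (use c east x in auto)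
  next
    case west
    consider "b = 0" | "b = - int n" | "b < 0" "0 < int n + 2 * b" | "int n + 2 * b = 0" | "- int n < b" "int n + 2 * b < 0"
      using west by linarith
    then show ?thesis
    proof cases
      case 3
      then show ?thesis using west x by (intro bexI[OF _ w[of "int n + 2 * b" "- b"]]) auto
    next
      case 4
      then show ?thesis using west x by (intro bexI[OF _ m[of "- b"]]) auto
    next
      case 5
      then show ?thesis using west x by (intro bexI[OF _ s[of "- b"]]) auto
    qed (use c west x in auto)
  qed
qed

lemma boundary_set_imp_block:
  assumes "n \<ge> 1" "B \<in> boundary_sets n"
  shows "\<exists>x \<in> nodes n. B = block n x"
proof -
  have self: "x \<in> nodes n" if "x \<in> block n x" for x using that by (simp add: block_def)
  consider (corner) "B \<in> corner_singletons n" | (west) "B \<in> west_pairs n"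
    | (east) "B \<in> east_pairs n" | (south) "B \<in> south_pairs n" | (mid) "B \<in> middle_triplets n"
    using assms(2) by (auto simp: boundary_sets_def)
  then show ?thesis
  proof cases
    case corner
    then consider "B = {(- int n, 0)}" | "B = {(int n, 0)}" | "B = {(0, - int n)}"
      by (auto simp: corner_singletons_def)
    then show ?thesis
    proof cases
      case 1
      have "block n (- int n, 0) = B" using block_west[of "int n" n 0] 1 assms(1) by simp
      then show ?thesis using self 1 by blast
    next
      case 2
      have "block n (int n, 0) = B" using block_east[of "int n" n 0] 2 assms(1) by simp
      then show ?thesis using self 2 by blast
    next
      case 3
      have "block n (0, - int n) = B" using block_south[of n "int n"] 3 assms(1) by simp
      then show ?thesis using self 3 by blast
    qed
  next
    case west
    then obtain i where i: "0 < i" "i < int n" "i mod 2 = int n mod 2"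
      "B = {(- i, 0), ((- int n - i) div 2, (- int n + i) div 2)}"
      by (auto simp: west_pairs_def)
    define d where "d = (int n - i) div 2"
    have d: "int n = i + 2 * d" using i(3) unfolding d_def by presburger
    have "(- int n - i) div 2 = - i - d" "(- int n + i) div 2 = - d" using d by auto
    then have "block n (- i, 0) = B" using block_west[OF i(1) _ d] i by simp
    then show ?thesis using self i(4) by blast
  next
    case east
    then obtain i where i: "0 < i" "i < int n" "i mod 2 = int n mod 2"
      "B = {(i, 0), ((int n + i) div 2, (- int n + i) div 2)}"
      by (auto simp: east_pairs_def)
    define d where "d = (int n - i) div 2"
    have d: "int n = i + 2 * d" using i(3) unfolding d_def by presburger
    have "(int n + i) div 2 = i + d" "(- int n + i) div 2 = - d" using d by auto
    then have "block n (i, 0) = B" using block_east[OF i(1) _ d] i by simp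
    then show ?thesis using self i(4) by blast
  next
    case south
    then obtain i where i: "int n < 2 * i" "i < int n"
      "B = {(- int n + i, - i), (int n - i, - i)}"
      by (auto simp: south_pairs_def)
    then have "block n (int n - i, - i) = B" using block_south[OF i(1)] by simp
    then show ?thesis using self i(3) by blast
  next
    case mid
    then have "even n" by (auto simp: middle_triplets_def split: if_splits)
    then obtain m where m: "n = 2 * m" by auto
    then have "B = {(0, 0), (- int m, - int m), (int m, - int m)}"
      using mid by (auto simp: middle_triplets_def)
    moreover from this have "block n (0, 0) = B" using block_middle[of n "int m"] m assms(1) by simp
    ultimately show ?thesis using self by blast
  qed
qed

text \<open>Boundary sets are blocks, blocks are equal or disjoint, and the boundary sets cover
  \<open>nodes n\<close>; hence no block is missing.\<close>

lemma boundary_sets_eq: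
  assumes "n \<ge> 1"
  shows "boundary_sets n = block n ` nodes n"
proof
  show "boundary_sets n \<subseteq> block n ` nodes n"
    using boundary_set_imp_block[OF assms] by blast
  show "block n ` nodes n \<subseteq> boundary_sets n"
  proof
    fix C assume "C \<in> block n ` nodes n"
    then obtain x where x: "x \<in> nodes n" "C = block n x" by blast
    obtain B where B: "B \<in> boundary_sets n" "x \<in> B" using node_in_boundary_set[OF x(1)] by blast
    obtain y where "B = block n y" using boundary_set_imp_block[OF assms B(1)] by blast
    then have "B = C" using x B(2) by (auto simp: block_def)
    then show "C \<in> boundary_sets n" using B by simp
  qed
qed

text \<open>Unique existence inside components is replaced by conditions on pairs of vertices, which
  can be compared before and after a spin.\<close>

definition grove :: "nat \<Rightarrow> point set set \<Rightarrow> bool" where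
  "grove n G \<longleftrightarrow> G \<subseteq> lattice_edges n \<and> forest G \<and>
     (\<forall>v \<in> grove_vertices n. \<exists>x \<in> nodes n. conn G v x) \<and>
     (\<forall>x \<in> nodes n. \<forall>y \<in> nodes n. conn G x y \<longleftrightarrow> lb n x = lb n y)"

lemma nodes_subset: "nodes n \<subseteq> grove_vertices n"
  by (auto simp: nodes_def)

lemma component_of_conn: "component_of G = (\<lambda>p. {q. conn G p q})"
  by (simp add: component_of_def conn_def fun_eq_iff)

lemma lattice_edges_no_loop: "{a} \<notin> lattice_edges n"
  by (auto simp: lattice_edges_def)

text \<open>If a component contains exactly one boundary set, connected boundary vertices share
  their block, as both blocks lie in the common component. Conversely, the block of any boundary
  vertex reached from \<open>v\<close> is the only one in the component of \<open>v\<close>.\<close>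

lemma simplified_grove_iff_grove:
  assumes "n \<ge> 1"
  shows "simplified_grove n G \<longleftrightarrow> grove n G"
proof
  assume s: "simplified_grove n G"
  note s' = s[unfolded simplified_grove_def components_of_def boundary_sets_eq[OF assms]
      component_of_conn, THEN conjunct2, THEN conjunct2]
  have un: "\<exists>!B. B \<in> block n ` nodes n \<and> B \<subseteq> {q. conn G v q}" if "v \<in> grove_vertices n" for v
    using bspec[OF s'[THEN conjunct1] imageI[OF that]] .
  have cov: "\<exists>v \<in> grove_vertices n. block n x \<subseteq> {q. conn G v q}" if "x \<in> nodes n" for x
    using bspec[OF s'[THEN conjunct2] imageI[OF that]] by blast
  have self: "x \<in> block n x" if "x \<in> nodes n" for x using that by (simp add: block_def)
  have blk: "block n x \<subseteq> {q. conn G x q}" if x: "x \<in> nodes n" for x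
  proof -
    obtain v where v: "block n x \<subseteq> {q. conn G v q}" using cov[OF x] by blast
    then have "conn G v x" using self[OF x] by auto
    then show ?thesis using v conn_trans[OF conn_sym, of G v x] by blast
  qed
  have eq: "block n x = block n y" if "x \<in> nodes n" "y \<in> nodes n" "conn G x y" for x y
  proof -
    have "block n y \<subseteq> {q. conn G x q}"
      using blk[OF that(2)] conn_trans[OF that(3)] by blast
    moreover have "x \<in> grove_vertices n" using that(1) nodes_subset by blast
    moreover note blk[OF that(1)]
    ultimately show ?thesis using ex1E[OF un[of x]] that by (metis imageI)
  qed
  show "grove n G" unfolding grove_def
  proof (intro conjI ballI iffI)
    show "G \<subseteq> lattice_edges n" using s by (simp add: simplified_grove_def)
    then show "forest G"
      using s lattice_edges_no_loop
      by (intro acyclic_graph_imp_forest) (auto simp: simplified_grove_def)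
    show "\<exists>x \<in> nodes n. conn G v x" if "v \<in> grove_vertices n" for v
      using un[OF that] self by blast
    show "lb n x = lb n y" if "x \<in> nodes n" "y \<in> nodes n" "conn G x y" for x y
      using eq[OF that] self[OF that(1)] by (auto simp: block_def)
    show "conn G x y" if "x \<in> nodes n" "y \<in> nodes n" "lb n x = lb n y" for x y
      using blk[OF that(1)] that by (auto simp: block_def)
  qed
next
  assume g: "grove n G"
  have blk: "block n x \<subseteq> {q. conn G v q}" if "x \<in> nodes n" "conn G v x" for x v
    using g that conn_trans[OF that(2)] by (auto simp: grove_def block_def)
  show "simplified_grove n G"
    unfolding simplified_grove_def components_of_def boundary_sets_eq[OF assms] component_of_conn
  proof (intro conjI ballI)
    show "G \<subseteq> lattice_edges n" "acyclic_graph G"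
      using g by (auto simp: grove_def forest_imp_acyclic_graph)
  next
    fix C assume "C \<in> (\<lambda>p. {q. conn G p q}) ` grove_vertices n"
    then obtain v where v: "v \<in> grove_vertices n" "C = {q. conn G v q}" by blast
    then obtain x where x: "x \<in> nodes n" "conn G v x" using g by (auto simp: grove_def)
    show "\<exists>!B. B \<in> block n ` nodes n \<and> B \<subseteq> C"
    proof (rule ex1I[of _ "block n x"])
      show "block n x \<in> block n ` nodes n \<and> block n x \<subseteq> C"
        using blk x v by blast
      fix B assume "B \<in> block n ` nodes n \<and> B \<subseteq> C"
      then obtain y where y: "y \<in> nodes n" "B = block n y" "conn G v y"
        unfolding v(2) block_def by auto
      have "conn G x y" using x(2) y(3) conn_trans conn_sym by metis
      then show "B = block n x" using g x y by (auto simp: grove_def block_def)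
    qed
  next
    fix B assume "B \<in> block n ` nodes n"
    then obtain x where "x \<in> nodes n" "B = block n x" by blast
    then show "\<exists>C \<in> (\<lambda>p. {q. conn G p q}) ` grove_vertices n. B \<subseteq> C"
      using blk[of x x] nodes_subset by auto
  qed
qed

section \<open>Local moves\<close>

lemma conn_cong:
  assumes "conn G a b"
  shows "conn G a x \<longleftrightarrow> conn G b x" "conn G x a \<longleftrightarrow> conn G x b"
  using conn_trans[OF assms] conn_trans[OF conn_sym[OF assms]]
    conn_trans[OF _ assms] conn_trans[OF _ conn_sym[OF assms]] by blast+

lemma grove_edge_vertices:
  assumes "grove n G" "{a, b} \<in> G"
  shows "a \<in> grove_vertices n" "b \<in> grove_vertices n" "a \<noteq> b"
proof -
  have "{a, b} \<in> lattice_edges n" using assms by (auto simp: grove_def)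
  then show "a \<in> grove_vertices n" "b \<in> grove_vertices n" "a \<noteq> b"
    by (auto simp: lattice_edges_def doubleton_eq_iff)
qed

lemma grove_forest: "grove n G \<Longrightarrow> {a, b} \<in> G \<Longrightarrow> \<not> conn (G - {{a, b}}) a b"
  unfolding grove_def forest_def by blast

lemma neighbours_lattice_edge:
  assumes "p \<in> grove_vertices n" "v \<in> grove_vertices n" "v \<in> set (neighbours p)"
  shows "{p, v} \<in> lattice_edges n"
  unfolding lattice_edges_def using assms
  by (intro CollectI exI[of _ p] exI[of _ v]) (cases p; auto)

lemma lattice_edge_neighbours:
  assumes "{p, v} \<in> lattice_edges n"
  shows "v \<in> set (neighbours p)"
proof -
  obtain a b where "{p, v} = {a, b}"
    "(fst b - fst a, snd b - snd a) \<in> {2, -2} \<times> {0} \<union> {1, -1} \<times> {1, -1}"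
    using assms unfolding lattice_edges_def by blast
  then show ?thesis by (cases a; cases b) (auto simp: doubleton_eq_iff)
qed

lemma consecutive_sym: "consecutive_around p u v \<Longrightarrow> consecutive_around p v u"
  unfolding consecutive_around_def by (metis insert_commute)

lemma consecutive_nth:
  "k < 6 \<Longrightarrow> consecutive_around p (neighbours p ! k) (neighbours p ! ((k + 1) mod 6))"
  unfolding consecutive_around_def by blast

lemma length_neighbours [simp]: "length (neighbours p) = 6"
  by (cases p) simp

lemma distinct_neighbours: "distinct (neighbours p)"
  by (cases p) simp

lemma consecutiveD:
  assumes "consecutive_around p u v"
  shows "v \<in> set (neighbours p)" "u \<noteq> v"
proof -
  obtain k where k: "k < 6" "{u, v} = {neighbours p ! k, neighbours p ! ((k + 1) mod 6)}"
    using assms by (auto simp: consecutive_around_def)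
  then have "v \<in> {neighbours p ! k, neighbours p ! ((k + 1) mod 6)}" by blast
  then show "v \<in> set (neighbours p)" using k(1) by (auto intro!: nth_mem)
  have "k \<noteq> (k + 1) mod 6" using k(1) by presburger
  then have "neighbours p ! k \<noteq> neighbours p ! ((k + 1) mod 6)"
    using nth_eq_iff_index_eq[OF distinct_neighbours, of k p "(k + 1) mod 6"] k(1) by simp
  then show "u \<noteq> v" using k(2) by (auto simp: doubleton_eq_iff)
qed

definition step :: "nat \<Rightarrow> point set set \<Rightarrow> point set set \<Rightarrow> bool" where
  "step n G G' \<longleftrightarrow> grove n G \<and> grove n G' \<and> spin n G G'"

abbreviation reach :: "nat \<Rightarrow> point set set \<Rightarrow> point set set \<Rightarrow> bool" where
  "reach n \<equiv> (step n)\<^sup>*\<^sup>*"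

text \<open>The reverse spin has the same pivot, and consecutiveness is symmetric.\<close>

lemma step_sym: "step n G G' \<Longrightarrow> step n G' G"
proof -
  assume st: "step n G G'"
  then obtain p u v where p: "p \<in> grove_vertices n" "u \<in> grove_vertices n" "v \<in> grove_vertices n"
    "consecutive_around p u v" "{p, u} \<in> G" "{p, v} \<notin> G" "G' = insert {p, v} (G - {{p, u}})"
    by (auto simp: step_def spin_def spin_at_def)
  have "{p, u} \<noteq> {p, v}" using p(5,6) by auto
  then have "{p, v} \<in> G'" "{p, u} \<notin> G'" "G = insert {p, u} (G' - {{p, v}})"
    using p(5-7) by auto
  then have "spin n G' G"
    unfolding spin_def spin_at_def
    by (intro bexI[OF _ p(1)] bexI[OF _ p(3)] bexI[OF _ p(2)] conjI consecutive_sym[OF p(4)])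
  then show ?thesis using st by (simp add: step_def)
qed

lemma reach_sym: "reach n G G' \<Longrightarrow> reach n G' G"
  by (induction rule: rtranclp_induct) (auto intro: converse_rtranclp_into_rtranclp step_sym)

lemma reach_grove: "reach n G G' \<Longrightarrow> grove n G \<Longrightarrow> grove n G'"
  by (induction rule: rtranclp_induct) (auto simp: step_def)

text \<open>In the first alternative of \<open>side\<close> connectivity does not change at all. In
  the second a branch without boundary vertices is transplanted, which is invisible to
  \<open>conn\<close> between boundary vertices.\<close>

lemma step_spin:
  assumes g: "grove n G" and e: "{p, u} \<in> G" and c: "consecutive_around p u v"
    and v: "v \<in> grove_vertices n" and nc: "\<not> conn (G - {{p, u}}) p v"
    and side: "conn (G - {{p, u}}) u v \<or> (\<forall>x \<in> nodes n. \<not> conn (G - {{p, u}}) p x)"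
  shows "step n G (insert {p, v} (G - {{p, u}}))"
proof -
  let ?H = "G - {{p, u}}" let ?G = "insert {p, v} ?H"
  note pu = grove_edge_vertices[OF g e]
  have "{p, v} \<notin> ?H" using nc conn_edge by metis
  then have new: "{p, v} \<notin> G" using consecutiveD(2)[OF c] by (auto simp: doubleton_eq_iff)
  have sp: "spin n G ?G"
    unfolding spin_def spin_at_def
    by (intro bexI[OF _ pu(1)] bexI[OF _ pu(2)] bexI[OF _ v] conjI c e new refl)
  have G: "conn G x y \<longleftrightarrow> conn ?H x y \<or> conn ?H x p \<and> conn ?H u y \<or> conn ?H x u \<and> conn ?H p y" for x y
    by (rule conn_split[OF e])
  have G': "conn ?G x y \<longleftrightarrow> conn ?H x y \<or> conn ?H x p \<and> conn ?H v y \<or> conn ?H x v \<and> conn ?H p y" for x y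
    by (rule conn_insert)
  have "grove n ?G" unfolding grove_def
  proof (intro conjI)
    show "?G \<subseteq> lattice_edges n"
      using g neighbours_lattice_edge[OF pu(1) v consecutiveD(1)[OF c]] by (auto simp: grove_def)
    show "forest ?G"
      using g nc by (intro forest_insert forest_subset[of G ?H]) (simp_all add: grove_def Diff_subset)
    have *: "(\<forall>w \<in> grove_vertices n. \<exists>x \<in> nodes n. conn ?G w x) \<and>
      (\<forall>x \<in> nodes n. \<forall>y \<in> nodes n. conn ?G x y \<longleftrightarrow> conn G x y)"
    proof (cases "conn ?H u v")
      case True
      have "conn ?G x y \<longleftrightarrow> conn G x y" for x y
        unfolding G G' conn_cong[OF True] by simp
      then show ?thesis using g by (simp add: grove_def)
    next
      case False
      then have free: "\<not> conn ?H p x" "\<not> conn ?H x p" if "x \<in> nodes n" for x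
        using side False that conn_commute[of ?H x p] by blast+
      \<comment> \<open>A path from \<open>v\<close> to the boundary cannot use the deleted edge:
        one direction of passage would put \<open>v\<close> on the branch of \<open>p\<close>, the
        other would put a boundary vertex there.\<close>
      have vn: "\<exists>y \<in> nodes n. conn ?H v y"
      proof -
        obtain y where y: "y \<in> nodes n" "conn G v y" using g v by (auto simp: grove_def)
        then show ?thesis using free[OF y(1)] nc conn_commute[of ?H v p] unfolding G by blast
      qed
      have "\<exists>x \<in> nodes n. conn ?G w x" if w: "w \<in> grove_vertices n" for w
      proof -
        obtain y where y: "y \<in> nodes n" "conn G w y" using g w by (auto simp: grove_def)
        then show ?thesis using free[OF y(1)] vn unfolding G G' by blast
      qed
      moreover have "conn ?G x y \<longleftrightarrow> conn G x y" if "x \<in> nodes n" "y \<in> nodes n" for x y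
        using free that unfolding G G' by blast
      ultimately show ?thesis by blast
    qed
    then show "\<forall>w \<in> grove_vertices n. \<exists>x \<in> nodes n. conn ?G w x" by blast
    show "\<forall>x \<in> nodes n. \<forall>y \<in> nodes n. conn ?G x y \<longleftrightarrow> lb n x = lb n y"
      using * g by (simp add: grove_def)
  qed
  then show ?thesis using g sp by (simp add: step_def)
qed

text \<open>The edge \<open>{b, c}\<close> keeps \<open>c\<close> on the side of \<open>b\<close>
  when \<open>{a, b}\<close> is deleted.\<close>

lemma step_two_edges:
  assumes g: "grove n G" and e: "{a, b} \<in> G" "{b, c} \<in> G" "a \<noteq> c"
    and c: "consecutive_around a b c"
  shows "step n G (insert {a, c} (G - {{a, b}}))"
proof (rule step_spin[OF g e(1) c])
  show "c \<in> grove_vertices n" using grove_edge_vertices[OF g e(2)] by simp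
  have "{b, c} \<noteq> {a, b}" using e(3) by (auto simp: doubleton_eq_iff)
  then have bc: "conn (G - {{a, b}}) b c" using e(2) by (intro conn_edge) auto
  then show "\<not> conn (G - {{a, b}}) a c"
    using grove_forest[OF g e(1)] conn_trans[OF _ conn_sym[OF bc]] by blast
  show "conn (G - {{a, b}}) b c \<or> (\<forall>x \<in> nodes n. \<not> conn (G - {{a, b}}) a x)"
    using bc by blast
qed

text \<open>After deletion of \<open>{a, b}\<close> the vertex \<open>c\<close> is on exactly one
  side, and the endpoint on the other side serves as pivot. Which of the two new edges arises cannot
  be prescribed.\<close>

lemma step_triangle:
  assumes g: "grove n G" and e: "{a, b} \<in> G" and ac: "conn G a c" and v: "c \<in> grove_vertices n"
    and c: "consecutive_around a b c" "consecutive_around b a c"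
  shows "step n G (insert {a, c} (G - {{a, b}})) \<or> step n G (insert {b, c} (G - {{a, b}}))"
proof -
  let ?H = "G - {{a, b}}"
  have n: "\<not> conn ?H a b" "\<not> conn ?H b a" using grove_forest[OF g e] conn_commute[of ?H a b] by simp_all
  have "conn ?H a c \<or> conn ?H b c" using ac n unfolding conn_split[OF e] by blast
  then show ?thesis
  proof
    assume h: "conn ?H a c"
    then have "\<not> conn ?H b c" using n conn_cong(2)[OF h] by blast
    then have "step n G (insert {b, c} (G - {{b, a}}))"
      using h e by (intro step_spin[OF g _ c(2) v]) (auto simp: insert_commute)
    then show ?thesis by (simp add: insert_commute)
  next
    assume h: "conn ?H b c"
    then have "\<not> conn ?H a c" using n conn_cong(2)[OF h] by blast
    then show ?thesis using step_spin[OF g e c(1) v] h by blast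
  qed
qed

definition leaf :: "point set set \<Rightarrow> point \<Rightarrow> point \<Rightarrow> bool" where
  "leaf G v u \<longleftrightarrow> (\<forall>x. {v, x} \<in> G \<longleftrightarrow> x = u)"

lemma leafI:
  assumes "{v, u} \<in> G" "\<And>y. {v, y} \<in> G \<Longrightarrow> y = u"
  shows "leaf G v u"
  using assms unfolding leaf_def by metis

text \<open>Without its only edge, the vertex is a branch by itself and contains no boundary vertex,
  so it may turn through all six directions one after the other.\<close>

lemma leaf_move:
  assumes g: "grove n G" and l: "leaf G v u" and v: "v \<notin> nodes n"
    and nb: "set (neighbours v) \<subseteq> grove_vertices n" and x: "x \<in> set (neighbours v)"
  shows "reach n G (insert {v, x} (G - {{v, u}}))"
proof -
  let ?H = "G - {{v, u}}"
  have vu: "{v, u} \<in> G" using l unfolding leaf_def by blast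
  have iso: "{v, y} \<notin> ?H" for y using l unfolding leaf_def by (metis Diff_iff insertI1)
  have uv: "u \<in> set (neighbours v)"
    using g vu lattice_edge_neighbours unfolding grove_def by blast
  obtain k where k: "k < 6" "u = neighbours v ! k"
    using uv by (metis in_set_conv_nth length_neighbours)
  obtain l where l: "l < 6" "x = neighbours v ! l"
    using x by (metis in_set_conv_nth length_neighbours)
  have vv: "v \<notin> set (neighbours v)" by (cases v) auto
  have "reach n G (insert {v, neighbours v ! ((k + m) mod 6)} ?H)" for m
  proof (induction m)
    case 0
    then show ?case using k vu by (simp add: insert_absorb)
  next
    case (Suc m)
    let ?i = "(k + m) mod 6"
    let ?a = "neighbours v ! ?i" let ?b = "neighbours v ! ((?i + 1) mod 6)"
    let ?G = "insert {v, ?a} ?H"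
    have g': "grove n ?G" using reach_grove[OF Suc g] .
    have eq: "?G - {{v, ?a}} = ?H" using iso by auto
    have b: "?b \<in> set (neighbours v)" by (auto intro!: nth_mem)
    have "\<not> conn ?H v y" if "y \<noteq> v" for y using conn_isolated[of ?H v y] iso that by blast
    moreover have "?b \<noteq> v" using b vv by metis
    moreover have "y \<noteq> v" if "y \<in> nodes n" for y using v that by blast
    ultimately have "step n ?G (insert {v, ?b} (?G - {{v, ?a}}))"
      using b nb by (intro step_spin[OF g' _ consecutive_nth]) (auto simp: eq)
    moreover have "(?i + 1) mod 6 = (k + Suc m) mod 6" by (simp add: mod_Suc_eq)
    ultimately show ?case using Suc eq by (simp add: rtranclp.rtrancl_into_rtrancl)
  qed
  \<comment> \<open>The summand 6 keeps the subtraction of naturals exact and vanishes modulo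
    6.\<close>
  from this[of "6 + l - k"] show ?thesis using k l by simp
qed

section \<open>Corner coordinates\<close>

text \<open>Coordinates with origin at one of the three corners and axes along the two sides that meet
  there.  The conditions are invariant under the symmetries of the triangle, so that every
  statement proved here holds at all three corners.\<close>

locale corner =
  fixes n :: nat and pt :: "int \<Rightarrow> int \<Rightarrow> point"
  assumes pt_eq [simp]: "pt i j = pt i' j' \<longleftrightarrow> i = i' \<and> j = j'"
    and pt_vertex: "pt i j \<in> grove_vertices n \<longleftrightarrow> 0 \<le> i \<and> 0 \<le> j \<and> i + j \<le> int n"
    and pt_neighbours: "set (neighbours (pt i j)) =
      {pt (i + 1) j, pt i (j + 1), pt (i - 1) (j + 1), pt (i - 1) j, pt i (j - 1), pt (i + 1) (j - 1)}"
    and pt_consecutive: "(a - i, b - j, c - i, d - j) \<in>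
      {(1, 0, 0, 1), (0, 1, -1, 1), (-1, 1, -1, 0), (-1, 0, 0, -1), (0, -1, 1, -1), (1, -1, 1, 0)} \<Longrightarrow>
      consecutive_around (pt i j) (pt a b) (pt c d)"
    and pt_node: "pt i j \<in> nodes n \<longleftrightarrow> 0 \<le> i \<and> 0 \<le> j \<and> i + j \<le> int n \<and> (i = 0 \<or> j = 0 \<or> i + j = int n)"
    and lb_pair: "0 \<le> d \<Longrightarrow> 2 * d \<le> int n \<Longrightarrow> lb n (pt d 0) = lb n (pt 0 d)"
    and lb_neq: "0 \<le> d \<Longrightarrow> 2 * (d + 1) \<le> int n \<Longrightarrow> lb n (pt d 0) \<noteq> lb n (pt (d + 1) 0)"
    and lb_neq': "0 \<le> d \<Longrightarrow> 2 * d \<le> int n \<Longrightarrow> lb n (pt 0 d) \<noteq> lb n (pt 0 (d + 1))"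
    and lb_only: "0 \<le> d \<Longrightarrow> 2 * d < int n \<Longrightarrow> x \<in> nodes n \<Longrightarrow>
      lb n x = lb n (pt d 0) \<Longrightarrow> x = pt d 0 \<or> x = pt 0 d"
begin

lemma pt_consecutive_sym:
  "(c - i, d - j, a - i, b - j) \<in>
      {(1, 0, 0, 1), (0, 1, -1, 1), (-1, 1, -1, 0), (-1, 0, 0, -1), (0, -1, 1, -1), (1, -1, 1, 0)} \<Longrightarrow>
      consecutive_around (pt i j) (pt a b) (pt c d)"
  by (rule consecutive_sym[OF pt_consecutive])

lemma edge_dirs:
  assumes "grove n G" "{pt i j, y} \<in> G"
  shows "y = pt (i + 1) j \<or> y = pt i (j + 1) \<or> y = pt (i - 1) (j + 1) \<or>
    y = pt (i - 1) j \<or> y = pt i (j - 1) \<or> y = pt (i + 1) (j - 1)"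
proof -
  have "{pt i j, y} \<in> lattice_edges n" using assms unfolding grove_def by blast
  then show ?thesis using lattice_edge_neighbours pt_neighbours by blast
qed

lemma interior:
  assumes "1 \<le> i" "1 \<le> j" "i + j < int n"
  shows "pt i j \<notin> nodes n" "set (neighbours (pt i j)) \<subseteq> grove_vertices n"
    "pt i j \<in> grove_vertices n"
  using assms by (auto simp: pt_neighbours pt_vertex pt_node)

lemma interior_edge:
  assumes "grove n G" "1 \<le> i" "1 \<le> j" "i + j < int n"
  obtains y where "{pt i j, y} \<in> G"
proof -
  note int = interior[OF assms(2-)]
  obtain x where x: "x \<in> nodes n" "conn G (pt i j) x"
    using assms(1) int(3) unfolding grove_def by blast
  then have "x \<noteq> pt i j" using int(1) by blast
  then show ?thesis using conn_first_edge[OF x(2)] that by blast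
qed

lemma interior_leaf_move:
  assumes "grove n G" "1 \<le> i" "1 \<le> j" "i + j < int n" "leaf G (pt i j) u"
    "y \<in> set (neighbours (pt i j))"
  shows "reach n G (insert {pt i j, y} (G - {{pt i j, u}}))"
  using leaf_move[OF assms(1,5) interior(1,2)[OF assms(2-4)] assms(6)] .

section \<open>Where a sequence of spins deletes and adds edges\<close>

text \<open>Deleted edges meet the triangle with vertices \<open>pt i j\<close>,
  \<open>pt (i - m) (j + m)\<close> and \<open>pt i (j + m)\<close>, one side of which is the chain
  starting at \<open>pt i j\<close>. Added edges stay on or beyond the antidiagonal
  \<open>i + j\<close>, so no edge at an earlier line is created.\<close>

definition moved :: "int \<Rightarrow> int \<Rightarrow> nat \<Rightarrow> point set set \<Rightarrow> point set set \<Rightarrow> bool" where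
  "moved i j m G G' \<longleftrightarrow>
    (\<forall>e \<in> G - G'. \<exists>a b. 0 \<le> a \<and> 0 \<le> b \<and> a + b \<le> int m \<and> pt (i - a) (j + a + b) \<in> e) \<and>
    (\<forall>e \<in> G' - G. \<forall>a b. pt a b \<in> e \<longrightarrow> i + j \<le> a + b)"

lemma moved_refl: "moved i j m G G"
  by (simp add: moved_def)

lemma moved_removed:
  "moved i j m G G' \<Longrightarrow> e \<in> G \<Longrightarrow> e \<notin> G' \<Longrightarrow>
    \<exists>a b. 0 \<le> a \<and> 0 \<le> b \<and> a + b \<le> int m \<and> pt (i - a) (j + a + b) \<in> e"
  unfolding moved_def by simp

lemma moved_added:
  "moved i j m G G' \<Longrightarrow> e \<in> G' \<Longrightarrow> e \<notin> G \<Longrightarrow> pt a b \<in> e \<Longrightarrow> i + j \<le> a + b"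
  unfolding moved_def by simp

lemma moved_trans:
  assumes "moved i j m G G'" "moved i j m G' G''"
  shows "moved i j m G G''"
  unfolding moved_def
proof (intro conjI ballI allI impI)
  show "\<exists>a b. 0 \<le> a \<and> 0 \<le> b \<and> a + b \<le> int m \<and> pt (i - a) (j + a + b) \<in> e" if "e \<in> G - G''" for e
    using moved_removed[OF assms(1), of e] moved_removed[OF assms(2), of e] that
    by (cases "e \<in> G'") simp_all
  show "i + j \<le> a + b" if "e \<in> G'' - G" "pt a b \<in> e" for e a b
    using moved_added[OF assms(1), of e a b] moved_added[OF assms(2), of e a b] that
    by (cases "e \<in> G'") simp_all
qed

lemma moved_mono:
  assumes "moved i j m' G G'" "m' \<le> m"
  shows "moved i j m G G'"
  unfolding moved_def
proof (intro conjI ballI allI impI)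
  fix e assume "e \<in> G - G'"
  then obtain a b where "0 \<le> a" "0 \<le> b" "a + b \<le> int m'" "pt (i - a) (j + a + b) \<in> e"
    using moved_removed[OF assms(1), of e] by auto
  then show "\<exists>a b. 0 \<le> a \<and> 0 \<le> b \<and> a + b \<le> int m \<and> pt (i - a) (j + a + b) \<in> e"
    using assms(2) by (intro exI[of _ a] exI[of _ b]) simp
next
  fix e a b assume "e \<in> G' - G" "pt a b \<in> e"
  then show "i + j \<le> a + b" using moved_added[OF assms(1), of e a b] by simp
qed

text \<open>The triangle of size at most \<open>m - 1\<close> at \<open>pt i (j + 1)\<close> lies in
  the triangle of size \<open>m\<close> at \<open>pt i j\<close>; this passes the bound through the
  recursion on the chain length.\<close>

lemma moved_shift:
  assumes "moved i (j + 1) m' G G'" "m' < m"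
  shows "moved i j m G G'"
  unfolding moved_def
proof (intro conjI ballI allI impI)
  fix e assume "e \<in> G - G'"
  then obtain a b where "0 \<le> a" "0 \<le> b" "a + b \<le> int m'" "pt (i - a) (j + 1 + a + b) \<in> e"
    using moved_removed[OF assms(1), of e] by auto
  then show "\<exists>a b. 0 \<le> a \<and> 0 \<le> b \<and> a + b \<le> int m \<and> pt (i - a) (j + a + b) \<in> e"
    using assms(2) by (intro exI[of _ a] exI[of _ "b + 1"]) (auto simp: algebra_simps)
next
  fix e a b assume "e \<in> G' - G" "pt a b \<in> e"
  then have "i + (j + 1) \<le> a + b" using moved_added[OF assms(1), of e a b] by simp
  then show "i + j \<le> a + b" by simp
qed

lemma moved_swap:
  assumes "0 \<le> a" "0 \<le> b" "a + b \<le> int m" "pt (i - a) (j + a + b) \<in> e"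
    "i + j \<le> c + d" "i + j \<le> c' + d'"
  shows "moved i j m G (insert {pt c d, pt c' d'} (G - {e}))"
  unfolding moved_def
proof (intro conjI ballI allI impI)
  fix e' assume "e' \<in> G - insert {pt c d, pt c' d'} (G - {e})"
  then have "e' = e" by blast
  then show "\<exists>a b. 0 \<le> a \<and> 0 \<le> b \<and> a + b \<le> int m \<and> pt (i - a) (j + a + b) \<in> e'"
    using assms(1-4) by blast
next
  fix e' k l assume "e' \<in> insert {pt c d, pt c' d'} (G - {e}) - G" "pt k l \<in> e'"
  then have "pt k l \<in> {pt c d, pt c' d'}" by blast
  then show "i + j \<le> k + l" using assms(5,6) by auto
qed

section \<open>Turning an interior vertex into a leaf\<close>

text \<open>The two remaining directions are consecutive. If both are occupied, the neighbour
  \<open>pt (i + 1) j\<close> turns its edge from \<open>pt i j\<close> to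
  \<open>pt i (j + 1)\<close> across their common triangle.\<close>

lemma free_base:
  assumes g: "grove n G" and ij: "1 \<le> i" "1 \<le> j" "i + j < int n"
    and e: "\<And>y. {pt i j, y} \<in> G \<Longrightarrow> y = pt (i + 1) j \<or> y = pt i (j + 1)"
  shows "\<exists>G' z. reach n G G' \<and> leaf G' (pt i j) z \<and> moved i j m G G'"
proof (cases "{pt i j, pt (i + 1) j} \<in> G \<and> {pt i j, pt i (j + 1)} \<in> G")
  case True
  define G' where "G' = insert {pt (i + 1) j, pt i (j + 1)} (G - {{pt (i + 1) j, pt i j}})"
  have "{pt (i + 1) j, pt i j} \<in> G" using True by (simp only: insert_commute)
  moreover have "consecutive_around (pt (i + 1) j) (pt i j) (pt i (j + 1))"
    by (rule pt_consecutive_sym) simp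
  ultimately have "step n G G'" unfolding G'_def
    using True by (intro step_two_edges[OF g]) simp_all
  moreover have "leaf G' (pt i j) (pt i (j + 1))"
  proof (rule leafI)
    show "{pt i j, pt i (j + 1)} \<in> G'" using True by (simp add: G'_def doubleton_eq_iff)
    fix y assume y: "{pt i j, y} \<in> G'"
    then have "{pt i j, y} \<in> G" "y \<noteq> pt (i + 1) j" by (auto simp: G'_def doubleton_eq_iff)
    then show "y = pt i (j + 1)" using e by blast
  qed
  moreover have "moved i j m G G'" unfolding G'_def
    by (rule moved_swap[of 0 0]) auto
  ultimately show ?thesis by blast
next
  case False
  obtain y where "{pt i j, y} \<in> G" using interior_edge[OF g ij] .
  then have "leaf G (pt i j) y" using e False by (intro leafI) metis+
  then show ?thesis using moved_refl by blast
qed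

text \<open>The vertex \<open>pt i j\<close> can be made a leaf.  The only obstruction is a pair of edges at it in the
  directions \<open>(1, 0)\<close> and \<open>(-1, 1)\<close> while the vertex \<open>s = pt i (j + 1)\<close> between them lies in
  another component.  Then \<open>s\<close> satisfies the same hypotheses with a shorter chain, because the
  component of \<open>pt i j\<close> cuts off the chain that starts at \<open>s\<close>; once \<open>s\<close> is a leaf it is moved
  into the component of \<open>pt i j\<close>.  The length of the chain plays the role that planarity would
  otherwise play.\<close>

lemma free_vertex:
  assumes "grove n G" "1 \<le> j" "int m < i" "i + j + int m < int n"
    and "\<And>t. t < m \<Longrightarrow> {pt (i - int t) (j + int t), pt (i - int t - 1) (j + int t + 1)} \<in> G"
    and "{pt (i - int m) (j + int m), pt (i - int m - 1) (j + int m + 1)} \<notin> G"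
    and "\<And>t. t \<le> m \<Longrightarrow> {pt (i - int t) (j + int t), pt (i - int t - 1) (j + int t)} \<notin> G"
    and "\<And>t. t \<le> m \<Longrightarrow> {pt (i - int t) (j + int t), pt (i - int t) (j + int t - 1)} \<notin> G"
    and "{pt i j, pt (i + 1) (j - 1)} \<notin> G"
  shows "\<exists>G' z. reach n G G' \<and> leaf G' (pt i j) z \<and> moved i j m G G'"
  using assms
proof (induction m arbitrary: i j G rule: less_induct)
  case (less m)
  note g = less.prems(1) and chain = less.prems(5) and stop = less.prems(6)
    and noR = less.prems(7) and noUR = less.prems(8) and noUL = less.prems(9)
  let ?v = "pt i j" let ?x = "pt (i + 1) j" let ?s = "pt i (j + 1)" let ?v1 = "pt (i - 1) (j + 1)"
  have ij: "1 \<le> i" "1 \<le> j" "i + j < int n" using less.prems(2-4) by linarith+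
  \<comment> \<open>The hypotheses exclude three of the six directions; the remaining ones are
    consecutive, with \<open>?s\<close> in the middle.\<close>
  have ed: "y = ?x \<or> y = ?s \<or> y = ?v1" if "{?v, y} \<in> G" for y
    using edge_dirs[OF g that] noR[of 0] noUR[of 0] noUL that by auto
  show ?case
  proof (cases "m = 0")
    case True
    then have "{?v, ?v1} \<notin> G" using stop by simp
    then show ?thesis using ed by (intro free_base[OF g ij]) metis
  next
    case False
    then have m: "m > 0" by simp
    have vv1: "{?v, ?v1} \<in> G" using chain[of 0] m by simp
    let ?vm = "pt (i - int m) (j + int m)"
    let ?pr = "pt (i - int m + 1) (j + int m - 1)"
    have mij: "1 \<le> i - int m" "1 \<le> j + int m" "i - int m + (j + int m) < int n"
      using less.prems(2-4) by linarith+
    have prev: "{?vm, ?pr} \<in> G"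
      using chain[of "m - 1"] m by (simp add: of_nat_diff algebra_simps insert_commute)
    show ?thesis
    proof (cases "{?vm, pt (i - int m + 1) (j + int m)} \<in> G \<or> {?vm, pt (i - int m) (j + int m + 1)} \<in> G")
      \<comment> \<open>The last chain vertex carries nothing but its chain edge. Moved aside as a
        leaf, it shortens the chain by one.\<close>
      case False
      have lf: "leaf G ?vm ?pr"
      proof (rule leafI[OF prev])
        fix y assume y: "{?vm, y} \<in> G"
        then show "y = ?pr"
          using edge_dirs[OF g y] False noR[of m] noUR[of m] stop by auto
      qed
      define G1 where "G1 = insert {?vm, pt (i - int m + 1) (j + int m)} (G - {{?vm, ?pr}})"
      have r1: "reach n G G1" unfolding G1_def
        by (rule interior_leaf_move[OF g mij lf]) (simp add: pt_neighbours)
      have g1: "grove n G1" using reach_grove[OF r1 g] .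
      have mv1: "moved i j m G G1" unfolding G1_def
        by (rule moved_swap[of "int m" 0]) (use m in auto)
      have m1: "int (m - 1) = int m - 1" using m by (simp add: of_nat_diff)
      have "\<exists>G' z. reach n G1 G' \<and> leaf G' ?v z \<and> moved i j (m - 1) G1 G'"
      proof (rule less.IH[OF _ g1])
        show "m - 1 < m" "1 \<le> j" "int (m - 1) < i" "i + j + int (m - 1) < int n"
          using m less.prems(2-4) by (simp_all add: m1)
        show "{pt (i - int t) (j + int t), pt (i - int t - 1) (j + int t + 1)} \<in> G1" if "t < m - 1" for t
          using chain[of t] that m by (auto simp: G1_def doubleton_eq_iff)
        show "{pt (i - int (m - 1)) (j + int (m - 1)), pt (i - int (m - 1) - 1) (j + int (m - 1) + 1)} \<notin> G1"
          using m by (auto simp: G1_def doubleton_eq_iff m1 algebra_simps insert_commute)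
        show "{pt (i - int t) (j + int t), pt (i - int t - 1) (j + int t)} \<notin> G1" if "t \<le> m - 1" for t
          using noR[of t] that m by (auto simp: G1_def doubleton_eq_iff)
        show "{pt (i - int t) (j + int t), pt (i - int t) (j + int t - 1)} \<notin> G1" if "t \<le> m - 1" for t
          using noUR[of t] that m by (auto simp: G1_def doubleton_eq_iff)
        show "{?v, pt (i + 1) (j - 1)} \<notin> G1"
          using noUL m by (auto simp: G1_def doubleton_eq_iff)
      qed
      then obtain G' z where G': "reach n G1 G'" "leaf G' ?v z" "moved i j (m - 1) G1 G'" by blast
      have "moved i j m G G'" by (rule moved_trans[OF mv1 moved_mono[OF G'(3)]]) simp
      then show ?thesis using rtranclp_trans[OF r1 G'(1)] G'(2) by blast
    next
      case True
      \<comment> \<open>Once \<open>?s\<close> is in the component of \<open>?v\<close>, the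
        triangle \<open>?v\<close>, \<open>?v1\<close>, \<open>?s\<close> allows the edge to
        \<open>?v1\<close> to be given up, and two consecutive directions remain.\<close>
      have fin: "\<exists>G' z. reach n H G' \<and> leaf G' ?v z \<and> moved i j m H G'"
        if H: "grove n H" "{?v, ?v1} \<in> H" "conn H ?v ?s"
          "\<And>y. {?v, y} \<in> H \<Longrightarrow> y = ?x \<or> y = ?s \<or> y = ?v1" for H
      proof -
        have "step n H (insert {?v, ?s} (H - {{?v, ?v1}})) \<or> step n H (insert {?v1, ?s} (H - {{?v, ?v1}}))"
        proof (rule step_triangle[OF H(1-3)])
          show "?s \<in> grove_vertices n" using ij by (simp add: pt_vertex)
          show "consecutive_around ?v ?v1 ?s" by (rule pt_consecutive_sym) simp
          show "consecutive_around ?v1 ?v ?s" by (rule pt_consecutive) simp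
        qed
        then obtain w where w: "w = ?v \<or> w = ?v1" "step n H (insert {w, ?s} (H - {{?v, ?v1}}))" by blast
        define H1 where "H1 = insert {w, ?s} (H - {{?v, ?v1}})"
        have "y = ?x \<or> y = ?s" if "{?v, y} \<in> H1" for y
        proof -
          have "{?v, y} = {w, ?s} \<or> {?v, y} \<in> H \<and> y \<noteq> ?v1" using that unfolding H1_def by blast
          then show ?thesis using H(4)[of y] w(1) by (auto simp: doubleton_eq_iff)
        qed
        moreover have "grove n H1" using w(2) by (simp add: step_def H1_def)
        ultimately obtain G' z where G': "reach n H1 G'" "leaf G' ?v z" "moved i j m H1 G'"
          using free_base[of H1 i j m] ij by blast
        have "moved i j m H H1" unfolding H1_def using w(1)
          by (elim disjE; hypsubst; intro moved_swap[of 0 0]) auto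
        then have "moved i j m H G'" using moved_trans G'(3) by blast
        moreover have "reach n H G'"
          using converse_rtranclp_into_rtranclp[of "step n" H H1] w(2) G'(1) unfolding H1_def by blast
        ultimately show ?thesis using G'(2) by blast
      qed
      show ?thesis
      proof (cases "conn G ?v ?s")
        case True
        show ?thesis by (rule fin[OF g vv1 True ed])
      next
        case ns: False
        show ?thesis
        proof (cases "{?v, ?x} \<in> G")
          case False
          have "y = ?v1" if "{?v, y} \<in> G" for y
            using ed[OF that] that False ns conn_edge[of ?v ?s G] by auto
          then have "leaf G ?v ?v1" by (rule leafI[OF vv1])
          then show ?thesis using moved_refl by blast
        next
          case x: True
          have cv: "t \<le> m \<Longrightarrow> conn G ?v (pt (i - int t) (j + int t))" for t
          proof (induction t)
            case (Suc t)
            have "conn G (pt (i - int t) (j + int t)) (pt (i - int (Suc t)) (j + int (Suc t)))"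
              using conn_edge[OF chain[of t]] Suc.prems by (simp add: algebra_simps)
            then show ?case using conn_trans[OF Suc.IH] Suc.prems by simp
          qed simp
          \<comment> \<open>\<open>?P t\<close> says that the parallel chain starting at
            \<open>?s\<close> breaks at position \<open>t\<close>.\<close>
          let ?P = "\<lambda>t. {pt (i - int t) (j + 1 + int t), pt (i - int t - 1) (j + 1 + int t + 1)} \<notin> G"
          have cs: "conn G ?s (pt (i - int t) (j + 1 + int t))" if "\<And>r. r < t \<Longrightarrow> \<not> ?P r" for t
            using that
          proof (induction t)
            case (Suc t)
            have "conn G (pt (i - int t) (j + 1 + int t)) (pt (i - int (Suc t)) (j + 1 + int (Suc t)))"
              using conn_edge[of _ _ G] Suc.prems[of t] by (simp add: algebra_simps)
            then show ?case using conn_trans[OF Suc.IH] Suc.prems by simp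
          qed simp
          \<comment> \<open>Otherwise the last two vertices of the parallel chain would be the two
            neighbours of \<open>?vm\<close> from the case distinction, and the edge from
            \<open>?vm\<close> to one of them would connect \<open>?v\<close> with
            \<open>?s\<close>.\<close>
          have ex: "\<exists>t < m. ?P t"
          proof (rule ccontr)
            assume "\<not> (\<exists>t < m. ?P t)"
            then have all: "\<And>t. t < m \<Longrightarrow> \<not> ?P t" by blast
            have "conn G ?s (pt (i - int m) (j + int m + 1))" using cs[of m] all by (simp add: algebra_simps)
            moreover have "conn G ?s (pt (i - int m + 1) (j + int m))"
              using cs[of "m - 1"] all m by (simp add: algebra_simps of_nat_diff)
            ultimately obtain c where c: "{?vm, c} \<in> G" "conn G ?s c" using True by blast
            have "conn G ?v ?vm" using cv by simp
            also have "conn G ?vm c" using conn_edge[OF c(1)] .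
            also have "conn G c ?s" using conn_sym[OF c(2)] .
            finally show False using ns by simp
          qed
          define k where "k = (LEAST t. ?P t)"
          obtain t0 where t0: "t0 < m" "?P t0" using ex by blast
          have Pk: "?P k" unfolding k_def by (rule LeastI[of ?P, OF t0(2)])
          have km: "k < m" using Least_le[of ?P, OF t0(2)] t0(1) unfolding k_def by linarith
          have below: "\<not> ?P t" if "t < k" for t using not_less_Least[of t ?P] that unfolding k_def by blast
          \<comment> \<open>The directions forbidden to the parallel chain lead to vertices of the
            first chain or to \<open>?x\<close>, all in the component of \<open>?v\<close>. This
            yields the remaining hypotheses of the recursive call.\<close>
          have sep: "{pt (i - int t) (j + 1 + int t), y} \<notin> G" if "t \<le> k" "conn G ?v y" for t y
          proof
            assume "{pt (i - int t) (j + 1 + int t), y} \<in> G"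
            moreover have "conn G ?s (pt (i - int t) (j + 1 + int t))" using cs[of t] below that(1) by simp
            ultimately have "conn G ?s y" using conn_trans[OF _ conn_edge] by metis
            then show False using ns conn_trans[OF that(2) conn_sym] by metis
          qed
          have "\<exists>G' z. reach n G G' \<and> leaf G' ?s z \<and> moved i (j + 1) k G G'"
          proof (rule less.IH[OF km g])
            show "1 \<le> j + 1" "int k < i" "i + (j + 1) + int k < int n"
              using less.prems(2-4) km by linarith+
            show "{pt (i - int t) (j + 1 + int t), pt (i - int t - 1) (j + 1 + int t + 1)} \<in> G" if "t < k" for t
              using below[OF that] by simp
            show "{pt (i - int k) (j + 1 + int k), pt (i - int k - 1) (j + 1 + int k + 1)} \<notin> G"
              using Pk .
            show "{pt (i - int t) (j + 1 + int t), pt (i - int t - 1) (j + 1 + int t)} \<notin> G" if "t \<le> k" for t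
              using sep[OF that] cv[of "Suc t"] that km by (simp add: algebra_simps)
            show "{pt (i - int t) (j + 1 + int t), pt (i - int t) (j + 1 + int t - 1)} \<notin> G" if "t \<le> k" for t
              using sep[OF that] cv[of t] that km by simp
            show "{?s, pt (i + 1) (j + 1 - 1)} \<notin> G"
              using sep[of 0 ?x] conn_edge[OF x] by simp
          qed
          then obtain G1 z where G1: "reach n G G1" "leaf G1 ?s z" "moved i (j + 1) k G G1" by blast
          have g1: "grove n G1" using reach_grove[OF G1(1) g] .
          \<comment> \<open>As a leaf, \<open>?s\<close> can be attached to \<open>?v1\<close> and
            thereby enters the component of \<open>?v\<close>.\<close>
          define G2 where "G2 = insert {?s, ?v1} (G1 - {{?s, z}})"
          have r2: "reach n G1 G2" unfolding G2_def
            by (rule interior_leaf_move[OF g1 _ _ _ G1(2)]) (use less.prems(2-4) m in \<open>auto simp: pt_neighbours\<close>)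
          have mv: "moved i j m G G2"
            by (rule moved_trans[OF moved_shift[OF G1(3) km]], unfold G2_def, rule moved_swap[of 0 1])
              (use m in auto)
          \<comment> \<open>Every edge deleted while freeing \<open>?s\<close> has an end strictly
            beyond the antidiagonal that contains \<open>?v\<close> and \<open>?v1\<close>.\<close>
          have "{?v, ?v1} \<in> G1"
          proof (rule ccontr)
            assume "{?v, ?v1} \<notin> G1"
            then obtain a b where "0 \<le> a" "0 \<le> b" "pt (i - a) (j + 1 + a + b) \<in> {?v, ?v1}"
              using moved_removed[OF G1(3) vv1] by auto
            then show False by auto
          qed
          then have v2: "{?v, ?v1} \<in> G2" by (auto simp: G2_def doubleton_eq_iff)
          have "{?v1, ?s} \<in> G2" by (simp add: G2_def insert_commute)
          then have c2: "conn G2 ?v ?s" using conn_trans[OF conn_edge[OF v2] conn_edge] by metis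
          have e2: "y = ?x \<or> y = ?s \<or> y = ?v1" if y: "{?v, y} \<in> G2" for y
          proof -
            have "{?v, y} \<in> G1" using y by (auto simp: G2_def doubleton_eq_iff)
            have "{?v, y} \<in> G"
            proof (rule ccontr)
              assume "{?v, y} \<notin> G"
              then have "i + (j + 1) \<le> i + j" using moved_added[OF G1(3) \<open>{?v, y} \<in> G1\<close>] by blast
              then show False by simp
            qed
            then show ?thesis using ed by blast
          qed
          obtain G' z' where G': "reach n G2 G'" "leaf G' ?v z'" "moved i j m G2 G'"
            using fin[OF reach_grove[OF r2 g1] v2 c2 e2] by auto
          have "reach n G G'" using G1(1) r2 G'(1) by (meson rtranclp_trans)
          then show ?thesis using G'(2) moved_trans[OF mv G'(3)] by blast
        qed
      qed
    qed
  qed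
qed

section \<open>Straight lines around a corner and their preservation\<close>

definition lines :: "int \<Rightarrow> point set set" where
  "lines D = {{pt (a + 1) b, pt a (b + 1)} | a b. 0 \<le> a \<and> 0 \<le> b \<and> a + b + 1 \<le> D}"

lemma lines_edge:
  assumes "lines D \<subseteq> G" "0 \<le> t" "t < d" "d \<le> D"
  shows "{pt (d - t) t, pt (d - t - 1) (t + 1)} \<in> G"
proof -
  have "{pt (d - t) t, pt (d - t - 1) (t + 1)} = {pt (d - t - 1 + 1) t, pt (d - t - 1) (t + 1)}" by simp
  moreover have "0 \<le> d - t - 1" "d - t - 1 + t + 1 \<le> D" using assms(3,4) by simp_all
  ultimately have "{pt (d - t) t, pt (d - t - 1) (t + 1)} \<in> lines D"
    unfolding lines_def using assms(2) by blast
  then show ?thesis using assms(1) by blast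
qed

lemma conn_antidiagonal:
  assumes "\<And>t. 0 \<le> t \<Longrightarrow> t < k \<Longrightarrow> {pt (d - t) t, pt (d - t - 1) (t + 1)} \<in> G" "0 \<le> k"
  shows "conn G (pt d 0) (pt (d - k) k)"
  using assms(2,1)
proof (induction k rule: int_ge_induct)
  case (step k)
  have "conn G (pt d 0) (pt (d - k) k)" using step.IH step.prems by simp
  also have "conn G (pt (d - k) k) (pt (d - (k + 1)) (k + 1))"
    using conn_edge[OF step.prems[of k]] step.hyps by (simp add: algebra_simps)
  finally show ?case .
qed simp

text \<open>The condition \<open>d + 1 \<le> a + b\<close> protects the lines up to
  \<open>d\<close>, and \<open>k + 1 \<le> b\<close> protects the part of the next line that is
  already built. The upper bounds keep deletions away from the lines of the other corners. Added
  edges need no control here, since only inclusions have to survive.\<close>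

definition rem :: "int \<Rightarrow> int \<Rightarrow> point set set \<Rightarrow> point set set \<Rightarrow> bool" where
  "rem d k G G' \<longleftrightarrow> (\<forall>e \<in> G - G'. \<exists>a b. pt a b \<in> e \<and> 0 \<le> a \<and> a \<le> d \<and> k + 1 \<le> b \<and> b \<le> d + 1 \<and> d + 1 \<le> a + b)"

lemma remD:
  "rem d k G G' \<Longrightarrow> e \<in> G \<Longrightarrow> e \<notin> G' \<Longrightarrow>
    \<exists>a b. pt a b \<in> e \<and> 0 \<le> a \<and> a \<le> d \<and> k + 1 \<le> b \<and> b \<le> d + 1 \<and> d + 1 \<le> a + b"
  unfolding rem_def by simp

lemma rem_refl: "rem d k G G"
  by (simp add: rem_def)

lemma rem_trans:
  assumes "rem d k G G'" "rem d k G' G''"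
  shows "rem d k G G''"
  unfolding rem_def
proof
  fix e assume "e \<in> G - G''"
  then show "\<exists>a b. pt a b \<in> e \<and> 0 \<le> a \<and> a \<le> d \<and> k + 1 \<le> b \<and> b \<le> d + 1 \<and> d + 1 \<le> a + b"
    using remD[OF assms(1), of e] remD[OF assms(2), of e] by (cases "e \<in> G'") simp_all
qed

lemma rem_mono:
  assumes "rem d k G G'" "k' \<le> k"
  shows "rem d k' G G'"
  unfolding rem_def
proof
  fix e assume "e \<in> G - G'"
  then obtain a b where "pt a b \<in> e" "0 \<le> a" "a \<le> d" "k + 1 \<le> b" "b \<le> d + 1" "d + 1 \<le> a + b"
    using remD[OF assms(1), of e] by auto
  then show "\<exists>a b. pt a b \<in> e \<and> 0 \<le> a \<and> a \<le> d \<and> k' + 1 \<le> b \<and> b \<le> d + 1 \<and> d + 1 \<le> a + b"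
    using assms(2) by (intro exI[of _ a] exI[of _ b]) simp
qed

lemma rem_at:
  assumes "\<And>e. e \<in> G \<Longrightarrow> e \<notin> G' \<Longrightarrow> pt (d - k) (k + 1) \<in> e" "0 \<le> k" "k \<le> d"
  shows "rem d k G G'"
  unfolding rem_def
proof
  fix e assume "e \<in> G - G'"
  then have "pt (d - k) (k + 1) \<in> e" using assms(1) by simp
  then show "\<exists>a b. pt a b \<in> e \<and> 0 \<le> a \<and> a \<le> d \<and> k + 1 \<le> b \<and> b \<le> d + 1 \<and> d + 1 \<le> a + b"
    using assms(2,3) by (intro exI[of _ "d - k"] exI[of _ "k + 1"]) simp
qed

lemma rem_edge:
  assumes "rem d k G G'" "{pt (d + 1 - t) t, pt (d - t) (t + 1)} \<in> G" "t < k"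
  shows "{pt (d + 1 - t) t, pt (d - t) (t + 1)} \<in> G'"
proof (rule ccontr)
  assume "{pt (d + 1 - t) t, pt (d - t) (t + 1)} \<notin> G'"
  then show False using remD[OF assms(1,2)] assms(3) by auto
qed

lemma rem_lines:
  assumes "rem d k G G'" "lines d \<subseteq> G"
  shows "lines d \<subseteq> G'"
proof
  fix e assume e: "e \<in> lines d"
  then obtain a b where ab: "e = {pt (a + 1) b, pt a (b + 1)}" "a + b + 1 \<le> d"
    unfolding lines_def by auto
  show "e \<in> G'"
  proof (rule ccontr)
    assume "e \<notin> G'"
    moreover have "e \<in> G" using assms(2) e by blast
    ultimately show False using remD[OF assms(1), of e] ab by auto
  qed
qed

section \<open>Attaching the next vertex of a line\<close>

text \<open>The counterpart of \<open>free_base\<close> for any two consecutive directions: the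
  pivot is the neighbour \<open>y1\<close>, and at most one edge is deleted.\<close>

lemma pair_free:
  assumes g: "grove n G" and ij: "1 \<le> i" "1 \<le> j" "i + j < int n"
    and e: "\<And>y. {pt i j, y} \<in> G \<Longrightarrow> y = y1 \<or> y = y2"
    and c: "consecutive_around y1 (pt i j) y2"
  shows "\<exists>G' z. reach n G G' \<and> leaf G' (pt i j) z \<and> G - G' \<subseteq> {{y1, pt i j}}"
proof (cases "{pt i j, y1} \<in> G \<and> {pt i j, y2} \<in> G")
  case True
  have d: "y1 \<noteq> y2" using consecutiveD(1)[OF c] by (cases y1) auto
  have ne: "y1 \<noteq> pt i j" "y2 \<noteq> pt i j" using True grove_edge_vertices(3)[OF g] by metis+
  define G' where "G' = insert {y1, y2} (G - {{y1, pt i j}})"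
  have "{y1, pt i j} \<in> G" using True by (simp only: insert_commute)
  then have "step n G G'" unfolding G'_def
    using True d by (intro step_two_edges[OF g _ _ _ c]) simp_all
  moreover have "leaf G' (pt i j) y2"
  proof (rule leafI)
    show "{pt i j, y2} \<in> G'" using True d ne by (simp add: G'_def doubleton_eq_iff)
    fix y assume y: "{pt i j, y} \<in> G'"
    then have "{pt i j, y} \<in> G" "y \<noteq> y1" using ne by (auto simp: G'_def doubleton_eq_iff)
    then show "y = y2" using e[of y] by simp
  qed
  moreover have "G - G' \<subseteq> {{y1, pt i j}}" unfolding G'_def by blast
  ultimately show ?thesis by blast
next
  case False
  obtain y where y: "{pt i j, y} \<in> G" using interior_edge[OF g ij] .
  have "leaf G (pt i j) y"
  proof (rule leafI[OF y])
    fix z assume z: "{pt i j, z} \<in> G"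
    show "z = y" using e[OF z] e[OF y] False y z by auto
  qed
  then show ?thesis by blast
qed

text \<open>Labels put the finished line \<open>d\<close> and the growing line \<open>d + 1\<close>
  into different components. The far end \<open>pt 0 (d + 1)\<close> already belongs to the second
  one, although the straight line has not reached it yet.\<close>

lemma corner_conn:
  assumes g: "grove n G" and d: "0 \<le> d" "2 * (d + 1) \<le> int n" and l: "lines d \<subseteq> G"
    and k: "0 \<le> k" "k \<le> d"
    and ch: "\<And>t. 0 \<le> t \<Longrightarrow> t < k \<Longrightarrow> {pt (d + 1 - t) t, pt (d - t) (t + 1)} \<in> G"
  shows "conn G (pt (d + 1) 0) (pt (d + 1 - k) k)"
    "\<And>t. 0 \<le> t \<Longrightarrow> t \<le> d \<Longrightarrow> conn G (pt d 0) (pt (d - t) t)"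
    "\<not> conn G (pt d 0) (pt (d + 1) 0)"
    "\<not> conn G (pt d 0) (pt (d + 1 - k) k)"
    "conn G (pt (d + 1) 0) (pt 0 (d + 1))"
proof -
  show 1: "conn G (pt (d + 1) 0) (pt (d + 1 - k) k)"
    using ch by (intro conn_antidiagonal[OF _ k(1)]) (simp add: algebra_simps)
  show "conn G (pt d 0) (pt (d - t) t)" if "0 \<le> t" "t \<le> d" for t
    by (rule conn_antidiagonal[OF lines_edge[OF l] that(1)]) (use that in auto)
  have nd: "pt d 0 \<in> nodes n" "pt (d + 1) 0 \<in> nodes n" "pt 0 (d + 1) \<in> nodes n"
    using d by (auto simp: pt_node)
  then show 2: "\<not> conn G (pt d 0) (pt (d + 1) 0)"
    using g lb_neq[OF d] by (simp add: grove_def)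
  then show "\<not> conn G (pt d 0) (pt (d + 1 - k) k)"
    using conn_cong(2)[OF 1] by blast
  show "conn G (pt (d + 1) 0) (pt 0 (d + 1))"
    using g lb_pair[of "d + 1"] d nd by (simp add: grove_def)
qed

text \<open>If the next vertex hangs on the previous line, then the branch it carries contains no
  boundary vertex and may turn into another component.\<close>

lemma rotate_off_line:
  assumes g: "grove n G" and d: "0 \<le> d" "2 * (d + 1) \<le> int n" and l: "lines d \<subseteq> G"
    and k: "0 \<le> k" "k < d"
    and ch: "\<And>t. 0 \<le> t \<Longrightarrow> t < k \<Longrightarrow> {pt (d + 1 - t) t, pt (d - t) (t + 1)} \<in> G"
    and e: "{pt (d - k) (k + 1), P} \<in> G" "P = pt (d - k - 1) (k + 1) \<or> P = pt (d - k) k"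
  shows "\<exists>G'. reach n G G' \<and> {pt (d + 1 - k) k, pt (d - k) (k + 1)} \<in> G' \<and> rem d k G G'"
proof -
  let ?q = "pt (d - k) (k + 1)" let ?B = "G - {{?q, P}}" let ?P0 = "pt (d - k) k"
  let ?qk = "pt (d + 1 - k) k"
  note cc = corner_conn[OF g d l k(1) less_imp_le[OF k(2)] ch]
  have lB: "lines d \<subseteq> ?B"
  proof
    fix x assume x: "x \<in> lines d"
    then have "?q \<notin> x" unfolding lines_def by auto
    then show "x \<in> ?B" using x l by auto
  qed
  have cB: "conn ?B (pt d 0) (pt (d - t) t)" if "0 \<le> t" "t \<le> d" for t
    by (rule conn_antidiagonal[OF lines_edge[OF lB] that(1)]) (use that in auto)
  have cP: "conn ?B (pt d 0) P" using cB[of k] cB[of "k + 1"] e(2) k by (auto simp: algebra_simps)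
  have nq: "\<not> conn ?B ?q (pt d 0)"
    using grove_forest[OF g e(1)] conn_cong(2)[OF cP] by blast
  have BG: "conn ?B x y \<Longrightarrow> conn G x y" for x y by (erule conn_mono) blast
  have qG: "conn G (pt d 0) ?q"
    using conn_trans[OF BG[OF cP] conn_sym[OF conn_edge[OF e(1)]]] .
  have nqk: "\<not> conn ?B ?q ?qk"
  proof
    assume "conn ?B ?q ?qk"
    then show False using cc(4) conn_trans[OF qG BG] by simp
  qed
  have nP0: "\<not> conn ?B ?q ?P0"
    using nq conn_cong(2)[OF cB[of k]] k by simp
  \<comment> \<open>In \<open>G\<close> the branch is in the component of line \<open>d\<close>,
    whose only boundary vertices are the ends of that line; both stay connected with
    \<open>P\<close> after the deletion.\<close>
  have nfree: "\<not> conn ?B ?q x" if x: "x \<in> nodes n" for x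
  proof
    assume a: "conn ?B ?q x"
    have "conn G (pt d 0) x" using conn_trans[OF qG BG[OF a]] .
    moreover have "pt d 0 \<in> nodes n" using d by (simp add: pt_node)
    ultimately have "lb n x = lb n (pt d 0)" using g x by (simp add: grove_def)
    then have "x = pt (d - 0) 0 \<or> x = pt (d - d) d" using lb_only[of d x] d x by auto
    then have "conn ?B (pt d 0) x" using cB[of 0] cB[of d] d by auto
    then show False using nq conn_trans[OF a conn_sym] by simp
  qed
  have stp: "step n (insert {?q, y} ?B) (insert {?q, y'} ?B)"
    if "grove n (insert {?q, y} ?B)" "consecutive_around ?q y y'" "y' \<in> grove_vertices n"
      "\<not> conn ?B ?q y" "\<not> conn ?B ?q y'" for y y'
  proof -
    have eq: "insert {?q, y} ?B - {{?q, y}} = ?B" using that(4) conn_edge[of ?q y ?B] by auto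
    show ?thesis
      using step_spin[OF that(1) _ that(2,3), unfolded eq] that(5) nfree by simp
  qed
  have GB: "G = insert {?q, P} ?B" using e(1) by auto
  \<comment> \<open>The directions to \<open>pt (d - k - 1) (k + 1)\<close>, \<open>?P0\<close> and
    \<open>?qk\<close> are consecutive, so at most two turns lead onto the new line.\<close>
  have r0: "reach n G (insert {?q, ?P0} ?B)"
  proof (cases "P = ?P0")
    case True
    then show ?thesis using GB by simp
  next
    case False
    then have P: "P = pt (d - k - 1) (k + 1)" using e(2) by simp
    have "step n (insert {?q, P} ?B) (insert {?q, ?P0} ?B)"
    proof (rule stp)
      show "grove n (insert {?q, P} ?B)" using g GB by simp
      show "consecutive_around ?q P ?P0" unfolding P by (rule pt_consecutive) simp
      show "?P0 \<in> grove_vertices n" using d k by (simp add: pt_vertex)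
      show "\<not> conn ?B ?q P" using grove_forest[OF g e(1)] .
    qed (rule nP0)
    then show ?thesis using GB by auto
  qed
  have "step n (insert {?q, ?P0} ?B) (insert {?q, ?qk} ?B)"
  proof (rule stp[OF _ _ _ nP0 nqk])
    show "grove n (insert {?q, ?P0} ?B)" using reach_grove[OF r0 g] .
    show "consecutive_around ?q ?P0 ?qk" by (rule pt_consecutive) simp
    show "?qk \<in> grove_vertices n" using d k by (simp add: pt_vertex)
  qed
  then have "reach n G (insert {?q, ?qk} ?B)" using r0 by (rule rtranclp.rtrancl_into_rtrancl[rotated])
  moreover have "rem d k G (insert {?q, ?qk} ?B)" by (rule rem_at) (use k in auto)
  ultimately show ?thesis by (intro exI[of _ "insert {?q, ?qk} ?B"]) (simp add: insert_commute)
qed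

text \<open>The end of the line is a boundary vertex, so it cannot be turned like an interior leaf.
  But its neighbours along the side carry other labels, so apart from the wanted edge only the one
  to \<open>pt 1 (d + 1)\<close> is possible; deleting that one isolates the vertex and leaves
  \<open>pt 1 d\<close> on the other side. To exclude \<open>pt 0 (d + 2)\<close>, the range of
  \<open>lb_neq'\<close> extends one step further than that of \<open>lb_neq\<close>.\<close>

lemma last_vertex:
  assumes g: "grove n G" and d: "0 \<le> d" "2 * (d + 1) \<le> int n" and l: "lines d \<subseteq> G"
    and ch: "\<And>t. 0 \<le> t \<Longrightarrow> t < d \<Longrightarrow> {pt (d + 1 - t) t, pt (d - t) (t + 1)} \<in> G"
  shows "\<exists>G'. reach n G G' \<and> {pt 1 d, pt 0 (d + 1)} \<in> G' \<and> rem d d G G'"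
proof (cases "{pt 0 (d + 1), pt 1 d} \<in> G")
  case True
  then show ?thesis using rem_refl by (intro exI[of _ G]) (simp add: insert_commute)
next
  case False
  let ?q = "pt 0 (d + 1)" let ?u = "pt 1 (d + 1)"
  note cc = corner_conn[OF g d l d(1) order_refl ch]
  have qq: "conn G ?q (pt 1 d)" using conn_trans[OF conn_sym[OF cc(5)] cc(1)] by simp
  have qn: "?q \<in> nodes n" using d by (simp add: pt_node)
  have ed: "y = ?u" if y: "{?q, y} \<in> G" for y
  proof -
    have yv: "y \<in> grove_vertices n" using grove_edge_vertices[OF g y] by simp
    have lbq: "lb n y = lb n ?q" if "y \<in> nodes n"
      using g qn that conn_edge[OF y] by (simp add: grove_def)
    have "y \<noteq> pt 0 (d + 2)"
      using lbq lb_neq'[of "d + 1"] yv d by (auto simp: pt_vertex pt_node algebra_simps)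
    moreover have "y \<noteq> pt 0 d"
      using lbq lb_neq'[of d] yv d by (auto simp: pt_vertex pt_node)
    ultimately show ?thesis
      using edge_dirs[OF g y] yv y False by (auto simp: pt_vertex algebra_simps)
  qed
  have "?q \<noteq> pt 1 d" by simp
  then obtain y where "{?q, y} \<in> G" using conn_first_edge[OF qq] by metis
  then have e: "{?q, ?u} \<in> G" using ed by metis
  let ?B = "G - {{?q, ?u}}"
  have iso: "\<not> conn ?B ?q (pt 1 d)"
    using conn_isolated[of ?B ?q "pt 1 d"] ed by fastforce
  have cu: "conn ?B ?u (pt 1 d)"
    using qq iso grove_forest[OF g e] unfolding conn_split[OF e] by blast
  have "step n G (insert {?q, pt 1 d} ?B)"
  proof (rule step_spin[OF g e _ _ iso])
    show "consecutive_around ?q ?u (pt 1 d)" by (rule pt_consecutive_sym) simp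
    show "pt 1 d \<in> grove_vertices n" using d by (simp add: pt_vertex)
  qed (use cu in blast)
  moreover have "rem d d G (insert {?q, pt 1 d} ?B)" by (rule rem_at) (use d in auto)
  ultimately show ?thesis
    by (intro exI[of _ "insert {?q, pt 1 d} ?B"]) (auto simp: insert_commute)
qed

text \<open>The cases distinguish the component of \<open>?q\<close>: that of the new line, that of
  the previous line, or a foreign one. In the first two a triangle move at one of the lines,
  followed by \<open>pair_free\<close> or \<open>rotate_off_line\<close>, is enough; only the third
  needs \<open>free_vertex\<close>.\<close>

lemma attach_vertex:
  assumes g: "grove n G" and d: "0 \<le> d" "2 * (d + 1) \<le> int n" and l: "lines d \<subseteq> G"
    and k: "0 \<le> k" "k \<le> d"
    and ch: "\<And>t. 0 \<le> t \<Longrightarrow> t < k \<Longrightarrow> {pt (d + 1 - t) t, pt (d - t) (t + 1)} \<in> G"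
  shows "\<exists>G'. reach n G G' \<and> {pt (d + 1 - k) k, pt (d - k) (k + 1)} \<in> G' \<and> rem d k G G'"
proof -
  let ?q = "pt (d - k) (k + 1)" let ?qk = "pt (d + 1 - k) k"
  consider "k = d" | "{?q, ?qk} \<in> G" | "k < d" "{?q, ?qk} \<notin> G" using k by linarith
  then show ?thesis
  proof cases
    case 1
    then show ?thesis using last_vertex[OF g d l] ch by simp
  next
    case 2
    then show ?thesis using rem_refl by (intro exI[of _ G]) (simp add: insert_commute)
  next
    case 3
    let ?U = "pt (d - k + 1) (k + 1)" let ?W = "pt (d - k) (k + 1 + 1)"
    let ?X = "pt (d - k - 1) (k + 1 + 1)" let ?P1 = "pt (d - k - 1) (k + 1)" let ?P0 = "pt (d - k) k"
    have ij: "1 \<le> d - k" "1 \<le> k + 1" "d - k + (k + 1) < int n" using d k 3(1) by simp_all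
    note cc = corner_conn[OF g d l k ch]
    have c1: "conn G (pt (d + 1) 0) ?qk" and c5: "conn G (pt (d + 1) 0) (pt 0 (d + 1))"
      using cc(1,5) by simp_all
    have cl: "conn G (pt d 0) (pt (d - r) r)" if "0 \<le> r" "r \<le> d" for r
      using cc(2)[of r] that by simp
    have cP: "conn G (pt d 0) ?P0" "conn G (pt d 0) ?P1"
      using cc(2)[of k] cc(2)[of "k + 1"] 3(1) k by (simp_all add: algebra_simps)
    have ed: "y = ?U \<or> y = ?W \<or> y = ?X \<or> y = ?P1 \<or> y = ?P0" if y: "{?q, y} \<in> G" for y
      using edge_dirs[OF g y] y 3(2) by (auto simp: algebra_simps)
    have fin: "\<exists>G'. reach n G G' \<and> {?qk, ?q} \<in> G' \<and> rem d k G G'"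
      if r: "reach n G H" and lf: "leaf H ?q z" and m: "rem d k G H" for H z
    proof -
      have "reach n H (insert {?q, ?qk} (H - {{?q, z}}))"
        by (rule interior_leaf_move[OF reach_grove[OF r g] ij lf]) (simp add: pt_neighbours algebra_simps)
      with r have "reach n G (insert {?q, ?qk} (H - {{?q, z}}))" by (rule rtranclp_trans)
      moreover have "rem d k H (insert {?q, ?qk} (H - {{?q, z}}))"
        by (rule rem_at) (use k in auto)
      ultimately show ?thesis using rem_trans[OF m]
        by (intro exI[of _ "insert {?q, ?qk} (H - {{?q, z}})"]) (simp add: insert_commute)
    qed
    have pair: "\<exists>G'. reach n G G' \<and> {?qk, ?q} \<in> G' \<and> rem d k G G'"
      if r: "reach n G H" and m: "rem d k G H" and e: "\<And>y. {?q, y} \<in> H \<Longrightarrow> y = y1 \<or> y = y2"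
        and c: "consecutive_around y1 ?q y2" for H y1 y2
    proof -
      obtain H' z where H': "reach n H H'" "leaf H' ?q z" "H - H' \<subseteq> {{y1, ?q}}"
        using pair_free[OF reach_grove[OF r g] ij e c] by auto
      have "rem d k H H'" by (rule rem_at) (use H'(3) k in auto)
      then show ?thesis using fin[OF rtranclp_trans[OF r H'(1)] H'(2) rem_trans[OF m]] by blast
    qed
    have one: "rem d k G (insert f (G - {{?q, y}}))" for f y
      by (rule rem_at) (use k in auto)
    consider (C) "conn G ?qk ?q" | (D) "conn G (pt d 0) ?q"
      | (O) "\<not> conn G ?qk ?q" "\<not> conn G (pt d 0) ?q" by blast
    then show ?thesis
    proof cases
      case C
      \<comment> \<open>An edge from \<open>?q\<close> to the previous line would connect it with
        the new one.\<close>
      have nP: "y = ?U \<or> y = ?W \<or> y = ?X" if y: "{?q, y} \<in> G" for y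
      proof -
        have "conn G ?qk y" using conn_trans[OF C conn_edge[OF y]] .
        then have "\<not> conn G (pt d 0) y" using cc(4) conn_cong(2) by metis
        then show ?thesis using ed[OF y] cP by auto
      qed
      have cX: "consecutive_around ?X ?q ?W" by (rule pt_consecutive) simp
      show ?thesis
      proof (cases "{?q, ?U} \<in> G")
        case False
        have "y = ?X \<or> y = ?W" if "{?q, y} \<in> G" for y using nP[OF that] that False by auto
        then show ?thesis by (rule pair[OF rtranclp.rtrancl_refl rem_refl _ cX])
      next
        case True
        \<comment> \<open>The directions \<open>?U\<close>, \<open>?W\<close>, \<open>?X\<close> are
          too many for \<open>pair_free\<close>. The triangle with \<open>?qk\<close> either
          produces the wanted edge or removes the edge to \<open>?U\<close>.\<close>
        have "step n G (insert {?q, ?qk} (G - {{?q, ?U}})) \<or> step n G (insert {?U, ?qk} (G - {{?q, ?U}}))"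
        proof (rule step_triangle[OF g True conn_sym[OF C]])
          show "?qk \<in> grove_vertices n" using d k by (simp add: pt_vertex)
          show "consecutive_around ?q ?U ?qk" by (rule pt_consecutive_sym) simp
          show "consecutive_around ?U ?q ?qk" by (rule pt_consecutive) simp
        qed
        then show ?thesis
        proof
          let ?H = "insert {?q, ?qk} (G - {{?q, ?U}})"
          assume "step n G ?H"
          moreover have "{?qk, ?q} \<in> ?H" by (simp add: insert_commute)
          ultimately show ?thesis using one r_into_rtranclp[of "step n" G ?H] by blast
        next
          let ?H = "insert {?U, ?qk} (G - {{?q, ?U}})"
          assume s: "step n G ?H"
          have "y = ?X \<or> y = ?W" if y: "{?q, y} \<in> ?H" for y
          proof -
            have "{?q, y} \<in> G" "y \<noteq> ?U" using y by (auto simp: doubleton_eq_iff)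
            then show ?thesis using nP[of y] by auto
          qed
          then show ?thesis by (rule pair[OF r_into_rtranclp[of "step n", OF s] one _ cX])
        qed
      qed
    next
      case D
      show ?thesis
      proof (cases "{?q, ?P1} \<in> G \<or> {?q, ?P0} \<in> G")
        case True
        then show ?thesis using rotate_off_line[OF g d l k(1) 3(1) ch] by blast
      next
        case nP: False
        have cU: "consecutive_around ?U ?q ?W" by (rule pt_consecutive_sym) simp
        show ?thesis
        proof (cases "{?q, ?X} \<in> G")
          case False
          have "y = ?U \<or> y = ?W" if "{?q, y} \<in> G" for y using ed[OF that] that False nP by auto
          then show ?thesis by (rule pair[OF rtranclp.rtrancl_refl rem_refl _ cU])
        next
          case True
          \<comment> \<open>The same exchange with the previous line: either \<open>?q\<close> comes
            to hang on it, or the edge to \<open>?X\<close> disappears and two consecutive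
            directions remain.\<close>
          have "step n G (insert {?q, ?P1} (G - {{?q, ?X}})) \<or> step n G (insert {?X, ?P1} (G - {{?q, ?X}}))"
          proof (rule step_triangle[OF g True])
            show "conn G ?q ?P1" using conn_trans[OF conn_sym[OF D] cP(2)] .
            show "?P1 \<in> grove_vertices n" using d k 3(1) by (simp add: pt_vertex)
            show "consecutive_around ?q ?X ?P1" by (rule pt_consecutive) simp
            show "consecutive_around ?X ?q ?P1" by (rule pt_consecutive_sym) simp
          qed
          then show ?thesis
          proof
            let ?H = "insert {?q, ?P1} (G - {{?q, ?X}})"
            assume s: "step n G ?H"
            then have gH: "grove n ?H" by (simp add: step_def)
            have "\<exists>G'. reach n ?H G' \<and> {?qk, ?q} \<in> G' \<and> rem d k ?H G'"
            proof (rule rotate_off_line[OF gH d _ k(1) 3(1)])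
              show "lines d \<subseteq> ?H" using rem_lines[OF one l] .
              show "{pt (d + 1 - t) t, pt (d - t) (t + 1)} \<in> ?H" if "0 \<le> t" "t < k" for t
                using rem_edge[OF one ch[OF that] that(2)] .
              show "{?q, ?P1} \<in> ?H" by simp
            qed simp
            then obtain G' where "reach n ?H G'" "{?qk, ?q} \<in> G'" "rem d k ?H G'" by blast
            then show ?thesis
              using converse_rtranclp_into_rtranclp[of "step n", OF s] rem_trans[OF one] by blast
          next
            let ?H = "insert {?X, ?P1} (G - {{?q, ?X}})"
            assume s: "step n G ?H"
            have "y = ?U \<or> y = ?W" if y: "{?q, y} \<in> ?H" for y
            proof -
              have "{?q, y} \<in> G" "y \<noteq> ?X" using y by (auto simp: doubleton_eq_iff)
              then show ?thesis using ed[of y] nP by auto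
            qed
            then show ?thesis by (rule pair[OF r_into_rtranclp[of "step n", OF s] one _ cU])
          qed
        qed
      qed
    next
      case O
      let ?P = "\<lambda>t. {pt (d - k - int t) (k + 1 + int t), pt (d - k - int t - 1) (k + 1 + int t + 1)} \<notin> G"
      have cs: "conn G ?q (pt (d - k - int t) (k + 1 + int t))" if "\<And>r. r < t \<Longrightarrow> \<not> ?P r" for t
        using that
      proof (induction t)
        case (Suc t)
        have "conn G (pt (d - k - int t) (k + 1 + int t)) (pt (d - k - int (Suc t)) (k + 1 + int (Suc t)))"
          using conn_edge[of _ _ G] Suc.prems[of t] by (simp add: algebra_simps)
        then show ?case using conn_trans[OF Suc.IH] Suc.prems by simp
      qed simp
      \<comment> \<open>A chain running the whole length would end at \<open>pt 0 (d + 1)\<close>,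
        which is in the component of the new line.\<close>
      have ex: "\<exists>t < nat (d - k). ?P t"
      proof (rule ccontr)
        assume "\<not> (\<exists>t < nat (d - k). ?P t)"
        then have "conn G ?q (pt (d - k - int (nat (d - k))) (k + 1 + int (nat (d - k))))"
          by (intro cs) blast
        then have "conn G ?q (pt 0 (d + 1))" using 3(1) by (simp add: algebra_simps)
        then have "conn G (pt (d + 1) 0) ?q" using conn_trans[OF c5 conn_sym] by blast
        then show False using O(1) conn_trans[OF conn_sym[OF c1]] by blast
      qed
      define m where "m = (LEAST t. ?P t)"
      obtain t0 where t0: "t0 < nat (d - k)" "?P t0" using ex by blast
      have Pm: "?P m" unfolding m_def by (rule LeastI[of ?P, OF t0(2)])
      have "m < nat (d - k)" using Least_le[of ?P, OF t0(2)] t0(1) unfolding m_def by linarith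
      then have mi: "int m < d - k" by linarith
      have below: "\<not> ?P t" if "t < m" for t using not_less_Least[of t ?P] that unfolding m_def by blast
      have sep: "{pt (d - k - int t) (k + 1 + int t), pt (d - r) r} \<notin> G" if "t \<le> m" "0 \<le> r" "r \<le> d" for t r
      proof
        assume "{pt (d - k - int t) (k + 1 + int t), pt (d - r) r} \<in> G"
        moreover have "conn G ?q (pt (d - k - int t) (k + 1 + int t))" using cs[of t] below that(1) by simp
        ultimately have "conn G ?q (pt (d - r) r)" using conn_trans[OF _ conn_edge] by metis
        then show False using O(2) conn_trans[OF cl[OF that(2,3)] conn_sym] by metis
      qed
      have "\<exists>G' z. reach n G G' \<and> leaf G' ?q z \<and> moved (d - k) (k + 1) m G G'"
      proof (rule free_vertex[OF g ij(2) mi])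
        show "d - k + (k + 1) + int m < int n" using d k mi by simp
        show "{pt (d - k - int t) (k + 1 + int t), pt (d - k - int t - 1) (k + 1 + int t + 1)} \<in> G"
          if "t < m" for t using below[OF that] by simp
        show "{pt (d - k - int m) (k + 1 + int m), pt (d - k - int m - 1) (k + 1 + int m + 1)} \<notin> G"
          using Pm .
        show "{pt (d - k - int t) (k + 1 + int t), pt (d - k - int t - 1) (k + 1 + int t)} \<notin> G" if "t \<le> m" for t
          using sep[OF that, of "k + 1 + int t"] that mi k by (simp add: algebra_simps)
        show "{pt (d - k - int t) (k + 1 + int t), pt (d - k - int t) (k + 1 + int t - 1)} \<notin> G" if "t \<le> m" for t
          using sep[OF that, of "k + int t"] that mi k by (simp add: algebra_simps)
        show "{?q, pt (d - k + 1) (k + 1 - 1)} \<notin> G" using 3(2) by (simp add: algebra_simps)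
      qed
      then obtain G' z where G': "reach n G G'" "leaf G' ?q z" "moved (d - k) (k + 1) m G G'" by blast
      \<comment> \<open>Because \<open>m < d - k\<close>, the triangle allowed by
        \<open>moved\<close> lies inside the region allowed by \<open>rem\<close>.\<close>
      have "rem d k G G'" unfolding rem_def
      proof
        fix e assume "e \<in> G - G'"
        then obtain a b where "0 \<le> a" "0 \<le> b" "a + b \<le> int m" "pt (d - k - a) (k + 1 + a + b) \<in> e"
          using moved_removed[OF G'(3), of e] by auto
        then show "\<exists>a b. pt a b \<in> e \<and> 0 \<le> a \<and> a \<le> d \<and> k + 1 \<le> b \<and> b \<le> d + 1 \<and> d + 1 \<le> a + b"
          using mi k by (intro exI[of _ "d - k - a"] exI[of _ "k + 1 + a + b"]) simp
      qed
      then show ?thesis by (rule fin[OF G'(1,2)])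
    qed
  qed
qed

section \<open>Completing the lines at a corner\<close>

lemma peel_line:
  assumes g: "grove n G" and d: "0 \<le> d" "2 * (d + 1) \<le> int n" and l: "lines d \<subseteq> G"
  shows "\<exists>G'. reach n G G' \<and> lines (d + 1) \<subseteq> G' \<and> rem d 0 G G'"
proof -
  have "0 \<le> k \<Longrightarrow> k \<le> d + 1 \<Longrightarrow> \<exists>G'. reach n G G' \<and> rem d 0 G G' \<and>
    (\<forall>t. 0 \<le> t \<longrightarrow> t < k \<longrightarrow> {pt (d + 1 - t) t, pt (d - t) (t + 1)} \<in> G')" for k
  proof (induction k rule: int_ge_induct)
    case base
    then show ?case using rem_refl by (intro exI[of _ G]) simp
  next
    case (step k)
    then obtain H where H: "reach n G H" "rem d 0 G H"
      "\<And>t. 0 \<le> t \<Longrightarrow> t < k \<Longrightarrow> {pt (d + 1 - t) t, pt (d - t) (t + 1)} \<in> H" by auto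
    have "\<exists>G'. reach n H G' \<and> {pt (d + 1 - k) k, pt (d - k) (k + 1)} \<in> G' \<and> rem d k H G'"
      using step by (intro attach_vertex[OF reach_grove[OF H(1) g] d rem_lines[OF H(2) l] _ _ H(3)]) auto
    then obtain G' where G': "reach n H G'" "{pt (d + 1 - k) k, pt (d - k) (k + 1)} \<in> G'" "rem d k H G'"
      by blast
    have "{pt (d + 1 - t) t, pt (d - t) (t + 1)} \<in> G'" if "0 \<le> t" "t < k + 1" for t
    proof (cases "t = k")
      case True
      then show ?thesis using G'(2) by simp
    next
      case False
      then have "t < k" using that by simp
      then show ?thesis using rem_edge[OF G'(3) H(3)] that by simp
    qed
    moreover have "rem d 0 G G'" using rem_trans[OF H(2) rem_mono[OF G'(3) step.hyps]] .
    ultimately show ?case using rtranclp_trans[OF H(1) G'(1)] by blast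
  qed
  from this[of "d + 1"] obtain G' where G': "reach n G G'" "rem d 0 G G'"
    "\<And>t. 0 \<le> t \<Longrightarrow> t < d + 1 \<Longrightarrow> {pt (d + 1 - t) t, pt (d - t) (t + 1)} \<in> G'" using d by auto
  have "lines (d + 1) \<subseteq> G'"
  proof
    fix e assume "e \<in> lines (d + 1)"
    then obtain a b where ab: "e = {pt (a + 1) b, pt a (b + 1)}" "0 \<le> a" "0 \<le> b" "a + b + 1 \<le> d + 1"
      unfolding lines_def by auto
    show "e \<in> G'"
    proof (cases "a + b + 1 = d + 1")
      case True
      then have "e = {pt (d + 1 - b) b, pt (d - b) (b + 1)}" using ab(1) by auto
      then show ?thesis using G'(3)[of b] ab(2-4) by simp
    next
      case False
      then have "a + b + 1 \<le> d" using ab(4) by simp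
      then have "e \<in> lines d" using ab(1-3) unfolding lines_def by blast
      then show ?thesis using rem_lines[OF G'(2) l] by blast
    qed
  qed
  then show ?thesis using G' by blast
qed

text \<open>The strictness of the bound on \<open>a\<close> matters: for even \<open>n\<close> it
  keeps the deletions at the west corner off the last line of the east corner.\<close>

lemma peel_corner:
  assumes g: "grove n G" and D: "2 * int D \<le> int n"
  shows "\<exists>G'. reach n G G' \<and> lines (int D) \<subseteq> G' \<and>
    (\<forall>e \<in> G - G'. \<exists>a b. pt a b \<in> e \<and> a < int D \<and> b \<le> int D)"
  using D
proof (induction D)
  case 0
  have "lines 0 = {}" unfolding lines_def by auto
  then show ?case by (intro exI[of _ G]) simp
next
  case (Suc D)
  then obtain H where H: "reach n G H" "lines (int D) \<subseteq> H"
    "\<forall>e \<in> G - H. \<exists>a b. pt a b \<in> e \<and> a < int D \<and> b \<le> int D" by auto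
  obtain G' where G': "reach n H G'" "lines (int D + 1) \<subseteq> G'" "rem (int D) 0 H G'"
    using peel_line[OF reach_grove[OF H(1) g] _ _ H(2)] Suc.prems by auto
  have "\<exists>a b. pt a b \<in> e \<and> a < int (Suc D) \<and> b \<le> int (Suc D)" if e: "e \<in> G - G'" for e
  proof (cases "e \<in> H")
    case True
    then obtain a b where "pt a b \<in> e" "a \<le> int D" "b \<le> int D + 1" using remD[OF G'(3), of e] e by auto
    then show ?thesis by (intro exI[of _ a] exI[of _ b]) simp
  next
    case False
    then obtain a b where "pt a b \<in> e" "a < int D" "b \<le> int D" using H(3) e by blast
    then show ?thesis by (intro exI[of _ a] exI[of _ b]) simp
  qed
  moreover have "lines (int (Suc D)) \<subseteq> G'" using G'(2) by (simp add: add.commute)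
  ultimately show ?case using rtranclp_trans[OF H(1) G'(1)] by blast
qed

end

section \<open>The three corners\<close>

text \<open>At the east and west corners \<open>i\<close> runs along the top side and
  \<open>j\<close> down the slanted side. At the south corner \<open>i\<close> runs up the east side
  and \<open>j\<close> up the west side.\<close>

definition east_pt :: "nat \<Rightarrow> int \<Rightarrow> int \<Rightarrow> point" where
  "east_pt n i j = (int n - 2 * i - j, - j)"

definition west_pt :: "nat \<Rightarrow> int \<Rightarrow> int \<Rightarrow> point" where
  "west_pt n i j = (- int n + 2 * i + j, - j)"

definition south_pt :: "nat \<Rightarrow> int \<Rightarrow> int \<Rightarrow> point" where
  "south_pt n i j = (i - j, - int n + i + j)"

lemma grove_vertices_iff':
  "(x, y) \<in> grove_vertices n \<longleftrightarrow> x - y \<le> int n \<and> - x - y \<le> int n \<and> y \<le> 0 \<and> even (x + y + int n)"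
  unfolding grove_vertices_iff by linarith

lemma nodes_iff':
  "(x, y) \<in> nodes n \<longleftrightarrow> (x, y) \<in> grove_vertices n \<and> (y = 0 \<or> x - y = int n \<or> - x - y = int n)"
  unfolding nodes_def grove_vertices_iff by (auto simp: abs_if)

text \<open>Both orders are provided because the east and south coordinates reverse the cyclic order
  of the neighbours.\<close>

lemma consecutive_offsets:
  assumes "(p, q, r, s) \<in>
    {(-1, 1, 1, 1), (1, 1, 2, 0), (2, 0, 1, -1), (1, -1, -1, -1), (-1, -1, -2, 0), (-2, 0, -1, 1)}"
  shows "consecutive_around (x, y) (x + p, y + q) (x + r, y + s)"
    "consecutive_around (x, y) (x + r, y + s) (x + p, y + q)"
proof -
  have nth: "consecutive_around (x, y) (x - 1, y + 1) (x + 1, y + 1)"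
    "consecutive_around (x, y) (x + 1, y + 1) (x + 2, y)"
    "consecutive_around (x, y) (x + 2, y) (x + 1, y - 1)"
    "consecutive_around (x, y) (x + 1, y - 1) (x - 1, y - 1)"
    "consecutive_around (x, y) (x - 1, y - 1) (x - 2, y)"
    "consecutive_around (x, y) (x - 2, y) (x - 1, y + 1)"
    using consecutive_nth[of 0 "(x, y)"] consecutive_nth[of 1 "(x, y)"] consecutive_nth[of 2 "(x, y)"]
      consecutive_nth[of 3 "(x, y)"] consecutive_nth[of 4 "(x, y)"] consecutive_nth[of 5 "(x, y)"]
    by simp_all
  show "consecutive_around (x, y) (x + p, y + q) (x + r, y + s)"
    using assms by (elim insertE emptyE; simp add: nth)
  then show "consecutive_around (x, y) (x + r, y + s) (x + p, y + q)" by (rule consecutive_sym)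
qed

lemma corner_east:
  assumes "n \<ge> 1"
  shows "corner n (east_pt n)"
proof
  fix i j i' j' :: int
  show "east_pt n i j = east_pt n i' j' \<longleftrightarrow> i = i' \<and> j = j'" by (auto simp: east_pt_def)
  show V: "east_pt n i j \<in> grove_vertices n \<longleftrightarrow> 0 \<le> i \<and> 0 \<le> j \<and> i + j \<le> int n"
  proof -
    \<comment> \<open>Parity holds automatically in corner coordinates, so only linear conditions
      remain.\<close>
    have "even (int n - 2 * i - j + - j + int n)" by simp
    then show ?thesis unfolding east_pt_def grove_vertices_iff' by linarith
  qed
  show "set (neighbours (east_pt n i j)) = {east_pt n (i + 1) j, east_pt n i (j + 1),
      east_pt n (i - 1) (j + 1), east_pt n (i - 1) j, east_pt n i (j - 1), east_pt n (i + 1) (j - 1)}"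
    by (auto simp: east_pt_def)
  show "east_pt n i j \<in> nodes n \<longleftrightarrow>
      0 \<le> i \<and> 0 \<le> j \<and> i + j \<le> int n \<and> (i = 0 \<or> j = 0 \<or> i + j = int n)"
    using V unfolding east_pt_def nodes_iff' by auto
next
  fix a i b j c d :: int
  assume *: "(a - i, b - j, c - i, d - j) \<in>
      {(1, 0, 0, 1), (0, 1, -1, 1), (-1, 1, -1, 0), (-1, 0, 0, -1), (0, -1, 1, -1), (1, -1, 1, 0)}"
  have "(- 2 * r - s, - s, - 2 * p - q, - q) \<in>
      {(-1, 1, 1, 1), (1, 1, 2, 0), (2, 0, 1, -1), (1, -1, -1, -1), (-1, -1, -2, 0), (-2, 0, -1, 1)}"
    if "(p, q, r, s) \<in>
      {(1, 0, 0, 1), (0, 1, -1, 1), (-1, 1, -1, 0), (-1, 0, 0, -1), (0, -1, 1, -1), (1, -1, 1, 0)}" for p q r s :: int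
    using that by (elim insertE emptyE; simp)
  from consecutive_offsets(2)[OF this[OF *], of "int n - 2 * i - j" "- j"]
  show "consecutive_around (east_pt n i j) (east_pt n a b) (east_pt n c d)"
    by (simp add: east_pt_def algebra_simps)
next
  fix d :: int
  assume d: "0 \<le> d"
  show "lb n (east_pt n d 0) = lb n (east_pt n 0 d)" if "2 * d \<le> int n"
    using d that assms by (auto simp: east_pt_def lb_def)
  show "lb n (east_pt n d 0) \<noteq> lb n (east_pt n (d + 1) 0)" if "2 * (d + 1) \<le> int n"
    using d that assms by (auto simp: east_pt_def lb_def)
  show "lb n (east_pt n 0 d) \<noteq> lb n (east_pt n 0 (d + 1))" if "2 * d \<le> int n"
    using d that assms by (auto simp: east_pt_def lb_def)
  show "x = east_pt n d 0 \<or> x = east_pt n 0 d"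
    if "2 * d < int n" "x \<in> nodes n" "lb n x = lb n (east_pt n d 0)" for x
  proof -
    have "x \<in> block n (int n - 2 * d, 0)" using that by (simp add: block_def east_pt_def)
    then show ?thesis using block_east[of "int n - 2 * d" n d] d that(1) by (auto simp: east_pt_def)
  qed
qed

lemma corner_west:
  assumes "n \<ge> 1"
  shows "corner n (west_pt n)"
proof
  fix i j i' j' :: int
  show "west_pt n i j = west_pt n i' j' \<longleftrightarrow> i = i' \<and> j = j'" by (auto simp: west_pt_def)
  show V: "west_pt n i j \<in> grove_vertices n \<longleftrightarrow> 0 \<le> i \<and> 0 \<le> j \<and> i + j \<le> int n"
  proof -
    have "even (- int n + 2 * i + j + - j + int n)" by simp
    then show ?thesis unfolding west_pt_def grove_vertices_iff' by linarith
  qed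
  show "set (neighbours (west_pt n i j)) = {west_pt n (i + 1) j, west_pt n i (j + 1),
      west_pt n (i - 1) (j + 1), west_pt n (i - 1) j, west_pt n i (j - 1), west_pt n (i + 1) (j - 1)}"
    by (auto simp: west_pt_def)
  show "west_pt n i j \<in> nodes n \<longleftrightarrow>
      0 \<le> i \<and> 0 \<le> j \<and> i + j \<le> int n \<and> (i = 0 \<or> j = 0 \<or> i + j = int n)"
    using V unfolding west_pt_def nodes_iff' by auto
next
  fix a i b j c d :: int
  assume *: "(a - i, b - j, c - i, d - j) \<in>
      {(1, 0, 0, 1), (0, 1, -1, 1), (-1, 1, -1, 0), (-1, 0, 0, -1), (0, -1, 1, -1), (1, -1, 1, 0)}"
  have "(2 * p + q, - q, 2 * r + s, - s) \<in>
      {(-1, 1, 1, 1), (1, 1, 2, 0), (2, 0, 1, -1), (1, -1, -1, -1), (-1, -1, -2, 0), (-2, 0, -1, 1)}"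
    if "(p, q, r, s) \<in>
      {(1, 0, 0, 1), (0, 1, -1, 1), (-1, 1, -1, 0), (-1, 0, 0, -1), (0, -1, 1, -1), (1, -1, 1, 0)}" for p q r s :: int
    using that by (elim insertE emptyE; simp)
  from consecutive_offsets(1)[OF this[OF *], of "- int n + 2 * i + j" "- j"]
  show "consecutive_around (west_pt n i j) (west_pt n a b) (west_pt n c d)"
    by (simp add: west_pt_def algebra_simps)
next
  fix d :: int
  assume d: "0 \<le> d"
  show "lb n (west_pt n d 0) = lb n (west_pt n 0 d)" if "2 * d \<le> int n"
    using d that assms by (auto simp: west_pt_def lb_def)
  show "lb n (west_pt n d 0) \<noteq> lb n (west_pt n (d + 1) 0)" if "2 * (d + 1) \<le> int n"
    using d that assms by (auto simp: west_pt_def lb_def)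
  show "lb n (west_pt n 0 d) \<noteq> lb n (west_pt n 0 (d + 1))" if "2 * d \<le> int n"
    using d that assms by (auto simp: west_pt_def lb_def)
  show "x = west_pt n d 0 \<or> x = west_pt n 0 d"
    if "2 * d < int n" "x \<in> nodes n" "lb n x = lb n (west_pt n d 0)" for x
  proof -
    have "x \<in> block n (- (int n - 2 * d), 0)" using that by (simp add: block_def west_pt_def)
    then show ?thesis using block_west[of "int n - 2 * d" n d] d that(1) by (auto simp: west_pt_def)
  qed
qed

lemma corner_south:
  assumes "n \<ge> 1"
  shows "corner n (south_pt n)"
proof
  fix i j i' j' :: int
  show "south_pt n i j = south_pt n i' j' \<longleftrightarrow> i = i' \<and> j = j'" by (auto simp: south_pt_def)
  show V: "south_pt n i j \<in> grove_vertices n \<longleftrightarrow> 0 \<le> i \<and> 0 \<le> j \<and> i + j \<le> int n"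
  proof -
    have "even (i - j + (- int n + i + j) + int n)" by simp
    then show ?thesis unfolding south_pt_def grove_vertices_iff' by linarith
  qed
  show "set (neighbours (south_pt n i j)) = {south_pt n (i + 1) j, south_pt n i (j + 1),
      south_pt n (i - 1) (j + 1), south_pt n (i - 1) j, south_pt n i (j - 1), south_pt n (i + 1) (j - 1)}"
    by (auto simp: south_pt_def)
  show "south_pt n i j \<in> nodes n \<longleftrightarrow>
      0 \<le> i \<and> 0 \<le> j \<and> i + j \<le> int n \<and> (i = 0 \<or> j = 0 \<or> i + j = int n)"
    using V unfolding south_pt_def nodes_iff' by auto
next
  fix a i b j c d :: int
  assume *: "(a - i, b - j, c - i, d - j) \<in>
      {(1, 0, 0, 1), (0, 1, -1, 1), (-1, 1, -1, 0), (-1, 0, 0, -1), (0, -1, 1, -1), (1, -1, 1, 0)}"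
  have "(r - s, r + s, p - q, p + q) \<in>
      {(-1, 1, 1, 1), (1, 1, 2, 0), (2, 0, 1, -1), (1, -1, -1, -1), (-1, -1, -2, 0), (-2, 0, -1, 1)}"
    if "(p, q, r, s) \<in>
      {(1, 0, 0, 1), (0, 1, -1, 1), (-1, 1, -1, 0), (-1, 0, 0, -1), (0, -1, 1, -1), (1, -1, 1, 0)}" for p q r s :: int
    using that by (elim insertE emptyE; simp)
  from consecutive_offsets(2)[OF this[OF *], of "i - j" "- int n + i + j"]
  show "consecutive_around (south_pt n i j) (south_pt n a b) (south_pt n c d)"
    by (simp add: south_pt_def algebra_simps)
next
  fix d :: int
  assume d: "0 \<le> d"
  show "lb n (south_pt n d 0) = lb n (south_pt n 0 d)" if "2 * d \<le> int n"
    using d that assms by (auto simp: south_pt_def lb_def)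
  show "lb n (south_pt n d 0) \<noteq> lb n (south_pt n (d + 1) 0)" if "2 * (d + 1) \<le> int n"
    using d that assms by (auto simp: south_pt_def lb_def)
  show "lb n (south_pt n 0 d) \<noteq> lb n (south_pt n 0 (d + 1))" if "2 * d \<le> int n"
    using d that assms by (auto simp: south_pt_def lb_def)
  show "x = south_pt n d 0 \<or> x = south_pt n 0 d"
    if "2 * d < int n" "x \<in> nodes n" "lb n x = lb n (south_pt n d 0)" for x
  proof -
    have "x \<in> block n (int n - (int n - d), - (int n - d))" using that by (simp add: block_def south_pt_def)
    then show ?thesis using block_south[of n "int n - d"] d that(1) by (auto simp: south_pt_def)
  qed
qed

section \<open>Sweeping the remaining vertices\<close>

lemma conn_parent:
  assumes "conn G a b"
  shows "a = b \<or> (\<exists>u. {a, u} \<in> G \<and> conn (G - {{a, u}}) u b)"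
  using assms
proof (induction rule: conn_induct)
  case (step y z)
  show ?case
  proof (cases "a = y")
    case True
    then show ?thesis using step.hyps(2) conn_refl by metis
  next
    case False
    then obtain u where u: "{a, u} \<in> G" "conn (G - {{a, u}}) u y" using step.IH by blast
    show ?thesis
    proof (cases "{y, z} = {a, u}")
      case True
      then have "z = a \<or> z = u" by (auto simp: doubleton_eq_iff)
      then show ?thesis using u(1) conn_refl by metis
    next
      case False
      then have "conn (G - {{a, u}}) y z" using step.hyps(2) by (intro conn_edge) simp
      then show ?thesis using u conn_trans[OF u(2)] by blast
    qed
  qed
qed simp

text \<open>A vertex whose branch contains no vertex tied to the boundary by \<open>Q\<close> can be turned freely
  except onto its own branch.\<close>

lemma sweep_vertex:
  assumes g: "grove n G" and Q: "Q \<subseteq> G" "\<And>e. e \<in> Q \<Longrightarrow> (x, y) \<notin> e"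
    and V: "(x, y) \<in> grove_vertices n" "(x, y) \<notin> nodes n"
      "set (neighbours (x, y)) \<subseteq> grove_vertices n"
    and same: "\<And>w w'. w \<in> nodes n \<Longrightarrow> w' \<in> nodes n \<Longrightarrow> lb n w = lb n w' \<Longrightarrow> conn Q w w'"
    and tied: "\<And>z. z \<in> {(x - 2, y), (x - 1, y + 1), (x + 1, y + 1)} \<Longrightarrow> \<exists>w \<in> nodes n. conn Q z w"
  shows "\<exists>G'. reach n G G' \<and> Q \<subseteq> G' \<and> {(x, y), (x - 2, y)} \<in> G'"
proof -
  define v L UL UR R DR DL where "v = (x, y)" and "L = (x - 2, y)" and "UL = (x - 1, y + 1)"
    and "UR = (x + 1, y + 1)" and "R = (x + 2, y)" and "DR = (x + 1, y - 1)" and "DL = (x - 1, y - 1)"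
  note defs = v_def L_def UL_def UR_def R_def DR_def DL_def
  have nb: "z \<in> {L, UL, UR, R, DR, DL}" if "{v, z} \<in> H" "grove n H" for z H
  proof -
    have "{v, z} \<in> lattice_edges n" using that unfolding grove_def by blast
    then have "z \<in> set (neighbours v)" by (rule lattice_edge_neighbours)
    then show ?thesis by (auto simp: defs)
  qed
  have inV: "L \<in> grove_vertices n" "UL \<in> grove_vertices n" "UR \<in> grove_vertices n"
    "R \<in> grove_vertices n" "DR \<in> grove_vertices n" "DL \<in> grove_vertices n"
    using V(3) by (auto simp: defs)
  have c: "consecutive_around v UL L" "consecutive_around v UR UL" "consecutive_around v R UR"
    "consecutive_around v DL L" "consecutive_around v DR DL" "consecutive_around v DR R"
    "consecutive_around R v DR" "consecutive_around DL v DR"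
    using consecutive_offsets(2)[of "-2" 0 "-1" 1 x y] consecutive_offsets(2)[of "-1" 1 1 1 x y]
      consecutive_offsets(2)[of 1 1 2 0 x y] consecutive_offsets(1)[of "-1" "-1" "-2" 0 x y]
      consecutive_offsets(1)[of 1 "-1" "-1" "-1" x y] consecutive_offsets(2)[of 2 0 1 "-1" x y]
      consecutive_offsets(2)[of "-1" "-1" "-2" 0 "x + 2" y] consecutive_offsets(1)[of 1 1 2 0 "x - 1" "y - 1"]
    by (simp_all add: defs add.commute[of 1])
  \<comment> \<open>The branches turned below contain no \<open>good\<close> vertex, so such
    vertices are always admissible new neighbours.\<close>
  define good where "good w \<longleftrightarrow> (\<exists>z \<in> nodes n. conn Q w z)" for w
  have good: "good L" "good UL" "good UR" using tied by (auto simp: good_def defs)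
  have goodn: "good w" if "w \<in> nodes n" for w using that unfolding good_def by (meson conn_refl)
  have vQ: "v \<notin> e" if "e \<in> Q" for e using Q(2)[OF that] by (simp add: v_def)
  have vn: "v \<notin> nodes n" using V(2) by (simp add: v_def)
  have stp: "step n (insert {v, a} B) (insert {v, b} B)"
    if B: "grove n (insert {v, a} B)" "\<And>w. good w \<Longrightarrow> \<not> conn B v w" "\<not> conn B v a"
      and ab: "consecutive_around v a b" "b \<in> grove_vertices n" "\<not> conn B v b" for a b B
  proof -
    have eq: "insert {v, a} B - {{v, a}} = B" using B(3) conn_edge[of v a B] by auto
    show ?thesis
      using step_spin[OF B(1) _ ab(1,2), unfolded eq] ab(3) B(2) goodn by simp
  qed
  \<comment> \<open>From \<open>R\<close> the edge turns over \<open>UR\<close> and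
    \<open>UL\<close> to \<open>L\<close>, from \<open>DL\<close> directly to \<open>L\<close>;
    every vertex it turns to is tied to the boundary. \<open>DR\<close> is not next to a tied vertex
    and is therefore left out.\<close>
  have fromUL: "reach n (insert {v, a} B) (insert {v, L} B)"
    if B: "grove n (insert {v, a} B)" "\<And>w. good w \<Longrightarrow> \<not> conn B v w" "\<not> conn B v a"
      and a: "a \<in> {L, UL, UR, R, DL}" for a B
  proof -
    have L1: "reach n (insert {v, L} B) (insert {v, L} B)" by simp
    have st: "reach n (insert {v, b} B) (insert {v, L} B)"
      if "grove n (insert {v, b} B)" "\<not> conn B v b" "consecutive_around v b c" "c \<in> grove_vertices n" "good c"
        "grove n (insert {v, c} B) \<Longrightarrow> reach n (insert {v, c} B) (insert {v, L} B)" for b c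
    proof -
      have s: "step n (insert {v, b} B) (insert {v, c} B)"
        using stp[OF that(1) B(2) that(2-4)] B(2)[OF that(5)] by blast
      then have "grove n (insert {v, c} B)" by (simp add: step_def)
      then show ?thesis using converse_rtranclp_into_rtranclp[of "step n", OF s that(6)] by blast
    qed
    have UL1: "reach n (insert {v, UL} B) (insert {v, L} B)" if "grove n (insert {v, UL} B)"
      using st[OF that B(2)[OF good(2)] c(1) inV(1) good(1) L1] .
    have UR1: "reach n (insert {v, UR} B) (insert {v, L} B)" if "grove n (insert {v, UR} B)"
      using st[OF that B(2)[OF good(3)] c(2) inV(2) good(2) UL1] .
    consider "a = L" | "a = UL" | "a = UR" | "a = R" | "a = DL" using a by blast
    then show ?thesis
    proof cases
      case 4
      show ?thesis using st[OF B(1)[unfolded 4] B(3)[unfolded 4] c(3) inV(3) good(3) UR1] 4 by simp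
    next
      case 5
      show ?thesis using st[OF B(1)[unfolded 5] B(3)[unfolded 5] c(4) inV(1) good(1) L1] 5 by simp
    qed (use L1 UL1 UR1 B(1) in simp_all)
  qed
  \<comment> \<open>From \<open>DR\<close> one extra turn to \<open>DL\<close> or \<open>R\<close>
    is needed, which fails only if both lie on the branch of \<open>v\<close>.\<close>
  have go: "reach n H (insert {v, L} (H - {{v, u}}))"
    if H: "grove n H" "{v, u} \<in> H" "\<And>w. good w \<Longrightarrow> \<not> conn (H - {{v, u}}) v w"
      and u: "u = DR \<Longrightarrow> \<not> conn (H - {{v, u}}) v DL \<or> \<not> conn (H - {{v, u}}) v R" for H u
  proof -
    let ?B = "H - {{v, u}}"
    have HB: "insert {v, u} ?B = H" using H(2) by blast
    have nu: "\<not> conn ?B v u" using grove_forest[OF H(1,2)] .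
    show ?thesis
    proof (cases "u = DR")
      case False
      then have "u \<in> {L, UL, UR, R, DL}" using nb[OF H(2,1)] by blast
      then show ?thesis using fromUL[of u ?B] H(1,3) nu HB by simp
    next
      case True
      then obtain b where b: "b \<in> {DL, R}" "\<not> conn ?B v b" using u by blast
      have s: "step n H (insert {v, b} ?B)"
        using stp[of u ?B b] H(1,3) nu HB b c(5,6) inV(4,6) True by auto
      then have "grove n (insert {v, b} ?B)" by (simp add: step_def)
      then have "reach n (insert {v, b} ?B) (insert {v, L} ?B)"
        using fromUL[of b ?B] H(3) b by blast
      then show ?thesis by (rule converse_rtranclp_into_rtranclp[of "step n", OF s])
    qed
  qed
  have keep: "Q \<subseteq> insert f (H - {{a, b}})" if "Q \<subseteq> H" "v \<in> {a, b}" for f H a b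
    using that vQ by blast
  have vL: "{v, L} = {(x, y), (x - 2, y)}" by (simp add: defs)
  obtain w where w: "w \<in> nodes n" "conn G v w" using g V(1) unfolding grove_def v_def by blast
  have "v \<noteq> w" using w(1) vn by blast
  then obtain u where u: "{v, u} \<in> G" "conn (G - {{v, u}}) u w" using conn_parent[OF w(2)] by blast
  let ?B = "G - {{v, u}}"
  have QB: "Q \<subseteq> ?B" using Q(1) vQ by blast
  have nu: "\<not> conn ?B v u" using grove_forest[OF g u(1)] .
  \<comment> \<open>A tied vertex on the branch would lead through \<open>Q\<close> to a boundary
    vertex with the label of \<open>w\<close>. Since \<open>Q\<close> joins equal labels and avoids
    \<open>{v, u}\<close>, the vertex \<open>v\<close> would still reach \<open>u\<close>.\<close>
  have free: "\<not> conn ?B v z" if z: "good z" for z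
  proof
    assume a: "conn ?B v z"
    obtain t where t: "t \<in> nodes n" "conn Q z t" using z unfolding good_def by blast
    have vt: "conn ?B v t" using conn_trans[OF a conn_mono[OF t(2) QB]] .
    have "conn G v t" by (rule conn_mono[OF vt]) blast
    then have "conn G t w" using conn_trans[OF conn_sym w(2)] by blast
    then have "lb n t = lb n w" using g t(1) w(1) by (simp add: grove_def)
    then have "conn ?B t w" using conn_mono[OF same[OF t(1) w(1)] QB] by blast
    then have "conn ?B v w" by (rule conn_trans[OF vt])
    then show False using nu conn_trans[OF _ conn_sym[OF u(2)]] by blast
  qed
  show ?thesis
  proof (cases "u = DR \<and> conn ?B v DL \<and> conn ?B v R")
    case False
    then have "reach n G (insert {v, L} ?B)" using go[OF g u(1) free] by blast
    then show ?thesis using keep[OF Q(1), of v u] vL by auto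
  next
    case True
    then have DR: "u = DR" by simp
    have "R \<noteq> v" by (simp add: defs)
    then obtain z where z: "{v, z} \<in> ?B" using conn_first_edge[of ?B v R] True by metis
    have zG: "{v, z} \<in> G" "z \<noteq> DR" using z DR by auto
    have "\<not> good z" using free conn_edge[OF z] by blast
    then have zz: "z = R \<or> z = DL" using nb[OF zG(1) g] zG(2) good by blast
    have zv: "{z, v} \<in> G" using zG(1) by (simp only: insert_commute)
    have vu: "{v, DR} \<in> G" using u(1) DR by simp
    \<comment> \<open>In the blocked case the branch leaves \<open>v\<close> through
      \<open>z\<close>, which is \<open>R\<close> or \<open>DL\<close>. Turning this edge from
      \<open>v\<close> to \<open>DR\<close> takes \<open>z\<close> off the branch, so that
      \<open>z\<close> becomes available for the extra turn.\<close>
    define H where "H = insert {z, DR} (G - {{z, v}})"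
    have s: "step n G H" unfolding H_def
      using zz c(7,8) zG(2) by (intro step_two_edges[OF g zv vu]) auto
    have gH: "grove n H" using s by (simp add: step_def)
    have vDR: "v \<noteq> DR" "z \<noteq> v" using zz by (auto simp: defs)
    have uH: "{v, DR} \<in> H" using vu zG(2) unfolding H_def by (auto simp: doubleton_eq_iff)
    let ?C = "H - {{v, DR}}"
    have C: "?C = insert {z, DR} (?B - {{z, v}})"
      unfolding H_def DR using vDR zG(2) by (auto simp: doubleton_eq_iff)
    have m: "conn (?B - {{z, v}}) a b \<Longrightarrow> conn ?B a b" for a b by (erule conn_mono) blast
    have m': "conn (?B - {{z, v}}) a b \<Longrightarrow> conn (G - {{z, v}}) a b" for a b by (erule conn_mono) blast
    have nz: "\<not> conn (?B - {{z, v}}) v z"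
    proof
      assume "conn (?B - {{z, v}}) v z"
      then show False using grove_forest[OF g zv] conn_sym[OF m'] by simp
    qed
    have freeC: "\<not> conn ?C v t" if "good t" for t
    proof
      assume "conn ?C v t"
      then consider "conn (?B - {{z, v}}) v t" | "conn (?B - {{z, v}}) v z" | "conn (?B - {{z, v}}) v DR"
        unfolding C conn_insert by blast
      then show False
      proof cases
        case 1
        then show False using m free[OF that] by simp
      next
        case 2
        then show False using nz by simp
      next
        case 3
        then show False using m[OF 3] nu DR by simp
      qed
    qed
    have "{z, DR} \<in> ?C" using C by simp
    then have zDR: "conn ?C z DR" by (rule conn_edge)
    have "\<not> conn ?C v z"
    proof
      assume "conn ?C v z"
      then show False using grove_forest[OF gH uH] conn_trans[OF _ zDR] by simp
    qed
    then have "\<not> conn ?C v DL \<or> \<not> conn ?C v R" using zz by blast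
    then have "reach n H (insert {v, L} ?C)" using go[OF gH uH freeC] by blast
    then have "reach n G (insert {v, L} ?C)" by (rule converse_rtranclp_into_rtranclp[of "step n", OF s])
    moreover have "Q \<subseteq> H" unfolding H_def by (rule keep[OF Q(1)]) simp
    then have "Q \<subseteq> insert {v, L} ?C" by (rule keep) simp
    ultimately show ?thesis using vL by auto
  qed
qed

section \<open>The skeleton of straight lines\<close>

text \<open>At the south corner only lines shorter than half the side are used: for even \<open>n\<close> the east and
  west lines already join the middle triplet, and a third line would close a cycle.\<close>

definition skel :: "nat \<Rightarrow> point set set" where
  "skel n = corner.lines (east_pt n) (int (n div 2)) \<union> corner.lines (west_pt n) (int (n div 2)) \<union>
     corner.lines (south_pt n) (int ((n - 1) div 2))"

text \<open>The vertices that lie on no line of \<^const>\<open>skel\<close>.\<close>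

definition free_vertices :: "nat \<Rightarrow> point set" where
  "free_vertices n = {(x, y). (x, y) \<in> grove_vertices n \<and> x + y < 0 \<and> y < x \<and> - 2 * y \<le> int n}"

text \<open>Ensures that turning a free vertex never touches a line.\<close>

lemma skel_endpoints:
  assumes n: "n \<ge> 1" and e: "e \<in> skel n" "(x, y) \<in> e"
  shows "(x, y) \<notin> free_vertices n"
proof -
  interpret E: corner n "east_pt n" by (rule corner_east[OF n])
  interpret W: corner n "west_pt n" by (rule corner_west[OF n])
  interpret S: corner n "south_pt n" by (rule corner_south[OF n])
  have D: "2 * int (n div 2) \<le> int n" "2 * int ((n - 1) div 2) < int n" using n by linarith+
  consider "e \<in> E.lines (int (n div 2))" | "e \<in> W.lines (int (n div 2))"
    | "e \<in> S.lines (int ((n - 1) div 2))" using e(1) by (auto simp: skel_def)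
  then show ?thesis
  proof cases
    case 1
    then show ?thesis using e(2) D(1)
      by (auto simp: E.lines_def free_vertices_def east_pt_def)
  next
    case 2
    then show ?thesis using e(2) D(1)
      by (auto simp: W.lines_def free_vertices_def west_pt_def)
  next
    case 3
    then show ?thesis using e(2) D(2)
      by (auto simp: S.lines_def free_vertices_def south_pt_def)
  qed
qed

text \<open>Along the lines of the east corner \<open>x + y\<close> is constant, and its sign
  decides whether the line is among the first \<open>n div 2\<close>. At the west corner
  \<open>x - y\<close> plays this role, at the south corner \<open>y\<close>.\<close>

lemma skel_east:
  assumes n: "n \<ge> 1" and v: "(x, y) \<in> grove_vertices n" "0 \<le> x + y"
  shows "conn (skel n) (x + y, 0) (x, y)"
proof -
  interpret E: corner n "east_pt n" by (rule corner_east[OF n])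
  have "even (int n - x - y)" using v(1) unfolding grove_vertices_iff' by presburger
  then obtain d where d: "int n - x - y = 2 * d" by (rule evenE)
  have b: "0 \<le> - y" "- y \<le> d" "d \<le> int (n div 2)"
    using v d unfolding grove_vertices_iff' by linarith+
  have "conn (skel n) (east_pt n d 0) (east_pt n (d - (- y)) (- y))"
    by (rule E.conn_antidiagonal[OF E.lines_edge[of "int (n div 2)"] b(1)])
      (use b in \<open>auto simp: skel_def\<close>)
  moreover have "east_pt n d 0 = (x + y, 0)" "east_pt n (d - (- y)) (- y) = (x, y)"
    using d by (simp_all add: east_pt_def)
  ultimately show ?thesis by simp
qed

lemma skel_west:
  assumes n: "n \<ge> 1" and v: "(x, y) \<in> grove_vertices n" "x \<le> y"
  shows "conn (skel n) (x - y, 0) (x, y)"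
proof -
  interpret W: corner n "west_pt n" by (rule corner_west[OF n])
  have "even (int n + x - y)" using v(1) unfolding grove_vertices_iff' by presburger
  then obtain d where d: "int n + x - y = 2 * d" by (rule evenE)
  have b: "0 \<le> - y" "- y \<le> d" "d \<le> int (n div 2)"
    using v d unfolding grove_vertices_iff' by linarith+
  have "conn (skel n) (west_pt n d 0) (west_pt n (d - (- y)) (- y))"
    by (rule W.conn_antidiagonal[OF W.lines_edge[of "int (n div 2)"] b(1)])
      (use b in \<open>auto simp: skel_def\<close>)
  moreover have "west_pt n d 0 = (x - y, 0)" "west_pt n (d - (- y)) (- y) = (x, y)"
    using d by (simp_all add: west_pt_def)
  ultimately show ?thesis by simp
qed

lemma skel_south:
  assumes n: "n \<ge> 1" and v: "(x, y) \<in> grove_vertices n" "int n < - 2 * y"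
  shows "conn (skel n) (int n + y, y) (x, y)"
proof -
  interpret S: corner n "south_pt n" by (rule corner_south[OF n])
  have "even (int n + y - x)" using v(1) unfolding grove_vertices_iff' by presburger
  then obtain k where k: "int n + y - x = 2 * k" by (rule evenE)
  have b: "0 \<le> k" "k \<le> int n + y" "int n + y \<le> int ((n - 1) div 2)"
    using v k n unfolding grove_vertices_iff' by linarith+
  have "conn (skel n) (south_pt n (int n + y) 0) (south_pt n (int n + y - k) k)"
    by (rule S.conn_antidiagonal[OF S.lines_edge[of "int ((n - 1) div 2)"] b(1)])
      (use b in \<open>auto simp: skel_def\<close>)
  moreover have "south_pt n (int n + y) 0 = (int n + y, y)" "south_pt n (int n + y - k) k = (x, y)"
    using k by (simp_all add: south_pt_def)
  ultimately show ?thesis by simp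
qed

lemma skel_same:
  assumes n: "n \<ge> 1" and w: "w \<in> nodes n" "w' \<in> nodes n" "lb n w = lb n w'"
  shows "conn (skel n) w w'"
proof -
  \<comment> \<open>One boundary vertex per label, recovered from the weight: the upper end of a
    west or east line, the right end of a south line, and \<open>(0, 0)\<close> for the middle
    triplet.\<close>
  define rep where "rep = (\<lambda>l :: int \<times> int. if fst l = 0 then (int n - snd l, 0) else if fst l = 1
    then (snd l - int n, 0) else if fst l = 2 then (int n - snd l div 2, - (snd l div 2)) else (0, 0 :: int))"
  have *: "conn (skel n) (rep (lb n w)) w" if w: "w \<in> nodes n" for w
  proof -
    obtain x y where xy: "w = (x, y)" by fastforce
    have V: "(x, y) \<in> grove_vertices n" using w xy nodes_subset by blast
    have nd: "y = 0 \<or> x - y = int n \<or> - x - y = int n" using w unfolding xy nodes_iff' by blast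
    have bd: "x - y \<le> int n" "- x - y \<le> int n" "y \<le> 0" using V unfolding grove_vertices_iff' by blast+
    have "(\<exists>c. lb n (x, y) = (0, c)) \<or> (\<exists>c. lb n (x, y) = (1, c)) \<or> (\<exists>c. lb n (x, y) = (2, c)) \<or>
      lb n (x, y) = (3, 0)" by (simp add: lb_def)
    then consider (W) c where "lb n (x, y) = (0, c)" | (E) c where "lb n (x, y) = (1, c)"
      | (S) c where "lb n (x, y) = (2, c)" | (M) "lb n (x, y) = (3, 0)"
      by blast
    then show ?thesis
    proof cases
      case W
      then have h: "x < 0" "x < int n + 3 * y" "c = int n + y - x" by (simp_all add: lb_eq_iff)
      have "x \<le> y" using h nd bd by linarith
      then show ?thesis using skel_west[OF n V] W h by (simp add: rep_def xy)
    next
      case E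
      then have h: "x > 0" "- x < int n + 3 * y" "c = int n + y + x" by (simp_all add: lb_eq_iff)
      have "0 \<le> x + y" using h nd bd by linarith
      then show ?thesis using skel_east[OF n V] E h by (simp add: rep_def xy add.commute)
    next
      case S
      then have h: "x > int n + 3 * y" "- x > int n + 3 * y" "c = - 2 * y" by (simp_all add: lb_eq_iff)
      have "c div 2 = - y" using h(3) by simp
      moreover have "int n < - 2 * y" using h nd bd by linarith
      ultimately show ?thesis using skel_south[OF n V] S by (simp add: rep_def xy)
    next
      case M
      then have h: "\<not> (x < 0 \<and> x < int n + 3 * y)" "\<not> (x > 0 \<and> - x < int n + 3 * y)"
        "\<not> (x > int n + 3 * y \<and> - x > int n + 3 * y)" by (simp_all add: lb_eq_iff)
      have "x + y = 0 \<or> x = y" using h nd bd n by linarith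
      then show ?thesis
      proof
        assume "x + y = 0"
        then show ?thesis using skel_east[OF n V] M by (simp add: rep_def xy)
      next
        assume "x = y"
        then show ?thesis using skel_west[OF n V] M by (simp add: rep_def xy)
      qed
    qed
  qed
  show ?thesis using conn_trans[OF conn_sym[OF *[OF w(1)]]] *[OF w(2)] w(3) by simp
qed

section \<open>Order of the sweep and uniqueness of the normal form\<close>

text \<open>Numbers vertices row by row from the top, and from left to right inside a row. Abscissas
  differ by at most \<open>2 * int n\<close>, so the row weight outruns them; the summand
  \<open>int n\<close> avoids truncation by \<open>nat\<close>.\<close>

definition rank :: "nat \<Rightarrow> point \<Rightarrow> nat" where
  "rank n = (\<lambda>(x, y). nat (- y * (2 * int n + 3) + x + int n))"

text \<open>The stages of the sweep; for \<open>N\<close> above all ranks of free vertices this is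
  the normal form.\<close>

definition swept :: "nat \<Rightarrow> nat \<Rightarrow> point set set" where
  "swept n N = skel n \<union> {{(x, y), (x - 2, y)} | x y. (x, y) \<in> free_vertices n \<and> rank n (x, y) < N}"

lemma free_neighbours:
  assumes "(x, y) \<in> free_vertices n"
  shows "(x, y) \<in> grove_vertices n" "(x, y) \<notin> nodes n" "set (neighbours (x, y)) \<subseteq> grove_vertices n"
proof -
  have h: "x + y < 0" "y < x" "- 2 * y \<le> int n" "even (x + y + int n)"
    using assms by (auto simp: free_vertices_def grove_vertices_iff')
  show "(x, y) \<in> grove_vertices n" using assms by (auto simp: free_vertices_def)
  show "(x, y) \<notin> nodes n" using h unfolding nodes_iff' by linarith
  have "x - y + 2 \<le> int n" "- x - y + 2 \<le> int n" using h by presburger+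
  then show "set (neighbours (x, y)) \<subseteq> grove_vertices n"
    using h by (auto simp: grove_vertices_iff')
qed

lemma rank_row:
  assumes "(x, y) \<in> grove_vertices n" "(x', y') \<in> grove_vertices n"
  shows "rank n (x, y) < rank n (x', y') \<longleftrightarrow> y' < y \<or> y = y' \<and> x < x'"
proof -
  have b: "- int n \<le> x" "x \<le> int n" "- int n \<le> x'" "x' \<le> int n" "y \<le> 0" "y' \<le> 0"
    using assms unfolding grove_vertices_iff' by linarith+
  have nn: "0 \<le> - y * (2 * int n + 3) + x + int n" "0 \<le> - y' * (2 * int n + 3) + x' + int n"
    using b mult_nonneg_nonneg[of "- y" "2 * int n + 3"] mult_nonneg_nonneg[of "- y'" "2 * int n + 3"]
    by linarith+
  have gap: "- r * (2 * int n + 3) + p < - s * (2 * int n + 3) + q"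
    if "s < r" "\<bar>p\<bar> \<le> int n" "\<bar>q\<bar> \<le> int n" for r s p q :: int
  proof -
    have "(2 * int n + 3) * 1 \<le> (2 * int n + 3) * (r - s)" using that(1) by (intro mult_left_mono) auto
    then show ?thesis using that(2,3) by (simp add: algebra_simps abs_le_iff)
  qed
  consider "y' < y" | "y = y'" | "y < y'" by linarith
  then have "- y * (2 * int n + 3) + x < - y' * (2 * int n + 3) + x' \<longleftrightarrow> y' < y \<or> y = y' \<and> x < x'"
    using gap[of y' y x x'] gap[of y y' x' x] b by cases (auto simp: abs_le_iff)
  then show ?thesis unfolding rank_def prod.case nat_less_eq_zless[OF nn(1)] by linarith
qed

text \<open>A vertex on no line is followed to the left along its row, through free vertices of
  smaller rank, until a line is met.\<close>

lemma swept_tied: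
  assumes n: "n \<ge> 1" and v: "(x, y) \<in> grove_vertices n"
    "(x, y) \<in> free_vertices n \<Longrightarrow> rank n (x, y) < N"
  shows "\<exists>w \<in> nodes n. conn (swept n N) (x, y) w"
  using v
proof (induction "nat (x + int n)" arbitrary: x rule: less_induct)
  case less
  have m: "conn (skel n) a b \<Longrightarrow> conn (swept n N) a b" for a b
    by (erule conn_mono) (simp add: swept_def)
  have bd: "x - y \<le> int n" "- x - y \<le> int n" "y \<le> 0" "even (x + y + int n)"
    using less.prems(1) unfolding grove_vertices_iff' by blast+
  consider "0 \<le> x + y" | "x \<le> y" | "int n < - 2 * y" | "(x, y) \<in> free_vertices n"
    using less.prems(1) unfolding free_vertices_def by fastforce
  then show ?case
  proof cases
    case 1
    have "(x + y, 0) \<in> nodes n" using bd 1 by (auto simp: nodes_iff)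
    then show ?thesis using conn_sym[OF m[OF skel_east[OF n less.prems(1) 1]]] by blast
  next
    case 2
    have "even (x - y + int n)" using bd(4) by presburger
    then have "(x - y, 0) \<in> nodes n" using bd 2 by (auto simp: nodes_iff)
    then show ?thesis using conn_sym[OF m[OF skel_west[OF n less.prems(1) 2]]] by blast
  next
    case 3
    have "(int n + y, y) \<in> nodes n" using bd by (auto simp: nodes_iff)
    then show ?thesis using conn_sym[OF m[OF skel_south[OF n less.prems(1) 3]]] by blast
  next
    case 4
    have V: "(x - 2, y) \<in> grove_vertices n" using free_neighbours(3)[OF 4] by auto
    have "rank n (x - 2, y) < rank n (x, y)" using rank_row[OF V less.prems(1)] by simp
    then have "rank n (x - 2, y) < N" using less.prems(2)[OF 4] by simp
    moreover have "nat (x - 2 + int n) < nat (x + int n)"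
      using V unfolding grove_vertices_iff' by linarith
    ultimately obtain w where w: "w \<in> nodes n" "conn (swept n N) (x - 2, y) w"
      using less.hyps[OF _ V] by blast
    have "{(x, y), (x - 2, y)} \<in> swept n N" using 4 less.prems(2)[OF 4] unfolding swept_def by blast
    then show ?thesis using w conn_trans[OF conn_edge w(2)] by blast
  qed
qed

lemma sweep:
  assumes n: "n \<ge> 1" and g: "grove n G" and s: "skel n \<subseteq> G"
  shows "\<exists>G'. reach n G G' \<and> swept n N \<subseteq> G'"
proof (induction N)
  case 0
  have "swept n 0 = skel n" by (simp add: swept_def)
  then show ?case using s by (intro exI[of _ G]) simp
next
  case (Suc N)
  then obtain H where H: "reach n G H" "swept n N \<subseteq> H" by blast
  show ?case
  proof (cases "\<exists>v \<in> free_vertices n. rank n v = N")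
    case False
    then have "swept n (Suc N) = swept n N"
      unfolding swept_def by (auto simp: less_Suc_eq)
    then show ?thesis using H by (intro exI[of _ H]) simp
  next
    case True
    then obtain x y where v: "(x, y) \<in> free_vertices n" "rank n (x, y) = N" by fastforce
    note fn = free_neighbours[OF v(1)]
    have "\<exists>G'. reach n H G' \<and> swept n N \<subseteq> G' \<and> {(x, y), (x - 2, y)} \<in> G'"
    proof (rule sweep_vertex[OF reach_grove[OF H(1) g] H(2) _ fn])
      show "(x, y) \<notin> e" if eN: "e \<in> swept n N" for e
      proof
        assume xe: "(x, y) \<in> e"
        then have "e \<notin> skel n" using skel_endpoints[OF n] v(1) by blast
        then obtain a b where ab: "e = {(a, b), (a - 2, b)}" "(a, b) \<in> free_vertices n" "rank n (a, b) < N"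
          using eN unfolding swept_def by blast
        \<comment> \<open>By rank, \<open>(x, y)\<close> can only be the left end; but then the
          right end would have larger rank than \<open>(x, y)\<close>.\<close>
        then have "(x, y) = (a - 2, b)" using xe v(2) by auto
        then have "rank n (x, y) < rank n (a, b)"
          using rank_row[OF fn(1) free_neighbours(1)[OF ab(2)]] by simp
        then show False using ab(3) v(2) by simp
      qed
      show "conn (swept n N) w w'" if "w \<in> nodes n" "w' \<in> nodes n" "lb n w = lb n w'" for w w'
        by (rule conn_mono[OF skel_same[OF n that]]) (simp add: swept_def)
      fix z assume z: "z \<in> {(x - 2, y), (x - 1, y + 1), (x + 1, y + 1)}"
      obtain a b where ab: "z = (a, b)" by fastforce
      have zV: "(a, b) \<in> grove_vertices n" using fn(3) z unfolding ab by auto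
      have "rank n (a, b) < rank n (x, y)" using rank_row[OF zV fn(1)] z unfolding ab by auto
      then show "\<exists>w \<in> nodes n. conn (swept n N) z w"
        using swept_tied[OF n zV, of N] v(2) unfolding ab by simp
    qed
    then obtain G' where G': "reach n H G'" "swept n N \<subseteq> G'" "{(x, y), (x - 2, y)} \<in> G'" by blast
    have "swept n (Suc N) \<subseteq> G'"
    proof
      fix e assume "e \<in> swept n (Suc N)"
      then consider "e \<in> swept n N"
        | a b where "e = {(a, b), (a - 2, b)}" "(a, b) \<in> free_vertices n" "rank n (a, b) = N"
        unfolding swept_def by (auto simp: less_Suc_eq)
      then show "e \<in> G'"
      proof cases
        case 2
        have "(a, b) = (x, y)"
          using rank_row[OF free_neighbours(1)[OF 2(2)] fn(1)]
            rank_row[OF fn(1) free_neighbours(1)[OF 2(2)]] 2(3) v(2) by auto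
        then show ?thesis using 2(1) G'(3) by simp
      qed (use G'(2) in blast)
    qed
    then show ?thesis using rtranclp_trans[OF H(1) G'(1)] by blast
  qed
qed

text \<open>An edge of \<open>G\<close> outside \<open>Q\<close> would join two vertices that
  \<open>Q\<close> already ties to boundary vertices of one label, hence to each other, and would
  close a cycle.\<close>

lemma grove_eqI:
  assumes g: "grove n G" and Q: "Q \<subseteq> G"
    and t: "\<And>v. v \<in> grove_vertices n \<Longrightarrow> \<exists>w \<in> nodes n. conn Q v w"
    and same: "\<And>w w'. w \<in> nodes n \<Longrightarrow> w' \<in> nodes n \<Longrightarrow> lb n w = lb n w' \<Longrightarrow> conn Q w w'"
  shows "G = Q"
proof (rule ccontr)
  assume "G \<noteq> Q"
  then obtain e where e: "e \<in> G" "e \<notin> Q" using Q by blast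
  have "e \<in> lattice_edges n" using e(1) g unfolding grove_def by blast
  then obtain a b where ab: "e = {a, b}" unfolding lattice_edges_def by blast
  note abG = grove_edge_vertices[OF g e(1)[unfolded ab]]
  obtain w w' where w: "w \<in> nodes n" "conn Q a w" "w' \<in> nodes n" "conn Q b w'"
    using t[OF abG(1)] t[OF abG(2)] by blast
  have "conn G w a" using conn_sym[OF conn_mono[OF w(2) Q]] .
  also have "conn G a b" using conn_edge e(1) ab by metis
  also have "conn G b w'" using conn_mono[OF w(4) Q] .
  finally have "lb n w = lb n w'" using g w(1,3) by (simp add: grove_def)
  then have "conn Q w w'" using same w(1,3) by blast
  then have "conn Q a b" using conn_trans[OF conn_trans[OF w(2)] conn_sym[OF w(4)]] by blast
  then have "conn (G - {{a, b}}) a b" by (rule conn_mono) (use Q e(2) ab in blast)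
  then show False using grove_forest[OF g] e(1) ab by blast
qed

section \<open>Combining the corners: any two groves are linked by spins\<close>

lemma reach_skel:
  assumes n: "n \<ge> 1" and g: "grove n G"
  shows "\<exists>G'. reach n G G' \<and> skel n \<subseteq> G'"
proof -
  interpret E: corner n "east_pt n" by (rule corner_east[OF n])
  interpret W: corner n "west_pt n" by (rule corner_west[OF n])
  interpret S: corner n "south_pt n" by (rule corner_south[OF n])
  let ?D = "int (n div 2)" let ?C = "int ((n - 1) div 2)"
  have D: "2 * ?D \<le> int n" "2 * ?C < int n" using n by linarith+
  obtain G1 where G1: "reach n G G1" "S.lines ?C \<subseteq> G1"
    using S.peel_corner[OF g, of "(n - 1) div 2"] D(2) by auto
  have g1: "grove n G1" using reach_grove[OF G1(1) g] .
  obtain G2 where G2: "reach n G1 G2" "E.lines ?D \<subseteq> G2"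
    "\<forall>e \<in> G1 - G2. \<exists>a b. east_pt n a b \<in> e \<and> a < ?D \<and> b \<le> ?D"
    using E.peel_corner[OF g1 D(1)] by blast
  have g2: "grove n G2" using reach_grove[OF G2(1) g1] .
  obtain G3 where G3: "reach n G2 G3" "W.lines ?D \<subseteq> G3"
    "\<forall>e \<in> G2 - G3. \<exists>a b. west_pt n a b \<in> e \<and> a < ?D \<and> b \<le> ?D"
    using W.peel_corner[OF g2 D(1)] by blast
  \<comment> \<open>South lines have depth \<open>- y\<close> greater than \<open>?D\<close>,
    whereas at both upper corners \<open>b\<close> is the depth and bounded by
    \<open>?D\<close>.\<close>
  have S2: "S.lines ?C \<subseteq> G2"
  proof (rule ccontr)
    assume "\<not> S.lines ?C \<subseteq> G2"
    then obtain e where e: "e \<in> S.lines ?C" "e \<in> G1 - G2" using G1(2) by blast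
    then obtain a b where "east_pt n a b \<in> e" "a < ?D" "b \<le> ?D" using G2(3) by blast
    then show False using e(1) D by (auto simp: S.lines_def east_pt_def south_pt_def)
  qed
  have S3: "S.lines ?C \<subseteq> G3"
  proof (rule ccontr)
    assume "\<not> S.lines ?C \<subseteq> G3"
    then obtain e where e: "e \<in> S.lines ?C" "e \<in> G2 - G3" using S2 by blast
    then obtain a b where "west_pt n a b \<in> e" "a < ?D" "b \<le> ?D" using G3(3) by blast
    then show False using e(1) D by (auto simp: S.lines_def west_pt_def south_pt_def)
  qed
  \<comment> \<open>On the east lines \<open>x + y\<close> is nonnegative, while a vertex with west
    coordinate \<open>a < ?D\<close> has \<open>x + y < 0\<close>.\<close>
  have E3: "E.lines ?D \<subseteq> G3"
  proof (rule ccontr)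
    assume "\<not> E.lines ?D \<subseteq> G3"
    then obtain e where e: "e \<in> E.lines ?D" "e \<in> G2 - G3" using G2(2) by blast
    then obtain a b where "west_pt n a b \<in> e" "a < ?D" "b \<le> ?D" using G3(3) by blast
    then show False using e(1) D by (auto simp: E.lines_def west_pt_def east_pt_def)
  qed
  have "reach n G G3" using G1(1) G2(1) G3(1) by (meson rtranclp_trans)
  then show ?thesis using S3 E3 G3(2) unfolding skel_def by blast
qed

lemma groves_connected:
  assumes n: "n \<ge> 1" and g: "grove n G" "grove n G'"
  shows "reach n G G'"
proof -
  have fin: "finite (free_vertices n)"
  proof (rule finite_subset)
    show "free_vertices n \<subseteq> {- int n..int n} \<times> {- int n..int n}"
      by (auto simp: free_vertices_def grove_vertices_iff')
  qed simp
  obtain N where N: "\<And>v. v \<in> free_vertices n \<Longrightarrow> rank n v < N"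
    using finite_nat_set_iff_bounded[of "rank n ` free_vertices n"] fin by auto
  have canon: "reach n H (swept n N)" if h: "grove n H" for H
  proof -
    obtain H1 where H1: "reach n H H1" "skel n \<subseteq> H1" using reach_skel[OF n h] by blast
    have h1: "grove n H1" using reach_grove[OF H1(1) h] .
    obtain H2 where H2: "reach n H1 H2" "swept n N \<subseteq> H2" using sweep[OF n h1 H1(2)] by blast
    have "H2 = swept n N"
    proof (rule grove_eqI[OF reach_grove[OF H2(1) h1] H2(2)])
      show "\<exists>w \<in> nodes n. conn (swept n N) v w" if "v \<in> grove_vertices n" for v
        using swept_tied[OF n, of "fst v" "snd v" N] that N by simp
      show "conn (swept n N) w w'" if "w \<in> nodes n" "w' \<in> nodes n" "lb n w = lb n w'" for w w'
        by (rule conn_mono[OF skel_same[OF n that]]) (simp add: swept_def)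
    qed
    then show ?thesis using rtranclp_trans[OF H1(1) H2(1)] by simp
  qed
  show ?thesis using rtranclp_trans[OF canon[OF g(1)] reach_sym[OF canon[OF g(2)]]] .
qed

section \<open>The target grove\<close>

text \<open>The diagonals from \<open>(- i, 0)\<close> turn into rows on the line
  \<open>x + 3 * y = - int n\<close>: for \<open>int n = i + 2 * d\<close> it contains
  \<open>(- i + d, - d)\<close>. Target edges thus start at a single vertex, going down right above
  this line and left on or below it.\<close>

definition diag_start :: "nat \<Rightarrow> point \<Rightarrow> bool" where
  "diag_start n = (\<lambda>(x, y). (x, y) \<in> grove_vertices n \<and> x + 3 * y > - int n \<and> x - y < int n)"

definition row_start :: "nat \<Rightarrow> point \<Rightarrow> bool" where
  "row_start n = (\<lambda>(x, y). (x, y) \<in> grove_vertices n \<and> x + 3 * y \<le> - int n \<and> - x - y < int n)"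

lemma target_edgeE:
  assumes "e \<in> target_grove n"
  obtains (diag) x y where "e = {(x, y), (x + 1, y - 1)}" "diag_start n (x, y)"
    | (row) x y where "e = {(x, y), (x - 2, y)}" "row_start n (x, y)"
proof -
  have half: "\<exists>d. int n = i + 2 * d" if "i mod 2 = int n mod 2" for i :: int
    using that by presburger
  consider (a) i t :: int where "e = {(- i + t, - t), (- i + t + 1, - t - 1)}" "0 \<le> i" "i < int n"
        "i mod 2 = int n mod 2" "0 \<le> t" "t < (int n - i) div 2"
    | (b) i d s :: int where "e = {(- i + d - 2 * s, - d), (- i + d - 2 * s - 2, - d)}" "0 \<le> i" "i < int n"
        "i mod 2 = int n mod 2" "d = (int n - i) div 2" "0 \<le> s" "s < d"
    | (c) i t :: int where "e = {(i + t, - t), (i + t + 1, - t - 1)}" "0 < i" "i < int n"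
        "i mod 2 = int n mod 2" "0 \<le> t" "t < (int n - i) div 2"
    | (d) i s :: int where "e = {(- int n + i + 2 * s, - i), (- int n + i + 2 * s + 2, - i)}"
        "int n < 2 * i" "i < int n" "0 \<le> s" "s < int n - i"
    using assms unfolding target_grove_def by blast
  then show ?thesis
  proof cases
    case a
    obtain d where d: "int n = i + 2 * d" using half[OF a(4)] by blast
    have "t < d" using a(6) d by simp
    then have "diag_start n (- i + t, - t)"
      using a(2,3,5) d by (auto simp: diag_start_def grove_vertices_iff')
    then show ?thesis using diag[of "- i + t" "- t"] a(1) by simp
  next
    case c
    obtain d where d: "int n = i + 2 * d" using half[OF c(4)] by blast
    have "t < d" using c(6) d by simp
    then have "diag_start n (i + t, - t)"
      using c(2,3,5) d by (auto simp: diag_start_def grove_vertices_iff')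
    then show ?thesis using diag[of "i + t" "- t"] c(1) by simp
  next
    case b
    obtain d' where d': "int n = i + 2 * d'" using half[OF b(4)] by blast
    then have "d' = d" using b(5) by simp
    then have "row_start n (- i + d - 2 * s, - d)"
      using b(2,3,6,7) d' by (auto simp: row_start_def grove_vertices_iff')
    then show ?thesis using row[of "- i + d - 2 * s" "- d"] b(1) by simp
  next
    case d
    have "row_start n (- int n + i + 2 * s + 2, - i)"
      using d by (auto simp: row_start_def grove_vertices_iff')
    moreover have "e = {(- int n + i + 2 * s + 2, - i), (- int n + i + 2 * s + 2 - 2, - i)}"
      using d(1) by (simp add: insert_commute)
    ultimately show ?thesis using row by blast
  qed
qed

lemma diag_target:
  assumes "diag_start n (x, y)"
  shows "{(x, y), (x + 1, y - 1)} \<in> target_grove n"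
proof -
  have h: "x - y < int n" "- x - y \<le> int n" "y \<le> 0" "even (x + y + int n)" "x + 3 * y > - int n"
    using assms by (auto simp: diag_start_def grove_vertices_iff')
  show ?thesis
  proof (cases "x + y \<le> 0")
    case True
    define i where "i = - (x + y)"
    have "i mod 2 = int n mod 2" using h(4) unfolding i_def by presburger
    moreover have "- y < (int n - i) div 2" using h(4,5) unfolding i_def by presburger
    moreover have "0 \<le> i" "i < int n" "0 \<le> - y" using h True unfolding i_def by linarith+
    moreover have "{(x, y), (x + 1, y - 1)} = {(- i + - y, - (- y)), (- i + - y + 1, - (- y) - 1)}"
      by (simp add: i_def)
    ultimately show ?thesis unfolding target_grove_def by blast
  next
    case False
    define i where "i = x + y"
    have "i mod 2 = int n mod 2" using h(4) unfolding i_def by presburger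
    moreover have "- y < (int n - i) div 2" using h(1,4) unfolding i_def by presburger
    moreover have "0 < i" "i < int n" "0 \<le> - y" using h False unfolding i_def by linarith+
    moreover have "{(x, y), (x + 1, y - 1)} = {(i + - y, - (- y)), (i + - y + 1, - (- y) - 1)}"
      by (simp add: i_def)
    ultimately show ?thesis unfolding target_grove_def by blast
  qed
qed

lemma row_target:
  assumes "row_start n (x, y)"
  shows "{(x, y), (x - 2, y)} \<in> target_grove n"
proof -
  have h: "x - y \<le> int n" "- x - y < int n" "y \<le> 0" "even (x + y + int n)" "x + 3 * y \<le> - int n"
    using assms by (auto simp: row_start_def grove_vertices_iff')
  show ?thesis
  proof (cases "- 2 * y \<le> int n")
    case True
    define d i where "d = - y" and "i = int n + 2 * y"
    obtain s where s: "x = - int n + 3 * d - 2 * s"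
    proof -
      have "\<exists>s. x = - int n + 3 * d - 2 * s" using h(4) unfolding d_def by presburger
      then show ?thesis using that by blast
    qed
    have "i mod 2 = int n mod 2" unfolding i_def by simp
    moreover have "d = (int n - i) div 2" by (simp add: i_def d_def)
    moreover have "0 \<le> i" "i < int n" "0 \<le> s" "s < d" using h True s unfolding i_def d_def by linarith+
    moreover have "{(x, y), (x - 2, y)} = {(- i + d - 2 * s, - d), (- i + d - 2 * s - 2, - d)}"
      by (simp add: i_def d_def s algebra_simps)
    ultimately show ?thesis unfolding target_grove_def by blast
  next
    case False
    define i where "i = - y"
    obtain s where s: "x = - int n + i + 2 * s + 2"
    proof -
      have "\<exists>s. x = - int n + i + 2 * s + 2" using h(4) unfolding i_def by presburger
      then show ?thesis using that by blast
    qed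
    have "int n < 2 * i" "i < int n" "0 \<le> s" "s < int n - i" using h False s unfolding i_def by linarith+
    moreover have "{(x, y), (x - 2, y)} = {(- int n + i + 2 * s, - i), (- int n + i + 2 * s + 2, - i)}"
      by (auto simp: i_def s)
    ultimately show ?thesis unfolding target_grove_def by blast
  qed
qed

text \<open>In the target grove a diagonal is followed back to the top side, a horizontal run to the west
  side.\<close>

definition origin :: "nat \<Rightarrow> point \<Rightarrow> point" where
  "origin n = (\<lambda>(x, y). if x + 3 * y > - int n then (x + y, 0) else (- int n - y, y))"

lemma conn_origin:
  assumes "(x, y) \<in> grove_vertices n"
  shows "conn (target_grove n) (origin n (x, y)) (x, y)"
proof (cases "x + 3 * y > - int n")
  case True
  show ?thesis
    using assms True
  proof (induction "nat (- y)" arbitrary: x y)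
    case 0
    then have "y = 0" unfolding grove_vertices_iff' by linarith
    then show ?case using 0 by (simp add: origin_def)
  next
    case (Suc k)
    have h: "x - y \<le> int n" "- x - y \<le> int n" "y < 0" "even (x + y + int n)"
      using Suc.prems(1) Suc.hyps(2) unfolding grove_vertices_iff' by auto
    have "even (x - 1 + (y + 1) + int n)" using h(4) by simp
    then have V: "(x - 1, y + 1) \<in> grove_vertices n" using h unfolding grove_vertices_iff' by linarith
    have A: "x - 1 + 3 * (y + 1) > - int n" using Suc.prems(2) by simp
    have "diag_start n (x - 1, y + 1)" using V A h(1) by (simp add: diag_start_def)
    then have "conn (target_grove n) (x - 1, y + 1) (x, y)"
      using conn_edge[OF diag_target] by fastforce
    moreover have "k = nat (- (y + 1))" using Suc.hyps(2) h(3) by linarith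
    then have "conn (target_grove n) (origin n (x - 1, y + 1)) (x - 1, y + 1)"
      by (rule Suc.hyps(1)[OF _ V A])
    moreover have "origin n (x - 1, y + 1) = origin n (x, y)"
      using A Suc.prems(2) by (simp add: origin_def)
    ultimately show ?case by (metis conn_trans)
  qed
next
  case False
  show ?thesis
    using assms False
  proof (induction "nat (x + int n)" arbitrary: x rule: less_induct)
    case less
    have h: "x - y \<le> int n" "- x - y \<le> int n" "y \<le> 0" "even (x + y + int n)"
      using less.prems(1) unfolding grove_vertices_iff' by auto
    show ?case
    proof (cases "- x - y = int n")
      case True
      then have "x = - int n - y" by simp
      then show ?thesis using less.prems(2) by (simp add: origin_def)
    next
      case False
      have "- x - y + 2 \<le> int n" using False h(2,4) by presburger
      moreover have "even (x - 2 + y + int n)" using h(4) by simp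
      ultimately have V: "(x - 2, y) \<in> grove_vertices n" using h unfolding grove_vertices_iff' by linarith
      have "row_start n (x, y)" using less.prems h False by (simp add: row_start_def)
      then have "conn (target_grove n) (x - 2, y) (x, y)"
        using conn_sym[OF conn_edge[OF row_target]] by blast
      moreover have "nat (x - 2 + int n) < nat (x + int n)"
        using V unfolding grove_vertices_iff' by linarith
      then have "conn (target_grove n) (origin n (x - 2, y)) (x - 2, y)"
        using less.hyps[OF _ V] less.prems(2) by simp
      moreover have "origin n (x - 2, y) = origin n (x, y)"
        using less.prems(2) by (simp add: origin_def)
      ultimately show ?thesis by (metis conn_trans)
    qed
  qed
qed

lemma lb_west_pair:
  assumes "n \<ge> 1" "0 \<le> d" "2 * d \<le> int n"
  shows "lb n (- int n + 2 * d, 0) = lb n (- int n + d, - d)"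
  using corner.lb_pair[OF corner_west[OF assms(1)] assms(2,3)] by (simp add: west_pt_def)

text \<open>Makes the label of the origin constant on components, so that different labels stay
  separated. The origin itself changes only along the last edge of a diagonal that turns into a row,
  and the two origins then lie in one boundary set.\<close>

lemma lb_origin_edge:
  assumes n: "n \<ge> 1" and e: "{a, b} \<in> target_grove n"
  shows "lb n (origin n a) = lb n (origin n b)"
  using e
proof (cases rule: target_edgeE)
  case (diag x y)
  have h: "x - y < int n" "- x - y \<le> int n" "y \<le> 0" "even (x + y + int n)" "x + 3 * y > - int n"
    using diag(2) by (auto simp: diag_start_def grove_vertices_iff')
  have "lb n (origin n (x, y)) = lb n (origin n (x + 1, y - 1))"
  proof (cases "x + 1 + 3 * (y - 1) > - int n")
    case True
    then show ?thesis using h(5) by (simp add: origin_def)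
  next
    case False
    then have x: "x = - int n + 2 - 3 * y" using h(4,5) by presburger
    have "lb n (- int n + 2 * (1 - y), 0) = lb n (- int n + (1 - y), - (1 - y))"
      using h(1,3) x by (intro lb_west_pair[OF n]) presburger+
    then show ?thesis using False h(5) by (simp add: origin_def x algebra_simps)
  qed
  then show ?thesis using diag(1) by (auto simp: doubleton_eq_iff)
next
  case (row x y)
  then have "lb n (origin n (x, y)) = lb n (origin n (x - 2, y))"
    by (auto simp: row_start_def origin_def)
  then show ?thesis using row(1) by (auto simp: doubleton_eq_iff)
qed

lemma lb_origin_node:
  assumes n: "n \<ge> 1" and w: "w \<in> nodes n"
  shows "lb n (origin n w) = lb n w"
proof -
  obtain x y where xy: "w = (x, y)" by fastforce
  have h: "x - y \<le> int n" "- x - y \<le> int n" "y \<le> 0" "y = 0 \<or> x - y = int n \<or> - x - y = int n"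
    using w unfolding xy nodes_iff' grove_vertices_iff' by blast+
  consider "x + 3 * y > - int n" "y = 0" | "x + 3 * y > - int n" "x - y = int n"
    | "x + 3 * y \<le> - int n" "x = - int n - y" | "x + 3 * y \<le> - int n" "x - y = int n"
    using h by linarith
  then show ?thesis
  proof cases
    case 2
    have "lb n (east_pt n (- y) 0) = lb n (east_pt n 0 (- y))"
      using 2 h by (intro corner.lb_pair[OF corner_east[OF n]]) linarith+
    moreover have "x = int n + y" using 2 by simp
    ultimately show ?thesis using 2(1) by (simp add: xy origin_def east_pt_def add.commute)
  next
    case 4
    have "lb n (south_pt n (int n + y) 0) = lb n (south_pt n 0 (int n + y))"
      using 4 h(1-3) by (intro corner.lb_pair[OF corner_south[OF n]]) presburger+
    moreover have "south_pt n (int n + y) 0 = (x, y)" "south_pt n 0 (int n + y) = (- int n - y, y)"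
      using 4(2) by (simp_all add: south_pt_def)
    ultimately show ?thesis using 4(1) by (simp add: xy origin_def)
  qed (simp_all add: xy origin_def)
qed

text \<open>The edge used is the last one of the diagonal: its upper end has its origin on the top
  side, its lower end on the west side.\<close>

lemma target_west_pair:
  assumes "0 \<le> d" "2 * d \<le> int n"
  shows "conn (target_grove n) (- int n + 2 * d, 0) (- int n + d, - d)"
proof (cases "d = 0")
  case False
  let ?x = "- int n + 3 * d - 1" let ?y = "- d + 1"
  have V: "(?x, ?y) \<in> grove_vertices n" "(?x + 1, ?y - 1) \<in> grove_vertices n"
    using assms False by (auto simp: grove_vertices_iff')
  have "diag_start n (?x, ?y)" using V assms by (simp add: diag_start_def)
  then have "conn (target_grove n) (?x, ?y) (?x + 1, ?y - 1)" by (rule conn_edge[OF diag_target])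
  moreover have "origin n (?x, ?y) = (- int n + 2 * d, 0)" by (simp add: origin_def)
  moreover have "origin n (?x + 1, ?y - 1) = (- int n + d, - d)" by (simp add: origin_def)
  ultimately show ?thesis
    using conn_trans[OF conn_trans[OF conn_origin[OF V(1)]] conn_sym[OF conn_origin[OF V(2)]]] by simp
qed simp

lemma target_same:
  assumes n: "n \<ge> 1" and w: "w \<in> nodes n" "w' \<in> nodes n" "lb n w = lb n w'"
  shows "conn (target_grove n) w w'"
proof -
  \<comment> \<open>For south labels the left end is chosen, in contrast to the skeleton, because
    rows are followed back to the west side.\<close>
  define rep where "rep = (\<lambda>l :: int \<times> int. if fst l = 0 then (int n - snd l, 0) else if fst l = 1
    then (snd l - int n, 0) else if fst l = 2 then (- (int n - snd l div 2), - (snd l div 2)) else (0, 0 :: int))"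
  have *: "conn (target_grove n) (rep (lb n w)) w" if w: "w \<in> nodes n" for w
  proof -
    obtain x y where xy: "w = (x, y)" by fastforce
    have V: "(x, y) \<in> grove_vertices n" using w xy nodes_subset by blast
    have nd: "y = 0 \<or> x - y = int n \<or> - x - y = int n" using w unfolding xy nodes_iff' by blast
    have bd: "x - y \<le> int n" "- x - y \<le> int n" "y \<le> 0" using V unfolding grove_vertices_iff' by blast+
    have "(\<exists>c. lb n (x, y) = (0, c)) \<or> (\<exists>c. lb n (x, y) = (1, c)) \<or> (\<exists>c. lb n (x, y) = (2, c)) \<or>
      lb n (x, y) = (3, 0)" by (simp add: lb_def)
    then consider (W) c where "lb n (x, y) = (0, c)" | (E) c where "lb n (x, y) = (1, c)"
      | (S) c where "lb n (x, y) = (2, c)" | (M) "lb n (x, y) = (3, 0)"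
      by blast
    then show ?thesis
    proof cases
      case W
      then have h: "x < 0" "x < int n + 3 * y" "c = int n + y - x" by (simp_all add: lb_eq_iff)
      have "y = 0 \<or> - x - y = int n" using h nd bd by linarith
      then show ?thesis
      proof
        assume "y = 0"
        then show ?thesis using W h by (simp add: rep_def xy)
      next
        assume a: "- x - y = int n"
        then have x: "x = - int n - y" by simp
        have "conn (target_grove n) (- int n + 2 * (- y), 0) (- int n + (- y), - (- y))"
          using bd h a by (intro target_west_pair) linarith+
        then show ?thesis using W h by (simp add: rep_def xy x)
      qed
    next
      case E
      then have h: "x > 0" "- x < int n + 3 * y" "c = int n + y + x" by (simp_all add: lb_eq_iff)
      have "x + 3 * y > - int n" using h nd bd by linarith
      then show ?thesis using conn_origin[OF V] E h by (simp add: rep_def xy origin_def add.commute)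
    next
      case S
      then have h: "x > int n + 3 * y" "- x > int n + 3 * y" "c = - 2 * y" by (simp_all add: lb_eq_iff)
      have "c div 2 = - y" using h(3) by simp
      moreover have "\<not> x + 3 * y > - int n" using h nd bd by linarith
      ultimately show ?thesis using conn_origin[OF V] S by (simp add: rep_def xy origin_def)
    next
      case M
      then have h: "\<not> (x < 0 \<and> x < int n + 3 * y)" "\<not> (x > 0 \<and> - x < int n + 3 * y)"
        "\<not> (x > int n + 3 * y \<and> - x > int n + 3 * y)" by (simp_all add: lb_eq_iff)
      have r: "rep (lb n (x, y)) = (0, 0)" using M by (simp add: rep_def xy)
      have "x = 0 \<and> y = 0 \<or> y < 0 \<and> int n = - 2 * y" using h nd bd n by linarith
      then show ?thesis
      proof
        assume "x = 0 \<and> y = 0"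
        then show ?thesis using r unfolding xy by simp
      next
        assume y: "y < 0 \<and> int n = - 2 * y"
        have t: "conn (target_grove n) (- int n + 2 * (- y), 0) (- int n + (- y), - (- y))"
          using y by (intro target_west_pair) linarith+
        have "x = y \<or> x = - y" using y nd bd by linarith
        then show ?thesis
        proof
          assume "x = y"
          then show ?thesis using t y unfolding xy r by simp
        next
          assume x: "x = - y"
          have "conn (target_grove n) (y, y) (x, y)" using conn_origin[OF V] y x by (simp add: origin_def)
          moreover have "conn (target_grove n) (0, 0) (y, y)" using t y by simp
          ultimately show ?thesis unfolding xy r by (rule conn_trans[rotated])
        qed
      qed
    qed
  qed
  show ?thesis using conn_trans[OF conn_sym[OF *[OF w(1)]]] *[OF w(2)] w(3) by simp
qed

lemma grove_target:
  assumes n: "n \<ge> 1"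
  shows "grove n (target_grove n)"
  unfolding grove_def
proof (intro conjI ballI)
  show "target_grove n \<subseteq> lattice_edges n"
  proof
    fix e assume "e \<in> target_grove n"
    then show "e \<in> lattice_edges n"
    proof (cases rule: target_edgeE)
      case (diag x y)
      have h: "x - y < int n" "- x - y \<le> int n" "y \<le> 0" "even (x + y + int n)"
        using diag(2) by (auto simp: diag_start_def grove_vertices_iff')
      have "x - y + 2 \<le> int n" using h(1,4) by presburger
      then have "(x + 1, y - 1) \<in> grove_vertices n" using h by (simp add: grove_vertices_iff')
      then show ?thesis unfolding diag(1) using diag(2)
        by (intro neighbours_lattice_edge) (auto simp: diag_start_def)
    next
      case (row x y)
      have h: "x - y \<le> int n" "- x - y < int n" "y \<le> 0" "even (x + y + int n)"
        using row(2) by (auto simp: row_start_def grove_vertices_iff')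
      have "- x - y + 2 \<le> int n" using h(2,4) by presburger
      then have "(x - 2, y) \<in> grove_vertices n" using h by (simp add: grove_vertices_iff')
      then show ?thesis unfolding row(1) using row(2)
        by (intro neighbours_lattice_edge) (auto simp: row_start_def)
    qed
  qed
  define out where "out = (\<lambda>(x, y). if x + 3 * y > - int n then (x + 1, y - 1) else (x - 2, y :: int))"
  \<comment> \<open>On diagonals the value falls with \<open>y\<close> and stays above
    \<open>4 * int n\<close>; on rows it falls with \<open>x\<close> and is at most
    \<open>2 * int n\<close>. So it also falls at the turn.\<close>
  define rk where "rk = (\<lambda>(x, y). nat (if x + 3 * y > - int n then 5 * int n + 5 + y else x + int n))"
  show "forest (target_grove n)"
  proof (rule forest_ranking)
    fix e assume "e \<in> target_grove n"
    then show "\<exists>v. e = {v, out v} \<and> rk (out v) < rk v"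
    proof (cases rule: target_edgeE)
      case (diag x y)
      have "x - y < int n" "- x - y \<le> int n" "y \<le> 0" "x + 3 * y > - int n"
        using diag(2) by (auto simp: diag_start_def grove_vertices_iff')
      then show ?thesis using diag(1) by (intro exI[of _ "(x, y)"]) (auto simp: out_def rk_def)
    next
      case (row x y)
      have "- x - y < int n" "y \<le> 0" "\<not> x + 3 * y > - int n"
        using row(2) by (auto simp: row_start_def grove_vertices_iff')
      then show ?thesis using row(1) by (intro exI[of _ "(x, y)"]) (auto simp: out_def rk_def)
    qed
  qed
  show "\<exists>w \<in> nodes n. conn (target_grove n) v w" if "v \<in> grove_vertices n" for v
  proof -
    obtain x y where v: "v = (x, y)" by fastforce
    have V: "(x, y) \<in> grove_vertices n" using that v by simp
    have "origin n (x, y) \<in> nodes n"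
      using V by (auto simp: origin_def nodes_iff grove_vertices_iff')
    then show ?thesis using conn_sym[OF conn_origin[OF V]] v by blast
  qed
  fix w w' assume w: "w \<in> nodes n" "w' \<in> nodes n"
  show "conn (target_grove n) w w' \<longleftrightarrow> lb n w = lb n w'"
  proof
    assume "conn (target_grove n) w w'"
    then have "lb n (origin n w) = lb n (origin n w')"
      by (induction rule: conn_induct) (auto dest: lb_origin_edge[OF n])
    then show "lb n w = lb n w'" using lb_origin_node[OF n] w by simp
  next
    assume "lb n w = lb n w'"
    then show "conn (target_grove n) w w'" by (rule target_same[OF n w])
  qed
qed

theorem theorem3:
  fixes n :: nat and G :: "point set set"
  assumes "n \<ge> 1"
    and "simplified_grove n G"
  shows "\<exists>(k :: nat) (Gs :: nat \<Rightarrow> point set set).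
           Gs 0 = G \<and>
           (\<forall>t \<le> k. simplified_grove n (Gs t)) \<and>
           (\<forall>t < k. spin n (Gs t) (Gs (Suc t))) \<and>
           Gs k = target_grove n"
proof -
  note eq = simplified_grove_iff_grove[OF assms(1)]
  have g: "grove n G" using assms(2) eq by simp
  have "reach n G (target_grove n)" by (rule groves_connected[OF assms(1) g grove_target[OF assms(1)]])
  then obtain k where "((step n) ^^ k) G (target_grove n)" by (auto simp: rtranclp_power)
  then obtain Gs where Gs: "Gs 0 = G" "Gs k = target_grove n" "\<And>t. t < k \<Longrightarrow> step n (Gs t) (Gs (Suc t))"
    by (auto simp: relpowp_fun_conv)
  have "simplified_grove n (Gs t)" if "t \<le> k" for t
  proof (cases t)
    \<comment> \<open>For \<open>k = 0\<close> there is no spin from which this could be read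
      off.\<close>
    case 0
    then show ?thesis using Gs(1) assms(2) by simp
  next
    case (Suc s)
    then show ?thesis using Gs(3)[of s] that eq by (simp add: step_def)
  qed
  moreover have "spin n (Gs t) (Gs (Suc t))" if "t < k" for t using Gs(3)[OF that] by (simp add: step_def)
  ultimately show ?thesis using Gs(1,2) by blast
qed

end
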